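(* Assume that $a\in H^1(0,1)$ and that there is a constant $a_0>0$ with $a(x)\ge a_0$ for all $x\in[0,1]$; assume also that $|\alpha|<\beta$ and $|\alpha|<K<2\beta-|\alpha|$. Then for any initial data $(y_0,y_1,f(-\tau\,\cdot),\xi_0,\eta_0)\in\mathcal{X}$, the solution $$\Phi(t)=\big(y(\cdot,t),\,y_t(\cdot,t),\,y_t(0,t-\cdot\,\tau),\,y_t(0,t),\,y_t(1,t)\big)=e^{t\mathcal{A}}\big(y_0,y_1,f(-\tau\,\cdot),\xi_0,\eta_0\big)$$ of the closed-loop system tends in $\mathcal{X}$ to $(\Omega,0,0,0,0)$ as $t\to+\infty$, where $\Omega$ is the constant $$\Omega=\frac{1}{\beta-\alpha}\left[\int_0^1y_1\,dx+\alpha\tau\int_0^1f(-\tau x)\,dx+(\beta-\alpha)y_0(0)+m\xi_0+M\eta_0\right].$$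
   Context: Constants: $m,M,\tau,\beta,K>0$ and $\alpha\in\mathbb{R}$; put $\mu=\beta-\alpha$. The closed-loop system (overhead crane with delayed boundary velocity feedback) is $$\begin{cases}y_{tt}(x,t)-(ay_x)_x(x,t)=0,&0<x<1,\ t>0,\\ m y_{tt}(0,t)-(ay_x)(0,t)=-\beta y_t(0,t)+\alpha y_t(0,t-\tau),&t>0,\\ M y_{tt}(1,t)+(ay_x)(1,t)=0,&t>0,\end{cases}$$ with $y(x,0)=y_0(x)$, $y_t(x,0)=y_1(x)$, $y_t(0,-x\tau)=f(-x\tau)$ for $x\in(0,1)$. With $u(x,t)=y_t(0,t-x\tau)$, $z=y_t$, $\xi=y_t(0,t)$, $\eta=y_t(1,t)$ and $\Phi=(y,z,u,\xi,\eta)$ it is written $\dot\Phi=\mathcal{A}\Phi$, $\Phi(0)=(y_0,y_1,f(-\tau\,\cdot),\xi_0,\eta_0)$; for general data in $\mathcal{X}$ the solution means the mild solution $e^{t\mathcal{A}}\Phi(0)$. The state space is $\mathcal{X}=H^1(0,1)\times L^2(0,1)\times L^2(0,1)\times\mathbb{R}^2$, equipped with the inner product $$\langle(y,z,u,\xi,\eta),(\tilde y,\tilde z,\tilde u,\tilde\xi,\tilde\eta)\rangle_{\mathcal{X}}=\int_0^1(a y_x\tilde y_x+z\tilde z)\,dx+K\tau\int_0^1u\tilde u\,dx+m\xi\tilde\xi+M\eta\tilde\eta+\varpi\,\ell(y,z,u,\xi,\eta)\,\ell(\tilde y,\tilde z,\tilde u,\tilde\xi,\tilde\eta),$$ where $\ell(y,z,u,\xi,\eta)=\int_0^1z\,dx+m\xi+M\eta+\mu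 y(0)+\tau\alpha\int_0^1u\,dx$ and $\varpi>0$ is a constant fixed small enough that $\mathcal{X}$ with this inner product is a Hilbert space whose norm is equivalent to the usual product norm. The linear operator $\mathcal{A}$ is defined by $$\mathcal{D}(\mathcal{A})=\{(y,z,u,\xi,\eta)\in\mathcal{X}:\ y\in H^2(0,1),\ z,u\in H^1(0,1),\ \xi=u(0)=z(0),\ \eta=z(1)\},$$ $$\mathcal{A}(y,z,u,\xi,\eta)=\Big(z,\ (ay_x)_x,\ -\tfrac{u_x}{\tau},\ \tfrac1m\big[(ay_x)(0)-\beta\xi+\alpha u(1)\big],\ -\tfrac{(ay_x)(1)}{M}\Big),$$ and it generates a $C_0$-semigroup of contractions $e^{t\mathcal{A}}$ on $\mathcal{X}$. *)

theory Defs
  imports "HOL-Analysis.Analysis"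
begin

section \<open>The space $L^2(0,1)$\<close>

abbreviation leb01 :: "real measure" where
  "leb01 \<equiv> lebesgue_on {0<..<1}"

definition square_integrable :: "(real \<Rightarrow> real) \<Rightarrow> bool" where
  "square_integrable f \<longleftrightarrow> f \<in> borel_measurable leb01 \<and> integrable leb01 (\<lambda>x. (f x)\<^sup>2)"

lemma square_integrable_mult:
  assumes "square_integrable f" "square_integrable g"
  shows "integrable leb01 (\<lambda>x. f x * g x)"
proof (rule Bochner_Integration.integrable_bound)
  show "integrable leb01 (\<lambda>x. (f x)\<^sup>2 + (g x)\<^sup>2)"
    using assms by (auto simp: square_integrable_def)
  show "(\<lambda>x. f x * g x) \<in> borel_measurable leb01"
    using assms by (auto simp: square_integrable_def)
  have "\<bar>u * v\<bar> \<le> u\<^sup>2 + v\<^sup>2" for u v :: real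
  proof -
    have "2 * (\<bar>u\<bar> * \<bar>v\<bar>) \<le> u\<^sup>2 + v\<^sup>2"
      using sum_squares_bound[of "\<bar>u\<bar>" "\<bar>v\<bar>"] by (simp add: mult.assoc)
    then show ?thesis
      using mult_nonneg_nonneg[OF abs_ge_zero[of u] abs_ge_zero[of v]]
      unfolding abs_mult by linarith
  qed
  then show "AE x in leb01. norm (f x * g x) \<le> norm ((f x)\<^sup>2 + (g x)\<^sup>2)"
    by simp
qed

lemma square_integrable_0: "square_integrable (\<lambda>x. 0)"
  by (simp add: square_integrable_def)

lemma square_integrable_const: "square_integrable (\<lambda>x. c)"
proof -
  have "finite_measure leb01"
    by (rule finite_measureI) (simp add: emeasure_restrict_space)
  then show ?thesis
    by (simp add: square_integrable_def finite_measure.integrable_const)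
qed

lemma square_integrable_add:
  assumes "square_integrable f" "square_integrable g"
  shows "square_integrable (\<lambda>x. f x + g x)"
  using assms square_integrable_mult[OF assms]
  by (auto simp: square_integrable_def power2_sum mult.assoc)

lemma square_integrable_cmult:
  assumes "square_integrable f"
  shows "square_integrable (\<lambda>x. c * f x)"
  using assms by (auto simp: square_integrable_def power_mult_distrib)

lemma square_integrable_diff:
  assumes "square_integrable f" "square_integrable g"
  shows "square_integrable (\<lambda>x. f x - g x)"
  using square_integrable_add[OF assms(1) square_integrable_cmult[OF assms(2), of "-1"]] by simp

lemma square_integrable_integrable:
  assumes "square_integrable f"
  shows "integrable leb01 f"
  using square_integrable_mult[OF assms square_integrable_const[of 1]] by simp

quotient_type L2 = "real \<Rightarrow> real" / partial:
  "\<lambda>f g. square_integrable f \<and> square_integrable g \<and> (AE x in leb01. f x = g x)"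
  morphisms rep_L2 abs_L2
proof (rule part_equivpI)
  show "\<exists>f. square_integrable f \<and> square_integrable f \<and> (AE x in leb01. f x = f x)"
    by (rule exI[of _ "\<lambda>x. 0"]) (simp add: square_integrable_0)
qed (auto intro!: sympI transpI elim: AE_mp)

instantiation L2 :: real_vector
begin

lift_definition zero_L2 :: L2 is "\<lambda>x. 0"
  by (simp add: square_integrable_0)

lift_definition plus_L2 :: "L2 \<Rightarrow> L2 \<Rightarrow> L2" is "\<lambda>f g x. f x + g x"
  by (auto intro: square_integrable_add)

lift_definition uminus_L2 :: "L2 \<Rightarrow> L2" is "\<lambda>f x. - f x"
  using square_integrable_cmult[of _ "-1"] by auto

lift_definition minus_L2 :: "L2 \<Rightarrow> L2 \<Rightarrow> L2" is "\<lambda>f g x. f x - g x"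
  by (auto intro: square_integrable_diff)

lift_definition scaleR_L2 :: "real \<Rightarrow> L2 \<Rightarrow> L2" is "\<lambda>c f x. c * f x"
  by (auto intro: square_integrable_cmult)

instance
proof
  fix f g h :: L2 and c d :: real
  show "f + g + h = f + (g + h)"
    by transfer (auto intro!: square_integrable_add simp: add.assoc)
  show "f + g = g + f"
    by transfer (auto intro!: square_integrable_add simp: add.commute)
  show "0 + f = f" by transfer auto
  show "- f + f = 0"
    by transfer (auto simp: square_integrable_0)
  show "f - g = f + - g"
    by transfer (auto intro!: square_integrable_diff)
  show "c *\<^sub>R (f + g) = c *\<^sub>R f + c *\<^sub>R g"
    by transfer (auto intro!: square_integrable_add square_integrable_cmult simp: distrib_left)
  show "(c + d) *\<^sub>R f = c *\<^sub>R f + d *\<^sub>R f"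
    by transfer (auto intro!: square_integrable_add square_integrable_cmult simp: distrib_right)
  show "c *\<^sub>R d *\<^sub>R f = (c * d) *\<^sub>R f"
    by transfer (auto intro!: square_integrable_cmult simp: mult.assoc)
  show "1 *\<^sub>R f = f" by transfer auto
qed

end

instantiation L2 :: real_inner
begin

lift_definition inner_L2 :: "L2 \<Rightarrow> L2 \<Rightarrow> real" is "\<lambda>f g. LINT x|leb01. f x * g x"
  by (rule integral_cong_AE) (auto simp: square_integrable_def)

definition norm_L2 :: "L2 \<Rightarrow> real" where "norm_L2 f = sqrt (inner f f)"
definition dist_L2 :: "L2 \<Rightarrow> L2 \<Rightarrow> real" where "dist_L2 f g = norm (f - g)"
definition sgn_L2 :: "L2 \<Rightarrow> L2" where "sgn_L2 f = f /\<^sub>R norm f"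
definition uniformity_L2 :: "(L2 \<times> L2) filter" where
  "uniformity_L2 = (INF e\<in>{0<..}. principal {(f, g). dist f g < e})"
definition open_L2 :: "L2 set \<Rightarrow> bool" where
  "open_L2 U \<longleftrightarrow> (\<forall>f\<in>U. \<forall>\<^sub>F (f', g) in uniformity. f' = f \<longrightarrow> g \<in> U)"

instance
proof
  fix f g h :: L2 and c :: real
  show "dist f g = norm (f - g)" by (rule dist_L2_def)
  show "sgn f = f /\<^sub>R norm f" by (rule sgn_L2_def)
  show "norm f = sqrt (inner f f)" by (rule norm_L2_def)
  show "inner f g = inner g f" by transfer (simp add: mult.commute)
  show "inner (f + g) h = inner f h + inner g h"
    by transfer (simp add: distrib_right square_integrable_mult)
  show "inner (c *\<^sub>R f) g = c * inner f g"
    by transfer (simp add: mult.assoc)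
  show "0 \<le> inner f f" by transfer simp
  show "inner f f = 0 \<longleftrightarrow> f = 0"
    by transfer
      (auto simp: square_integrable_0 square_integrable_def power2_eq_square
        integral_nonneg_eq_0_iff_AE)
next
  show "(uniformity :: (L2 \<times> L2) filter) = (INF e\<in>{0<..}. principal {(f, g). dist f g < e})"
    by (rule uniformity_L2_def)
next
  fix U :: "L2 set"
  show "open U \<longleftrightarrow> (\<forall>f\<in>U. \<forall>\<^sub>F (f', g) in uniformity. f' = f \<longrightarrow> g \<in> U)"
    by (rule open_L2_def)
qed

end

lemma rep_L2_square_integrable: "square_integrable (rep_L2 f)"
  using Quotient_rep_reflp[OF Quotient_L2] by blast

lemma rep_abs_L2:
  assumes "square_integrable f"
  shows "AE x in leb01. rep_L2 (abs_L2 f) x = f x"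
proof -
  have "square_integrable (rep_L2 (abs_L2 f)) \<and> square_integrable f \<and>
      (AE x in leb01. rep_L2 (abs_L2 f) x = f x)"
    by (rule Quotient_rep_abs[OF Quotient_L2]) (simp add: assms)
  then show ?thesis by simp
qed

lemma rep_L2_0: "AE x in leb01. rep_L2 0 x = 0"
  unfolding zero_L2_def by (rule rep_abs_L2) (rule square_integrable_0)

lemma rep_L2_add: "AE x in leb01. rep_L2 (f + g) x = rep_L2 f x + rep_L2 g x"
  unfolding plus_L2_def
  using rep_abs_L2[OF square_integrable_add[OF rep_L2_square_integrable rep_L2_square_integrable]]
  by simp

lemma rep_L2_scaleR: "AE x in leb01. rep_L2 (c *\<^sub>R f) x = c * rep_L2 f x"
  unfolding scaleR_L2_def
  using rep_abs_L2[OF square_integrable_cmult[OF rep_L2_square_integrable]] by simp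

lemma L2_eq_iff: "f = g \<longleftrightarrow> (AE x in leb01. rep_L2 f x = rep_L2 g x)"
  using Quotient_rel_rep[OF Quotient_L2, of f g] rep_L2_square_integrable by auto

lemma rep_L2_measurable [measurable]: "rep_L2 f \<in> borel_measurable leb01"
  using rep_L2_square_integrable by (auto simp: square_integrable_def)

lemma integrable_rep_L2: "integrable leb01 (rep_L2 f)"
  by (intro square_integrable_integrable rep_L2_square_integrable)


section \<open>Weak derivatives and the space $H^1(0,1)$\<close>

text \<open>
  Test functions are taken in \<open>C\<^sup>1\<^sub>c(0,1)\<close>, as in Brezis; the resulting weak
  derivative is the same as with \<open>C\<^sup>\<infinity>\<^sub>c(0,1)\<close>.
\<close>

definition test_function :: "(real \<Rightarrow> real) \<Rightarrow> bool" where
  "test_function \<phi> \<longleftrightarrow> \<phi> C1_differentiable_on UNIV \<and>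
     (\<exists>C. compact C \<and> C \<subseteq> {0<..<1} \<and> (\<forall>x. x \<notin> C \<longrightarrow> \<phi> x = 0))"

definition has_weak_deriv :: "L2 \<Rightarrow> L2 \<Rightarrow> bool" where
  "has_weak_deriv y g \<longleftrightarrow> (\<forall>\<phi>. test_function \<phi> \<longrightarrow>
     (LINT x|leb01. rep_L2 y x * deriv \<phi> x) = - (LINT x|leb01. rep_L2 g x * \<phi> x))"

lemma test_functionD:
  assumes "test_function \<phi>"
  shows "continuous_on UNIV \<phi>" "continuous_on UNIV (deriv \<phi>)"
    "bounded (range \<phi>)" "bounded (range (deriv \<phi>))"
proof -
  from assms obtain D C where D: "\<And>x. (\<phi> has_vector_derivative D x) (at x)" "continuous_on UNIV D"
    and C: "compact C" "\<And>x. x \<notin> C \<Longrightarrow> \<phi> x = 0"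
    unfolding test_function_def C1_differentiable_on_def by auto
  have D': "(\<phi> has_real_derivative D x) (at x)" for x
    using D(1) by (simp add: has_real_derivative_iff_has_vector_derivative)
  then have dD: "deriv \<phi> = D"
    by (intro ext DERIV_imp_deriv)
  show c: "continuous_on UNIV \<phi>"
    using D' by (intro DERIV_continuous_on) (auto simp: has_field_derivative_at_within)
  show cD: "continuous_on UNIV (deriv \<phi>)" using D dD by simp
  have D0: "D x = 0" if "x \<notin> C" for x
  proof -
    have "open (- C)" using C(1) by (simp add: compact_imp_closed open_Compl)
    then have "((\<lambda>_. 0) has_real_derivative D x) (at x)"
      using that C(2) by (intro has_field_derivative_transform_within_open[OF D', of "- C"]) auto
    then show ?thesis by (metis DERIV_const DERIV_unique)
  qed
  have "bounded (\<phi> ` C)" "bounded (D ` C)"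
    using C(1) c D(2) by (auto intro!: compact_imp_bounded compact_continuous_image
        intro: continuous_on_subset)
  moreover have "range \<phi> \<subseteq> insert 0 (\<phi> ` C)" "range D \<subseteq> insert 0 (D ` C)"
    using C(2) D0 by auto
  ultimately show "bounded (range \<phi>)" "bounded (range (deriv \<phi>))"
    unfolding dD by (meson bounded_insert bounded_subset)+
qed

lemma integrable_rep_L2_mult:
  assumes "continuous_on UNIV \<phi>" "bounded (range \<phi>)"
  shows "integrable leb01 (\<lambda>x. rep_L2 f x * \<phi> x)"
proof -
  obtain B where B: "\<And>x. \<bar>\<phi> x\<bar> \<le> B"
    using assms(2) by (auto simp: bounded_iff)
  have [measurable]: "\<phi> \<in> borel_measurable leb01"
    using borel_measurable_continuous_onI[OF assms(1)]
    by (intro measurable_restrict_space1 measurable_completion) simp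
  show ?thesis
  proof (rule Bochner_Integration.integrable_bound)
    show "integrable leb01 (\<lambda>x. B * rep_L2 f x)"
      using integrable_rep_L2 by auto
    show "AE x in leb01. norm (rep_L2 f x * \<phi> x) \<le> norm (B * rep_L2 f x)"
    proof (rule AE_I2)
      fix x
      have "\<bar>\<phi> x\<bar> \<le> \<bar>B\<bar>" using B[of x] by linarith
      then show "norm (rep_L2 f x * \<phi> x) \<le> norm (B * rep_L2 f x)"
        by (simp add: abs_mult mult.commute mult_right_mono)
    qed
  qed auto
qed

lemma integral_rep_L2_lincomb:
  assumes "continuous_on UNIV \<phi>" "bounded (range \<phi>)"
  shows "(LINT x|leb01. rep_L2 (f + c *\<^sub>R g) x * \<phi> x) =
    (LINT x|leb01. rep_L2 f x * \<phi> x) + c * (LINT x|leb01. rep_L2 g x * \<phi> x)"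
proof -
  have [measurable]: "\<phi> \<in> borel_measurable leb01"
    using borel_measurable_continuous_onI[OF assms(1)]
    by (intro measurable_restrict_space1 measurable_completion) simp
  have "(LINT x|leb01. rep_L2 (f + c *\<^sub>R g) x * \<phi> x) =
    (LINT x|leb01. rep_L2 f x * \<phi> x + c * (rep_L2 g x * \<phi> x))"
    by (rule integral_cong_AE)
      (use rep_L2_add[of f "c *\<^sub>R g"] rep_L2_scaleR[of c g] in \<open>auto simp: algebra_simps\<close>)
  then show ?thesis
    using integrable_rep_L2_mult[OF assms] by simp
qed

lemma has_weak_deriv_lincomb:
  assumes "has_weak_deriv y g" "has_weak_deriv y' g'"
  shows "has_weak_deriv (y + c *\<^sub>R y') (g + c *\<^sub>R g')"
  using assms test_functionD by (simp add: has_weak_deriv_def integral_rep_L2_lincomb)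

lemma has_weak_deriv_0: "has_weak_deriv 0 0"
proof -
  have "(LINT x|leb01. rep_L2 0 x * \<phi> x) = 0" for \<phi>
    by (rule integral_eq_zero_AE) (use rep_L2_0 in auto)
  then show ?thesis by (simp add: has_weak_deriv_def)
qed

lemma has_real_derivative_pos_part_sq:
  "((\<lambda>x::real. (max 0 x)\<^sup>2) has_real_derivative 2 * max 0 x) (at x)"
proof -
  consider "x < 0" | "x > 0" | "x = 0" by linarith
  then show ?thesis
  proof cases
    case 1
    have "((\<lambda>x::real. (max 0 x)\<^sup>2) has_real_derivative 0) (at x)"
      by (rule has_field_derivative_transform_within_open[of "\<lambda>_. 0" _ _ "{..<0}"]) (use 1 in auto)
    then show ?thesis using 1 by simp
  next
    case 2
    have "((\<lambda>x::real. x\<^sup>2) has_real_derivative 2 * x) (at x)"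
      by (auto intro!: derivative_eq_intros)
    then have "((\<lambda>x::real. (max 0 x)\<^sup>2) has_real_derivative 2 * x) (at x)"
      by (rule has_field_derivative_transform_within_open[of _ _ _ "{0<..}"]) (use 2 in auto)
    then show ?thesis using 2 by simp
  next
    case 3
    have "((\<lambda>h::real. (max 0 h)\<^sup>2 / h) \<longlongrightarrow> 0) (at 0)"
    proof (rule Lim_null_comparison)
      show "\<forall>\<^sub>F h::real in at 0. norm ((max 0 h)\<^sup>2 / h) \<le> \<bar>h\<bar>"
        by (rule always_eventually) (auto simp: max_def power2_eq_square)
      show "((\<lambda>h::real. \<bar>h\<bar>) \<longlongrightarrow> 0) (at 0)"
        by (intro tendsto_rabs_zero) simp
    qed
    then show ?thesis using 3 by (simp add: DERIV_def)
  qed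
qed

definition bump :: "real \<Rightarrow> real \<Rightarrow> real \<Rightarrow> real" where
  "bump c d x = (max 0 (x - c))\<^sup>2 * (max 0 (d - x))\<^sup>2"

lemma test_function_bump:
  assumes "0 < c" "d < 1" "0 < n"
  shows "test_function (\<lambda>x. 1 - (1 - bump c d x) ^ n)"
proof -
  define D where "D x = 2 * max 0 (x - c) * (max 0 (d - x))\<^sup>2 +
      (- 2 * max 0 (d - x)) * (max 0 (x - c))\<^sup>2" for x
  have 1: "((\<lambda>x. (max 0 (x - c))\<^sup>2) has_real_derivative 2 * max 0 (x - c)) (at x)" for x
    using DERIV_shift[of "\<lambda>x. (max 0 x)\<^sup>2" "2 * max 0 (x - c)" x "- c"]
      has_real_derivative_pos_part_sq[of "x - c"] by simp
  have 2: "((\<lambda>x. (max 0 (d - x))\<^sup>2) has_real_derivative - 2 * max 0 (d - x)) (at x)" for x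
  proof -
    have "((\<lambda>x. d - x) has_real_derivative - 1) (at x)"
      by (auto intro!: derivative_eq_intros)
    from DERIV_chain2[where f = "\<lambda>x. (max 0 x)\<^sup>2" and g = "\<lambda>x. d - x",
        OF has_real_derivative_pos_part_sq[of "d - x"] this]
    show ?thesis by simp
  qed
  have 3: "(bump c d has_real_derivative D x) (at x)" for x
    using DERIV_mult[OF 1[of x] 2[of x]]
    unfolding D_def bump_def[abs_def] by (simp add: algebra_simps)
  have 4: "((\<lambda>x. 1 - (1 - bump c d x) ^ n) has_real_derivative
      real n * (1 - bump c d x) ^ (n - 1) * D x) (at x)" for x
    by (rule derivative_eq_intros 3 refl)+ simp
  have cb: "continuous_on UNIV (bump c d)"
    unfolding bump_def[abs_def] by (intro continuous_intros)
  have cD: "continuous_on UNIV D"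
    unfolding D_def[abs_def] by (intro continuous_intros)
  have "(\<lambda>x. 1 - (1 - bump c d x) ^ n) C1_differentiable_on UNIV"
    unfolding C1_differentiable_on_def
    using 4 cb cD
    by (intro exI[of _ "\<lambda>x. real n * (1 - bump c d x) ^ (n - 1) * D x"])
      (auto intro!: continuous_intros simp: has_real_derivative_iff_has_vector_derivative)
  moreover have "1 - (1 - bump c d x) ^ n = 0" if "x \<notin> {c..d}" for x
    using that by (auto simp: bump_def max_def)
  ultimately show ?thesis
    unfolding test_function_def using assms by (intro conjI exI[of _ "{c..d}"]) auto
qed

lemma bump_bounds:
  assumes "0 \<le> c" "d \<le> 1" "0 < x" "x < 1"
  shows "0 \<le> bump c d x" "bump c d x \<le> 1"
proof -
  show "0 \<le> bump c d x" by (simp add: bump_def)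
  have "(max 0 (x - c))\<^sup>2 \<le> 1" "(max 0 (d - x))\<^sup>2 \<le> 1"
    using assms by (auto intro!: power_le_one simp: max_def)
  then show "bump c d x \<le> 1"
    unfolding bump_def by (intro mult_le_one) auto
qed

lemma bump_limit:
  assumes "0 \<le> c" "d \<le> 1" "0 < x" "x < 1"
  shows "(\<lambda>n. 1 - (1 - bump (c + 1 / real (Suc n)) (d - 1 / real (Suc n)) x) ^ Suc n)
    \<longlonglongrightarrow> indicat_real {c<..<d} x"
proof (cases "x \<in> {c<..<d}")
  case False
  have "bump (c + 1 / real (Suc n)) (d - 1 / real (Suc n)) x = 0" for n
  proof -
    have "x - (c + 1 / real (Suc n)) \<le> 0 \<or> (d - 1 / real (Suc n)) - x \<le> 0"
    proof -
      have "0 \<le> 1 / real (Suc n)" by simp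
      moreover have "x \<le> c \<or> d \<le> x" using False by auto
      ultimately show ?thesis by linarith
    qed
    then show ?thesis by (auto simp: bump_def max_def)
  qed
  then show ?thesis using False by simp
next
  case True
  let ?b = "\<lambda>n. bump (c + 1 / real (Suc n)) (d - 1 / real (Suc n)) x"
  define e where "e = min (x - c) (d - x)"
  have e: "0 < e" using True by (simp add: e_def)
  then obtain N where N: "1 / real (Suc N) < e"
    using nat_approx_posE by blast
  define r where "r = ?b N"
  have r: "0 < r" using N unfolding r_def bump_def e_def by (auto simp: max_def)
  have mono: "r \<le> ?b n" if "N \<le> n" for n
  proof -
    have "1 / real (Suc n) \<le> 1 / real (Suc N)" using that by (simp add: frac_le)
    then show ?thesis unfolding r_def bump_def
      by (intro mult_mono power_mono) auto
  qed
  have b: "0 \<le> ?b n" "?b n \<le> 1" for n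
  proof -
    have "0 < 1 / real (Suc n)" by simp
    then have "0 \<le> c + 1 / real (Suc n)" "d - 1 / real (Suc n) \<le> 1"
      using assms(1,2) by linarith+
    then show "0 \<le> ?b n" "?b n \<le> 1"
      using assms(3,4) by (simp_all only: bump_bounds)
  qed
  have "(\<lambda>n. (1 - ?b n) ^ Suc n) \<longlonglongrightarrow> 0"
  proof (rule Lim_null_comparison)
    show "\<forall>\<^sub>F n in sequentially. norm ((1 - ?b n) ^ Suc n) \<le> (1 - r) ^ Suc n"
      using eventually_ge_at_top[of N]
    proof eventually_elim
      case (elim n)
      then show ?case using mono[of n] b[of n]
        unfolding norm_power by (intro power_mono) auto
    qed
    have "\<bar>1 - r\<bar> < 1" using r b[of N] by (auto simp: r_def)
    then show "(\<lambda>n. (1 - r) ^ Suc n) \<longlonglongrightarrow> 0"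
      by (intro LIMSEQ_Suc LIMSEQ_power_zero) simp
  qed
  then have "(\<lambda>n. 1 - (1 - ?b n) ^ Suc n) \<longlonglongrightarrow> 1 - 0"
    by (intro tendsto_intros)
  then show ?thesis using True by simp
qed

lemma weak_zero_interval:
  assumes "\<And>\<phi>. test_function \<phi> \<Longrightarrow> (LINT x|leb01. rep_L2 h x * \<phi> x) = 0"
    and cd: "0 \<le> c" "d \<le> 1"
  shows "(LINT x|leb01. rep_L2 h x * indicat_real {c<..<d} x) = 0"
proof -
  let ?\<phi> = "\<lambda>n x. 1 - (1 - bump (c + 1 / real (Suc n)) (d - 1 / real (Suc n)) x) ^ Suc n"
  have tf: "test_function (?\<phi> n)" for n
  proof -
    have "0 < 1 / real (Suc n)" by simp
    then show ?thesis using cd by (intro test_function_bump) linarith+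
  qed
  have [measurable]: "?\<phi> n \<in> borel_measurable leb01" for n
    using borel_measurable_continuous_onI[OF test_functionD(1)[OF tf[of n]]]
    by (intro measurable_restrict_space1 measurable_completion) simp
  have [measurable]: "indicat_real {c<..<d} \<in> borel_measurable leb01"
    by (intro measurable_restrict_space1 measurable_completion) simp
  have "(\<lambda>n. LINT x|leb01. rep_L2 h x * ?\<phi> n x) \<longlonglongrightarrow>
      (LINT x|leb01. rep_L2 h x * indicat_real {c<..<d} x)"
  proof (rule integral_dominated_convergence)
    show "integrable leb01 (\<lambda>x. \<bar>rep_L2 h x\<bar>)"
      using integrable_rep_L2 by simp
    show "AE x in leb01. (\<lambda>n. rep_L2 h x * ?\<phi> n x) \<longlonglongrightarrow> rep_L2 h x * indicat_real {c<..<d} x"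
      using bump_limit[OF cd] by (intro AE_I2 tendsto_mult tendsto_const) simp
    fix n
    show "AE x in leb01. norm (rep_L2 h x * ?\<phi> n x) \<le> \<bar>rep_L2 h x\<bar>"
    proof (rule AE_I2)
      fix x assume "x \<in> space leb01"
      then have "0 < x" "x < 1" by auto
      moreover have "0 < 1 / real (Suc n)" by simp
      then have "0 \<le> c + 1 / real (Suc n)" "d - 1 / real (Suc n) \<le> 1"
        using cd by linarith+
      ultimately have "0 \<le> bump (c + 1 / real (Suc n)) (d - 1 / real (Suc n)) x"
        "bump (c + 1 / real (Suc n)) (d - 1 / real (Suc n)) x \<le> 1"
        by (simp_all only: bump_bounds)
      then have "0 \<le> (1 - bump (c + 1 / real (Suc n)) (d - 1 / real (Suc n)) x) ^ Suc n"
        "(1 - bump (c + 1 / real (Suc n)) (d - 1 / real (Suc n)) x) ^ Suc n \<le> 1"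
        by (auto intro!: power_le_one zero_le_power simp del: power_Suc)
      then have "\<bar>?\<phi> n x\<bar> \<le> 1" by (simp del: power_Suc of_nat_Suc)
      then show "norm (rep_L2 h x * ?\<phi> n x) \<le> \<bar>rep_L2 h x\<bar>"
        by (simp add: abs_mult mult_left_le del: power_Suc of_nat_Suc)
    qed
  qed measurable
  then show ?thesis
    using assms(1)[OF tf] by (simp add: LIMSEQ_const_iff del: power_Suc of_nat_Suc)
qed

lemma weak_zero_borel:
  assumes "\<And>\<phi>. test_function \<phi> \<Longrightarrow> (LINT x|leb01. rep_L2 h x * \<phi> x) = 0"
    and A: "A \<in> sets (borel :: real measure)"
  shows "(LINT x|leb01. rep_L2 h x * indicat_real A x) = 0"
proof -
  have [measurable]: "indicat_real A \<in> borel_measurable leb01" if "A \<in> sets borel" for A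
    using that by (intro measurable_restrict_space1 measurable_completion) simp
  have int: "integrable leb01 (\<lambda>x. rep_L2 h x * indicat_real A x)" if "A \<in> sets borel" for A
    using that integrable_rep_L2[of h]
    by (intro Bochner_Integration.integrable_bound[OF integrable_rep_L2[of h]])
      (auto split: split_indicator)
  have full: "(LINT x|leb01. rep_L2 h x) = 0"
    using weak_zero_interval[OF assms(1), of 0 1]
    by (subst Bochner_Integration.integral_cong[OF refl, of _ _ "\<lambda>x. rep_L2 h x * indicat_real {0<..<1} x"])
      (auto split: split_indicator)
  have gen: "sets (borel :: real measure) = sigma_sets UNIV (range (\<lambda>(a, b). {a<..<b}))"
    using arg_cong[OF borel_eq_box, of "sets :: real measure \<Rightarrow> _"] by (simp add: box_real)
  have "Int_stable (range (\<lambda>(a, b). {a<..<b::real}))"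
    by (auto simp: Int_stable_def)
  moreover have "range (\<lambda>(a, b). {a<..<b::real}) \<subseteq> Pow UNIV" by simp
  moreover have "A \<in> sigma_sets UNIV (range (\<lambda>(a, b). {a<..<b::real}))"
    using A unfolding gen .
  ultimately
  show ?thesis
  proof (induction rule: sigma_sets_induct_disjoint)
    case (basic B)
    then obtain a b where B: "B = {a<..<b}" by auto
    have "(LINT x|leb01. rep_L2 h x * indicat_real B x) =
      (LINT x|leb01. rep_L2 h x * indicat_real {max 0 a<..<min 1 b} x)"
      by (rule Bochner_Integration.integral_cong) (auto simp: B split: split_indicator)
    then show ?case using weak_zero_interval[OF assms(1)] by simp
  next
    case empty
    then show ?case by simp
  next
    case (compl B)
    then have B: "B \<in> sets borel" by (simp add: gen)
    have "(LINT x|leb01. rep_L2 h x * indicat_real (UNIV - B) x) =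
      (LINT x|leb01. rep_L2 h x - rep_L2 h x * indicat_real B x)"
      by (rule Bochner_Integration.integral_cong) (auto split: split_indicator)
    then show ?case
      using int[OF B] integrable_rep_L2[of h] compl full by simp
  next
    case (union B)
    then have B: "B i \<in> sets borel" for i by (auto simp: gen)
    have UB: "(\<Union>i. B i) \<in> sets borel" using B by auto
    have "set_lebesgue_integral leb01 (\<Union>i. B i \<inter> {0<..<1}) (rep_L2 h) =
      (\<Sum>i. set_lebesgue_integral leb01 (B i \<inter> {0<..<1}) (rep_L2 h))"
    proof (rule lebesgue_integral_countable_add)
      show "B i \<inter> {0<..<1} \<in> sets leb01" for i
        using B by (auto simp: sets_restrict_space)
      show "i \<noteq> j \<Longrightarrow> (B i \<inter> {0<..<1}) \<inter> (B j \<inter> {0<..<1}) = {}" for i j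
        using union(1) by (auto simp: disjoint_family_on_def)
      have "integrable leb01 (\<lambda>x. indicator (\<Union>i. B i \<inter> {0<..<1}) x *\<^sub>R rep_L2 h x)"
        by (rule Bochner_Integration.integrable_cong[THEN iffD1, OF refl _ int[OF UB]])
          (auto split: split_indicator)
      then show "set_integrable leb01 (\<Union>i. B i \<inter> {0<..<1}) (rep_L2 h)"
        by (simp add: set_integrable_def)
    qed
    moreover have "set_lebesgue_integral leb01 (B i \<inter> {0<..<1}) (rep_L2 h) = 0" for i
      unfolding set_lebesgue_integral_def
      by (subst union(3)[of i, symmetric], rule Bochner_Integration.integral_cong)
        (auto split: split_indicator)
    moreover have "set_lebesgue_integral leb01 (\<Union>i. B i \<inter> {0<..<1}) (rep_L2 h) =
      (LINT x|leb01. rep_L2 h x * indicat_real (\<Union>i. B i) x)"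
      unfolding set_lebesgue_integral_def
      by (rule Bochner_Integration.integral_cong) (auto split: split_indicator)
    ultimately show ?case by simp
  qed
qed

lemma weak_zero_imp_zero:
  assumes "\<And>\<phi>. test_function \<phi> \<Longrightarrow> (LINT x|leb01. rep_L2 h x * \<phi> x) = 0"
  shows "h = 0"
proof -
  have "AE x in leb01. rep_L2 h x = 0"
  proof (rule density_unique_real)
    show "integrable leb01 (rep_L2 h)" by (rule integrable_rep_L2)
    show "integrable leb01 (\<lambda>x. 0::real)" by simp
    fix A assume "A \<in> sets leb01"
    then have A: "A \<in> sets lebesgue" "A \<subseteq> {0<..<1}"
      by (auto simp: sets_restrict_space)
    obtain C N where C: "fsigma C" "N \<in> null_sets lebesgue" "C \<union> N = A" "disjnt C N"
      using lebesgue_set_almost_fsigma[OF A(1)] by metis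
    have Cb: "C \<in> sets borel" using C(1) by (auto elim!: fsigma.cases)
    have "AE x in lebesgue. x \<notin> N"
      using C(2) by (rule AE_not_in)
    then have N: "AE x in leb01. x \<notin> N"
      by (subst AE_restrict_space_iff) auto
    have [measurable]: "indicat_real C \<in> borel_measurable leb01"
      using Cb by (intro measurable_restrict_space1 measurable_completion) simp
    have [measurable]: "indicat_real A \<in> borel_measurable leb01"
      using A(1) by (intro measurable_restrict_space1) simp
    have "set_lebesgue_integral leb01 A (rep_L2 h) =
      (LINT x|leb01. rep_L2 h x * indicat_real C x)"
      unfolding set_lebesgue_integral_def
    proof (rule integral_cong_AE)
      show "AE x in leb01. indicat_real A x *\<^sub>R rep_L2 h x = rep_L2 h x * indicat_real C x"
        using N by eventually_elim (use C(3) in \<open>auto split: split_indicator\<close>)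
    qed measurable
    then show "set_lebesgue_integral leb01 A (rep_L2 h) = set_lebesgue_integral leb01 A (\<lambda>x. 0)"
      using weak_zero_borel[OF assms Cb] by (simp add: set_lebesgue_integral_def)
  qed
  then show ?thesis
    unfolding L2_eq_iff using rep_L2_0 by eventually_elim simp
qed

lemma has_weak_deriv_unique:
  assumes "has_weak_deriv y g" "has_weak_deriv y g'"
  shows "g = g'"
proof -
  have "has_weak_deriv 0 (g - g')"
    using has_weak_deriv_lincomb[OF assms, of "-1"] by simp
  moreover have "(LINT x|leb01. rep_L2 0 x * deriv \<phi> x) = 0" if "test_function \<phi>" for \<phi>
    using integral_rep_L2_lincomb[OF test_functionD(2,4)[OF that], of 0 1 0] by simp
  ultimately have "g - g' = 0"
    by (intro weak_zero_imp_zero) (simp add: has_weak_deriv_def)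
  then show ?thesis by simp
qed

definition weak_deriv :: "L2 \<Rightarrow> L2" where
  "weak_deriv y = (THE g. has_weak_deriv y g)"

definition in_H1 :: "L2 \<Rightarrow> bool" where
  "in_H1 y \<longleftrightarrow> (\<exists>g. has_weak_deriv y g)"

lemma weak_deriv_eq: "has_weak_deriv y g \<Longrightarrow> weak_deriv y = g"
  unfolding weak_deriv_def using has_weak_deriv_unique by blast

lemma has_weak_deriv_weak_deriv: "in_H1 y \<Longrightarrow> has_weak_deriv y (weak_deriv y)"
  unfolding in_H1_def using weak_deriv_eq by blast

lemma in_H1_lincomb: "in_H1 y \<Longrightarrow> in_H1 y' \<Longrightarrow> in_H1 (y + c *\<^sub>R y')"
  unfolding in_H1_def using has_weak_deriv_lincomb by blast

lemma weak_deriv_lincomb: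
  "in_H1 y \<Longrightarrow> in_H1 y' \<Longrightarrow> weak_deriv (y + c *\<^sub>R y') = weak_deriv y + c *\<^sub>R weak_deriv y'"
  by (intro weak_deriv_eq has_weak_deriv_lincomb has_weak_deriv_weak_deriv)

lemma in_H1_0: "in_H1 0"
  unfolding in_H1_def using has_weak_deriv_0 by blast

typedef H1 = "{y. in_H1 y}"
  morphisms L2_of_H1 Abs_H1
  using in_H1_0 by blast

setup_lifting type_definition_H1

instantiation H1 :: real_vector
begin

lift_definition zero_H1 :: H1 is 0 by (rule in_H1_0)

lift_definition plus_H1 :: "H1 \<Rightarrow> H1 \<Rightarrow> H1" is "(+)"
  using in_H1_lincomb[of _ _ 1] by simp

lift_definition uminus_H1 :: "H1 \<Rightarrow> H1" is uminus
  using in_H1_lincomb[OF in_H1_0, of _ "-1"] by simp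

lift_definition minus_H1 :: "H1 \<Rightarrow> H1 \<Rightarrow> H1" is "(-)"
  using in_H1_lincomb[of _ _ "-1"] by simp

lift_definition scaleR_H1 :: "real \<Rightarrow> H1 \<Rightarrow> H1" is "(*\<^sub>R)"
  using in_H1_lincomb[OF in_H1_0] by simp

instance
  by standard (transfer; simp add: algebra_simps)+

end

instantiation H1 :: real_inner
begin

lift_definition inner_H1 :: "H1 \<Rightarrow> H1 \<Rightarrow> real" is
  "\<lambda>y y'. inner y y' + inner (weak_deriv y) (weak_deriv y')" .

definition norm_H1 :: "H1 \<Rightarrow> real" where "norm_H1 f = sqrt (inner f f)"
definition dist_H1 :: "H1 \<Rightarrow> H1 \<Rightarrow> real" where "dist_H1 f g = norm (f - g)"
definition sgn_H1 :: "H1 \<Rightarrow> H1" where "sgn_H1 f = f /\<^sub>R norm f"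
definition uniformity_H1 :: "(H1 \<times> H1) filter" where
  "uniformity_H1 = (INF e\<in>{0<..}. principal {(f, g). dist f g < e})"
definition open_H1 :: "H1 set \<Rightarrow> bool" where
  "open_H1 U \<longleftrightarrow> (\<forall>f\<in>U. \<forall>\<^sub>F (f', g) in uniformity. f' = f \<longrightarrow> g \<in> U)"

instance
proof
  fix f g h :: H1 and c :: real
  show "dist f g = norm (f - g)" by (rule dist_H1_def)
  show "sgn f = f /\<^sub>R norm f" by (rule sgn_H1_def)
  show "norm f = sqrt (inner f f)" by (rule norm_H1_def)
  show "inner f g = inner g f" by transfer (simp add: inner_commute)
  show "inner (f + g) h = inner f h + inner g h"
  proof transfer
    fix f g h assume "in_H1 f" "in_H1 g"
    then have "weak_deriv (f + g) = weak_deriv f + weak_deriv g"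
      using weak_deriv_lincomb[of f g 1] by simp
    then show "inner (f + g) h + inner (weak_deriv (f + g)) (weak_deriv h) =
        inner f h + inner (weak_deriv f) (weak_deriv h) +
        (inner g h + inner (weak_deriv g) (weak_deriv h))"
      by (simp add: inner_add_left)
  qed
  show "inner (c *\<^sub>R f) g = c * inner f g"
  proof transfer
    fix c f g assume "in_H1 f"
    then have "weak_deriv (c *\<^sub>R f) = c *\<^sub>R weak_deriv f"
      using weak_deriv_lincomb[OF in_H1_0, of f c] weak_deriv_eq[OF has_weak_deriv_0] by simp
    then show "inner (c *\<^sub>R f) g + inner (weak_deriv (c *\<^sub>R f)) (weak_deriv g) =
        c * (inner f g + inner (weak_deriv f) (weak_deriv g))"
      by (simp add: distrib_left)
  qed
  show "0 \<le> inner f f" by transfer simp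
  show "inner f f = 0 \<longleftrightarrow> f = 0"
  proof transfer
    fix f :: L2
    show "inner f f + inner (weak_deriv f) (weak_deriv f) = 0 \<longleftrightarrow> f = 0"
      using weak_deriv_eq[OF has_weak_deriv_0]
      by (auto simp: add_nonneg_eq_0_iff)
  qed
next
  show "(uniformity :: (H1 \<times> H1) filter) = (INF e\<in>{0<..}. principal {(f, g). dist f g < e})"
    by (rule uniformity_H1_def)
next
  fix U :: "H1 set"
  show "open U \<longleftrightarrow> (\<forall>f\<in>U. \<forall>\<^sub>F (f', g) in uniformity. f' = f \<longrightarrow> g \<in> U)"
    by (rule open_H1_def)
qed

end

lemma has_weak_deriv_const: "has_weak_deriv (abs_L2 (\<lambda>x. c)) 0"
  unfolding has_weak_deriv_def
proof (intro allI impI)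
  fix \<phi> assume t: "test_function \<phi>"
  then obtain C where C: "C \<subseteq> {0<..<1}" "\<And>x. x \<notin> C \<Longrightarrow> \<phi> x = 0"
    unfolding test_function_def by auto
  have "\<phi> differentiable (at x)" for x
    using t by (auto simp: test_function_def C1_differentiable_on_eq)
  then have d: "(\<phi> has_real_derivative deriv \<phi> x) (at x)" for x
    using DERIV_deriv_iff_real_differentiable by blast
  note cont = test_functionD[OF t]
  have [measurable]: "\<phi> \<in> borel_measurable leb01" "deriv \<phi> \<in> borel_measurable leb01"
    using borel_measurable_continuous_onI[OF cont(1)] borel_measurable_continuous_onI[OF cont(2)]
    by (auto intro!: measurable_restrict_space1 measurable_completion)
  have "(deriv \<phi> has_integral \<phi> 1 - \<phi> 0) {0..1}"
    by (rule fundamental_theorem_of_calculus)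
      (auto simp: has_real_derivative_iff_has_vector_derivative[symmetric]
        intro: has_field_derivative_at_within[OF d])
  moreover have "\<phi> 0 = 0" "\<phi> 1 = 0" using C by force+
  ultimately have "(deriv \<phi> has_integral 0) {0..1}" by simp
  then have i0: "integral {0<..<1} (deriv \<phi>) = 0"
    using integral_open_interval_real[of 0 1 "deriv \<phi>"] by (simp add: integral_unique)
  have "deriv \<phi> absolutely_integrable_on {0..1}"
    using cont(2) by (intro absolutely_integrable_continuous_real) (auto intro: continuous_on_subset)
  then have "deriv \<phi> absolutely_integrable_on {0<..<1}"
    by (rule set_integrable_subset) auto
  then have "(LINT x|leb01. deriv \<phi> x) = 0"
    using i0 by (subst lebesgue_integral_eq_integral)
      (auto simp: set_integrable_def integrable_restrict_space)
  moreover have "(LINT x|leb01. rep_L2 (abs_L2 (\<lambda>x. c)) x * deriv \<phi> x) =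
      (LINT x|leb01. c * deriv \<phi> x)"
    by (rule integral_cong_AE)
      (use rep_abs_L2[OF square_integrable_const[of c]] in auto)
  moreover have "(LINT x|leb01. rep_L2 0 x * \<phi> x) = 0"
    by (rule integral_eq_zero_AE) (use rep_L2_0 in auto)
  ultimately show "(LINT x|leb01. rep_L2 (abs_L2 (\<lambda>x. c)) x * deriv \<phi> x) =
      - (LINT x|leb01. rep_L2 0 x * \<phi> x)"
    by simp
qed

lift_definition const_H1 :: "real \<Rightarrow> H1" is "\<lambda>c. abs_L2 (\<lambda>x. c)"
  unfolding in_H1_def using has_weak_deriv_const by blast

text \<open>
  Point values of an \<open>H\<^sup>1(0,1)\<close> class on \<open>[0,1]\<close> are those of its continuous
  representative on the closed interval.
\<close>

definition cont_rep :: "L2 \<Rightarrow> real \<Rightarrow> real" where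
  "cont_rep y = (SOME v. continuous_on {0..1} v \<and> (AE x in leb01. rep_L2 y x = v x))"


section \<open>Semigroups\<close>

definition C0_semigroup :: "(real \<Rightarrow> 'a \<Rightarrow> 'a :: real_normed_vector) \<Rightarrow> bool" where
  "C0_semigroup T \<longleftrightarrow>
     (\<forall>t\<ge>0. bounded_linear (T t)) \<and>
     T 0 = id \<and>
     (\<forall>s\<ge>0. \<forall>t\<ge>0. T (s + t) = T s \<circ> T t) \<and>
     (\<forall>x. ((\<lambda>t. T t x) \<longlongrightarrow> x) (at_right 0))"

definition is_generator ::
    "(real \<Rightarrow> 'a \<Rightarrow> 'a :: real_normed_vector) \<Rightarrow> 'a set \<Rightarrow> ('a \<Rightarrow> 'a) \<Rightarrow> bool" where
  "is_generator T D A \<longleftrightarrow>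
     D = {x. \<exists>y. ((\<lambda>h. (T h x - x) /\<^sub>R h) \<longlongrightarrow> y) (at_right 0)} \<and>
     (\<forall>x\<in>D. ((\<lambda>h. (T h x - x) /\<^sub>R h) \<longlongrightarrow> A x) (at_right 0))"

definition equivalent_norms :: "('a \<Rightarrow> real) \<Rightarrow> ('a \<Rightarrow> real) \<Rightarrow> bool" where
  "equivalent_norms N N' \<longleftrightarrow> (\<exists>c>0. \<exists>C>0. \<forall>x. c * N' x \<le> N x \<and> N x \<le> C * N' x)"


section \<open>The closed-loop crane\<close>

text \<open>
  A state is \<open>(y, z, u, \<xi>, \<eta>)\<close>; the type class instances for products provide the usual
  product norm and topology.
\<close>

type_synonym state = "H1 \<times> L2 \<times> L2 \<times> real \<times> real"

fun ell :: "real \<Rightarrow> real \<Rightarrow> real \<Rightarrow> real \<Rightarrow> real \<Rightarrow> state \<Rightarrow> real" where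
  "ell m M \<tau> \<alpha> \<beta> (y, z, u, \<xi>, \<eta>) =
     (LINT x|leb01. rep_L2 z x) + m * \<xi> + M * \<eta>
     + (\<beta> - \<alpha>) * cont_rep (L2_of_H1 y) 0 + \<tau> * \<alpha> * (LINT x|leb01. rep_L2 u x)"

fun inner_X :: "H1 \<Rightarrow> real \<Rightarrow> real \<Rightarrow> real \<Rightarrow> real \<Rightarrow> real \<Rightarrow> real \<Rightarrow> real \<Rightarrow> state \<Rightarrow> state \<Rightarrow> real"
where
  "inner_X a m M \<tau> \<alpha> \<beta> K \<omega> (y, z, u, \<xi>, \<eta>) (y', z', u', \<xi>', \<eta>') =
     (LINT x|leb01. cont_rep (L2_of_H1 a) x
          * rep_L2 (weak_deriv (L2_of_H1 y)) x * rep_L2 (weak_deriv (L2_of_H1 y')) x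
        + rep_L2 z x * rep_L2 z' x)
     + K * \<tau> * (LINT x|leb01. rep_L2 u x * rep_L2 u' x)
     + m * \<xi> * \<xi>' + M * \<eta> * \<eta>'
     + \<omega> * ell m M \<tau> \<alpha> \<beta> (y, z, u, \<xi>, \<eta>) * ell m M \<tau> \<alpha> \<beta> (y', z', u', \<xi>', \<eta>')"

definition norm_X :: "H1 \<Rightarrow> real \<Rightarrow> real \<Rightarrow> real \<Rightarrow> real \<Rightarrow> real \<Rightarrow> real \<Rightarrow> real \<Rightarrow> state \<Rightarrow> real"
where
  "norm_X a m M \<tau> \<alpha> \<beta> K \<omega> \<Phi> = sqrt (inner_X a m M \<tau> \<alpha> \<beta> K \<omega> \<Phi> \<Phi>)"

text \<open>The class of \<open>a y\<^sub>x\<close>; it lies in \<open>H\<^sup>1(0,1)\<close> whenever \<open>y \<in> H\<^sup>2(0,1)\<close>.\<close>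

definition flux :: "H1 \<Rightarrow> H1 \<Rightarrow> L2" where
  "flux a y = abs_L2 (\<lambda>x. cont_rep (L2_of_H1 a) x * rep_L2 (weak_deriv (L2_of_H1 y)) x)"

definition crane_dom :: "state set" where
  "crane_dom = {(y, z, u, \<xi>, \<eta>).
     in_H1 (weak_deriv (L2_of_H1 y)) \<and> in_H1 z \<and> in_H1 u \<and>
     \<xi> = cont_rep u 0 \<and> cont_rep u 0 = cont_rep z 0 \<and> \<eta> = cont_rep z 1}"

text \<open>Only the values on \<^const>\<open>crane_dom\<close> are meaningful.\<close>

fun crane_op :: "H1 \<Rightarrow> real \<Rightarrow> real \<Rightarrow> real \<Rightarrow> real \<Rightarrow> real \<Rightarrow> state \<Rightarrow> state" where
  "crane_op a m M \<tau> \<alpha> \<beta> (y, z, u, \<xi>, \<eta>) =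
     (Abs_H1 z,
      weak_deriv (flux a y),
      - (weak_deriv u /\<^sub>R \<tau>),
      (cont_rep (flux a y) 0 - \<beta> * \<xi> + \<alpha> * cont_rep u 1) / m,
      - (cont_rep (flux a y) 1 / M))"

end

theory Submission
  imports Defs
begin

text \<open>
  The energy of a solution is \<open>E(t) = \<parallel>\<Phi>(t) - (\<Omega>,0,0,0,0)\<parallel>\<^sup>2\<close>. The functional \<open>\<ell>\<close> that
  occurs in the inner product vanishes on the range of the generator, so it is conserved, and
  the constant \<open>\<Omega>\<close> is chosen exactly so that \<open>\<ell>\<close> vanishes on the shifted solution; constant
  displacements are equilibria. It remains to show that solutions with \<open>\<ell> = 0\<close> tend to \<open>0\<close>.

  Integration by parts gives \<open>E' \<le> -2k (\<xi>\<^sup>2 + u(1)\<^sup>2)\<close> on the domain of the generator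
  (\<open>crane_dissipative\<close>). This controls the velocity \<open>\<xi> = y\<^sub>t(0,t)\<close> in \<open>L\<^sup>2(0,\<infinity>)\<close>, and, applied to the
  difference quotients of a solution in time, it also controls \<open>\<xi>'\<close>. Through the boundary
  condition at \<open>x = 0\<close> the tension \<open>(a y\<^sub>x)(0,t) = m \<xi>' + \<beta> \<xi> - \<alpha> u(1)\<close> is then controlled
  as well, that is, both Cauchy data of the wave equation at \<open>x = 0\<close> lie in \<open>L\<^sup>2(0,\<infinity>)\<close>.

  A multiplier carries this control across the interval. For the weighted momentum
  \<open>R = \<integral> a v z y\<^sub>x dx\<close> with a decreasing weight \<open>v\<close> one has
  \<open>2 R' = [v (a y\<^sub>x)\<^sup>2 + a v z\<^sup>2] - \<integral> (v' (a y\<^sub>x)\<^sup>2 + (a v)' z\<^sup>2) dx\<close>, the bracket being the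
  difference of the values at \<open>1\<close> and \<open>0\<close>. Since \<open>a'\<close> is only square integrable, \<open>v\<close> is taken as
  \<open>exp (- \<integral>\<^sub>0\<^sup>x (1 + \<bar>a'\<bar> / a\<^sub>0))\<close>, which makes both \<open>v'\<close> and \<open>(a v)'\<close> uniformly negative; hence
  \<open>R'\<close> plus the Cauchy data at \<open>0\<close> dominate the energy of the string and of the payload
  (\<open>momentum_estimate\<close>). The functional \<open>\<integral> (2 - x) u\<^sup>2 dx\<close> does the same for the delay line. Together
  (\<open>crane_observability\<close>), up to constants, \<open>E \<le> \<xi>\<^sup>2 + u(1)\<^sup>2 + \<xi>'\<^sup>2 + q'\<close> with a
  bounded quadratic form \<open>q\<close>.

  So \<open>\<integral> E dt\<close> is finite for data in the domain, and because \<open>E\<close> decreases, \<open>t E(t)\<close> stays bounded.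
  Data in the domain are dense and the semigroup contracts the energy norm, which gives the claim
  for all data. This last argument is abstract (\<open>lyapunov_imp_strongly_stable\<close>); the remaining
  sections supply the calculus in \<open>H\<^sup>1(0,1)\<close> that the two estimates require and the density of
  the domain (\<open>crane_dom_dense\<close>).
\<close>

section \<open>Orbits of semigroups\<close>


text \<open>
  Generators only provide right derivatives of orbits, so monotonicity has to be read off these.
  If \<open>f\<close> rose, then after subtraction of a small slope there would be a last point at which
  \<open>f\<close> does not exceed its initial value; to the right of it the function would still decrease.
\<close>

lemma right_derivative_nonpos_imp_le:
  fixes f :: "real \<Rightarrow> real"
  assumes "a \<le> b" and cont: "continuous_on {a..b} f"
    and der: "\<And>t. a \<le> t \<Longrightarrow> t < b \<Longrightarrow> \<exists>D\<le>0. (f has_real_derivative D) (at_right t)"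
  shows "f b \<le> f a"
proof (rule ccontr)
  assume "\<not> f b \<le> f a"
  then have less: "f a < f b" by simp
  with assms(1) have ab: "a < b" by (cases "a = b") auto
  define \<epsilon> where "\<epsilon> = (f b - f a) / (2 * (b - a))"
  have e: "0 < \<epsilon>" using less ab by (simp add: \<epsilon>_def)
  define g where "g t = f t - f a - \<epsilon> * (t - a)" for t
  have "\<epsilon> * (b - a) = (f b - f a) / 2" using ab by (simp add: \<epsilon>_def divide_simps)
  then have gb: "g b > 0" using less by (simp add: g_def)
  have ga: "g a = 0" by (simp add: g_def)
  have cg: "continuous_on {a..b} g"
    unfolding g_def by (intro continuous_intros cont)
  define Z where "Z = {t \<in> {a..b}. g t \<le> 0}"
  have "closed Z" unfolding Z_def
    by (intro continuous_on_closed_Collect_le cg continuous_on_const) auto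
  moreover have "bounded Z"
    by (rule bounded_subset[of "{a..b}"]) (auto simp: Z_def)
  ultimately have "compact Z" by (simp add: compact_eq_bounded_closed)
  moreover have "a \<in> Z" using ab ga by (simp add: Z_def)
  ultimately obtain s where s: "s \<in> Z" "\<And>t. t \<in> Z \<Longrightarrow> t \<le> s"
    using compact_attains_sup[of Z] by blast
  have sb: "a \<le> s" "s < b" "g s \<le> 0" using s gb by (auto simp: Z_def order.strict_iff_order)
  obtain D where D: "D \<le> 0" "(f has_real_derivative D) (at_right s)"
    using der sb by blast
  have "(g has_real_derivative D - \<epsilon>) (at_right s)"
    unfolding g_def by (auto intro!: derivative_eq_intros D)
  then obtain d where d: "d > 0" "\<And>h. h > 0 \<Longrightarrow> h < d \<Longrightarrow> g (s + h) < g s"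
    using has_real_derivative_neg_dec_right[of g "D - \<epsilon>" s "{s<..}"] D e by auto
  define h where "h = min (d / 2) (b - s)"
  have h: "0 < h" "h < d" "s + h \<le> b" using d sb by (auto simp: h_def)
  then have "g (s + h) < 0" using d(2)[of h] sb by simp
  then have "s + h \<in> Z" using h sb by (simp add: Z_def)
  then show False using s(2) h by fastforce
qed

lemma C0_semigroupD:
  assumes "C0_semigroup T"
  shows "t \<ge> 0 \<Longrightarrow> bounded_linear (T t)" "T 0 x = x"
    "s \<ge> 0 \<Longrightarrow> t \<ge> 0 \<Longrightarrow> T (s + t) x = T s (T t x)"
    "((\<lambda>t. T t x) \<longlongrightarrow> x) (at_right 0)"
  using assms by (auto simp: C0_semigroup_def)

text \<open>
  Right continuity at a point makes the oscillation small on an interval to its right. Choosing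
  each interval strictly inside the previous one leaves a point which is interior to all of them,
  and there the oscillation is zero.
\<close>

lemma right_continuous_imp_ex_isCont:
  fixes F :: "real \<Rightarrow> 'a::metric_space"
  assumes rc: "\<And>t. t \<ge> a \<Longrightarrow> (F \<longlongrightarrow> F t) (at_right t)" and "a < b"
  shows "\<exists>c. a < c \<and> c < b \<and> isCont F c"
proof -
  define P where "P n I \<longleftrightarrow> (case I of (p, q) \<Rightarrow> a < p \<and> p < q \<and> q < b \<and>
      (\<forall>s\<in>{p..q}. dist (F s) (F p) < 1 / real (Suc n)))" for n :: nat and I
  define R where "R n I J \<longleftrightarrow> (case I of (p, q) \<Rightarrow> case J of (p', q') \<Rightarrow> p < p' \<and> q' < q)"
    for n :: nat and I J :: "real \<times> real"
  have ex: "\<exists>J. P n J \<and> p < fst J \<and> snd J < q" if "a \<le> p" "p < q" "q \<le> b" for n p q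
  proof -
    define r where "r = (p + q) / 2"
    have r: "p < r" "r < q" using that by (auto simp: r_def)
    have "\<forall>\<^sub>F s in at_right r. dist (F s) (F r) < 1 / real (Suc n)"
      using tendstoD[OF rc, of r "1 / real (Suc n)"] that r by simp
    then obtain w where w: "w > r" "\<And>s. r < s \<Longrightarrow> s < w \<Longrightarrow> dist (F s) (F r) < 1 / real (Suc n)"
      unfolding eventually_at_right_field by blast
    define v where "v = (r + min w q) / 2"
    have v: "r < v" "v < w" "v < q" using w r by (auto simp: v_def min_def)
    have "dist (F s) (F r) < 1 / real (Suc n)" if "s \<in> {r..v}" for s
      using w(2)[of s] that v by (cases "s = r") auto
    then have "P n (r, v)" using r v that by (simp add: P_def)
    then show ?thesis using r v by (intro exI[of _ "(r, v)"]) auto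
  qed
  have "\<exists>I. \<forall>n. P n (I n) \<and> R n (I n) (I (Suc n))"
  proof (rule dependent_nat_choice)
    show "\<exists>I. P 0 I" using ex[of a b 0] \<open>a < b\<close> by (metis order_refl)
    fix I n assume "P n I"
    then show "\<exists>J. P (Suc n) J \<and> R n I J"
      using ex[of "fst I" "snd I" "Suc n"] by (force simp: P_def R_def split: prod.splits)
  qed
  then obtain I where I: "\<And>n. P n (I n)" "\<And>n. R n (I n) (I (Suc n))" by blast
  define p q where "p n = fst (I n)" and "q n = snd (I n)" for n
  have pq: "P n (p n, q n)" "p n < p (Suc n)" "q (Suc n) < q n" for n
    using I(1)[of n] I(2)[of n] by (simp_all add: p_def q_def R_def split: prod.splits)
  have "\<Inter>(range (\<lambda>n. {p n..q n})) \<noteq> {}"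
  proof (rule compact_nest)
    show "{p n..q n} \<noteq> {}" for n using pq(1)[of n] by (simp add: P_def)
    show "m \<le> n \<Longrightarrow> {p n..q n} \<subseteq> {p m..q m}" for m n
      by (rule lift_Suc_antimono_le[of "\<lambda>n. {p n..q n}"]) (use pq in \<open>auto simp: less_eq_real_def\<close>)
  qed simp
  then obtain c where "c \<in> \<Inter>(range (\<lambda>n. {p n..q n}))" by blast
  then have c: "p n \<le> c \<and> c \<le> q n" for n by auto
  have c': "p n < c \<and> c < q n" for n using c[of "Suc n"] pq(2,3)[of n] by auto
  have "isCont F c"
    unfolding isCont_def tendsto_iff
  proof (intro allI impI)
    fix e :: real assume "e > 0"
    then obtain n where n: "1 / real (Suc n) < e / 2" using nat_approx_posE[of "e / 2"] by auto
    have "\<forall>\<^sub>F s in at c. s \<in> {p n<..<q n}"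
      using c'[of n] by (intro eventually_at_in_open') auto
    then show "\<forall>\<^sub>F s in at c. dist (F s) (F c) < e"
    proof eventually_elim
      case (elim s)
      have "dist (F s) (F (p n)) < 1 / real (Suc n)" "dist (F c) (F (p n)) < 1 / real (Suc n)"
        using pq(1)[of n] elim c[of n] by (auto simp: P_def)
      then show ?case using dist_triangle2[of "F s" "F c" "F (p n)"] n by linarith
    qed
  qed
  moreover have "a < c" "c < b" using c'[of 0] pq(1)[of 0] by (auto simp: P_def)
  ultimately show ?thesis by blast
qed

lemma C0_semigroup_right_continuous:
  assumes "C0_semigroup T" "t \<ge> 0"
  shows "((\<lambda>s. T s x) \<longlongrightarrow> T t x) (at_right t)"
proof -
  have "((\<lambda>h. T t (T h x)) \<longlongrightarrow> T t x) (at_right 0)"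
    by (rule bounded_linear.tendsto[OF C0_semigroupD(1)[OF assms] C0_semigroupD(4)[OF assms(1)]])
  moreover have "\<forall>\<^sub>F h in at_right 0. T t (T h x) = T (h + t) x"
    using eventually_at_right_less[of "0::real"]
    by eventually_elim (use assms in \<open>simp add: C0_semigroupD(3)[symmetric] add.commute\<close>)
  ultimately show ?thesis
    by (subst filterlim_at_right_to_0) (rule Lim_transform_eventually)
qed

text \<open>
  An orbit is right continuous, so it is continuous at arbitrarily small times \<open>c\<close>. Near
  \<open>t \<ge> c\<close> it is the image under the bounded operator \<open>T (t - c)\<close> of the orbit near \<open>c\<close>, so
  continuity propagates to all later times.
\<close>

lemma C0_semigroup_continuous_orbit:
  assumes T: "C0_semigroup T"
  shows "continuous_on {0..} (\<lambda>t. T t x)"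
  unfolding continuous_on_def
proof
  fix t :: real assume "t \<in> {0..}"
  then consider "t = 0" | "t > 0" by fastforce
  then show "((\<lambda>t. T t x) \<longlongrightarrow> T t x) (at t within {0..})"
  proof cases
    case 1
    have "at (0::real) within {0..} = at_right 0"
      unfolding at_within_def by (rule arg_cong[of _ _ "\<lambda>S. inf (nhds 0) (principal S)"]) auto
    then show ?thesis using 1 C0_semigroupD(2,4)[OF T] by simp
  next
    case 2
    obtain c where c: "0 < c" "c < t" "isCont (\<lambda>t. T t x) c"
      using right_continuous_imp_ex_isCont[OF C0_semigroup_right_continuous[OF T] 2] by blast
    have "isCont (\<lambda>s. T (s - (t - c)) x) t"
      using c(3) by (intro isCont_o2[of t "\<lambda>s. s - (t - c)" "\<lambda>t. T t x"]) auto
    then have "isCont (\<lambda>s. T (t - c) (T (s - (t - c)) x)) t"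
      using c by (intro bounded_linear.isCont[OF C0_semigroupD(1)[OF T]]) auto
    moreover have "\<forall>\<^sub>F s in nhds t. s \<in> {t - c<..}"
      using c by (intro eventually_nhds_in_open) auto
    then have "\<forall>\<^sub>F s in nhds t. T (t - c) (T (s - (t - c)) x) = T s x"
      by eventually_elim (use c in \<open>simp add: C0_semigroupD(3)[OF T, symmetric]\<close>)
    ultimately have "isCont (\<lambda>s. T s x) t" by (subst (asm) isCont_cong)
    then show ?thesis using continuous_at_imp_continuous_at_within[of t "\<lambda>s. T s x"]
      by (simp add: continuous_within)
  qed
qed

lemma generator_orbit:
  assumes T: "C0_semigroup T" and gen: "is_generator T D A" and x: "x \<in> D" and t: "t \<ge> 0"
  shows "T t x \<in> D" "A (T t x) = T t (A x)"
    "((\<lambda>s. T s x) has_vector_derivative A (T t x)) (at_right t)"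
proof -
  note sg = C0_semigroupD[OF T]
  have Ax: "((\<lambda>h. (T h x - x) /\<^sub>R h) \<longlongrightarrow> A x) (at_right 0)"
    using gen x by (auto simp: is_generator_def)
  interpret Tt: bounded_linear "T t" by (rule sg(1)[OF t])
  have "((\<lambda>h. T t ((T h x - x) /\<^sub>R h)) \<longlongrightarrow> T t (A x)) (at_right 0)"
    by (rule Tt.tendsto[OF Ax])
  moreover have ev: "\<forall>\<^sub>F h in at_right 0. T t ((T h x - x) /\<^sub>R h) = (T (h + t) x - T t x) /\<^sub>R h"
    using eventually_at_right_less[of "0::real"]
    by eventually_elim (use t in \<open>simp add: Tt.diff Tt.scale sg(3)[symmetric] add.commute\<close>)
  ultimately have lim: "((\<lambda>h. (T (h + t) x - T t x) /\<^sub>R h) \<longlongrightarrow> T t (A x)) (at_right 0)"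
    by (rule Lim_transform_eventually)
  moreover have "\<forall>\<^sub>F h in at_right 0. (T (h + t) x - T t x) /\<^sub>R h = (T h (T t x) - T t x) /\<^sub>R h"
    using eventually_at_right_less[of "0::real"]
    by eventually_elim (use t in \<open>simp add: sg(3)\<close>)
  ultimately have lim': "((\<lambda>h. (T h (T t x) - T t x) /\<^sub>R h) \<longlongrightarrow> T t (A x)) (at_right 0)"
    by (rule Lim_transform_eventually)
  then show D: "T t x \<in> D" using gen unfolding is_generator_def by blast
  then have "((\<lambda>h. (T h (T t x) - T t x) /\<^sub>R h) \<longlongrightarrow> A (T t x)) (at_right 0)"
    using gen by (auto simp: is_generator_def)
  with lim' show eq: "A (T t x) = T t (A x)"
    by (intro tendsto_unique[OF _ _ lim']) auto
  have "((\<lambda>s. (T s x - T t x) /\<^sub>R (s - t)) \<longlongrightarrow> T t (A x)) (at_right t)"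
    using lim by (subst filterlim_at_right_to_0) simp
  then show "((\<lambda>s. T s x) has_vector_derivative A (T t x)) (at_right t)"
    unfolding eq has_vector_derivative_def has_derivative_within
  proof (intro conjI bounded_linear_scaleR_left)
    assume "((\<lambda>s. (T s x - T t x) /\<^sub>R (s - t)) \<longlongrightarrow> T t (A x)) (at_right t)"
    then have "((\<lambda>s. (T s x - T t x) /\<^sub>R (s - t) - T t (A x)) \<longlongrightarrow> 0) (at_right t)"
      by (simp add: Lim_null[of _ "T t (A x)"])
    moreover have "\<forall>\<^sub>F s in at_right t. (T s x - T t x) /\<^sub>R (s - t) - T t (A x) =
        (1 / norm (s - t)) *\<^sub>R (T s x - (T t x + (s - t) *\<^sub>R T t (A x)))"
      using eventually_at_right_less[of t]
      by eventually_elim (simp add: scaleR_diff_right scaleR_add_right inverse_eq_divide)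
    ultimately show "((\<lambda>s. (1 / norm (s - t)) *\<^sub>R (T s x - (T t x + (s - t) *\<^sub>R T t (A x))))
        \<longlongrightarrow> 0) (at_right t)"
      by (rule Lim_transform_eventually)
  qed
qed

lemma generator_domain_diff_scaleR:
  assumes gen: "is_generator T D A" and T: "C0_semigroup T" and x: "x \<in> D" "y \<in> D"
  shows "r *\<^sub>R (x - y) \<in> D" "A (r *\<^sub>R (x - y)) = r *\<^sub>R (A x - A y)"
proof -
  have "((\<lambda>h. (T h x - x) /\<^sub>R h) \<longlongrightarrow> A x) (at_right 0)"
    "((\<lambda>h. (T h y - y) /\<^sub>R h) \<longlongrightarrow> A y) (at_right 0)"
    using gen x by (auto simp: is_generator_def)
  then have "((\<lambda>h. r *\<^sub>R ((T h x - x) /\<^sub>R h - (T h y - y) /\<^sub>R h)) \<longlongrightarrow> r *\<^sub>R (A x - A y)) (at_right 0)"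
    by (intro tendsto_intros)
  moreover have "\<forall>\<^sub>F h in at_right 0. r *\<^sub>R ((T h x - x) /\<^sub>R h - (T h y - y) /\<^sub>R h) =
      (T h (r *\<^sub>R (x - y)) - r *\<^sub>R (x - y)) /\<^sub>R h"
    using eventually_at_right_less[of "0::real"]
  proof eventually_elim
    case (elim h)
    interpret bounded_linear "T h" using C0_semigroupD(1)[OF T] elim by simp
    show ?case by (simp add: scale diff scaleR_diff_right mult.commute)
  qed
  ultimately have lim: "((\<lambda>h. (T h (r *\<^sub>R (x - y)) - r *\<^sub>R (x - y)) /\<^sub>R h) \<longlongrightarrow>
      r *\<^sub>R (A x - A y)) (at_right 0)"
    by (rule Lim_transform_eventually)
  then show D: "r *\<^sub>R (x - y) \<in> D" using gen unfolding is_generator_def by blast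
  then have "((\<lambda>h. (T h (r *\<^sub>R (x - y)) - r *\<^sub>R (x - y)) /\<^sub>R h) \<longlongrightarrow> A (r *\<^sub>R (x - y))) (at_right 0)"
    using gen by (auto simp: is_generator_def)
  then show "A (r *\<^sub>R (x - y)) = r *\<^sub>R (A x - A y)"
    by (intro tendsto_unique[OF _ _ lim]) auto
qed

lemma continuous_on_orbit_form:
  assumes T: "C0_semigroup T" and B: "bounded_bilinear B"
  shows "continuous_on {0..} (\<lambda>t. B (T t x) (T t y))"
  by (intro bounded_bilinear.continuous_on[OF B] C0_semigroup_continuous_orbit T)

lemma orbit_form_derivative:
  fixes B :: "'a::real_normed_vector \<Rightarrow> 'a \<Rightarrow> real"
  assumes T: "C0_semigroup T" and gen: "is_generator T D A" and B: "bounded_bilinear B"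
    and x: "x \<in> D" and t: "t \<ge> 0"
  shows "((\<lambda>s. B (T s x) (T s x)) has_real_derivative
    B (T t x) (A (T t x)) + B (A (T t x)) (T t x)) (at_right t)"
  unfolding has_real_derivative_iff_has_vector_derivative
  by (intro bounded_bilinear.has_vector_derivative[OF B] generator_orbit[OF T gen x t])

section \<open>A Lyapunov criterion for strong stability\<close>

lemma orbit_form_antimono:
  assumes T: "C0_semigroup T" and gen: "is_generator T D A"
    and B: "bounded_bilinear B" and sym: "\<And>x y. B x y = B y x"
    and diss: "\<And>x. x \<in> D \<Longrightarrow> B x (A x) \<le> (0::real)"
    and x: "x \<in> D" and st: "0 \<le> s" "s \<le> t"
  shows "B (T t x) (T t x) \<le> B (T s x) (T s x)"
proof (rule right_derivative_nonpos_imp_le[OF st(2)])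
  show "continuous_on {s..t} (\<lambda>r. B (T r x) (T r x))"
    by (rule continuous_on_subset[OF continuous_on_orbit_form[OF T B]]) (use st in auto)
  fix r assume "s \<le> r" "r < t"
  then have r: "r \<ge> 0" using st by simp
  show "\<exists>D\<le>0. ((\<lambda>r. B (T r x) (T r x)) has_real_derivative D) (at_right r)"
    using diss[OF generator_orbit(1)[OF T gen x r]] sym[of "A (T r x)" "T r x"]
    by (intro exI[of _ "B (T r x) (A (T r x)) + B (A (T r x)) (T r x)"] conjI
        orbit_form_derivative[OF T gen B x r]) simp
qed

lemma dissipative_imp_form_contraction:
  assumes T: "C0_semigroup T" and gen: "is_generator T D A" and dense: "closure D = UNIV"
    and B: "bounded_bilinear B" and sym: "\<And>x y. B x y = B y x"
    and diss: "\<And>x. x \<in> D \<Longrightarrow> B x (A x) \<le> (0::real)" and t: "t \<ge> 0"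
  shows "B (T t x) (T t x) \<le> B x x"
proof -
  obtain X where X: "\<And>n. X n \<in> D" "X \<longlonglongrightarrow> x"
    using dense closure_sequential[of x D] by auto
  have "(\<lambda>n. B (T t (X n)) (T t (X n))) \<longlonglongrightarrow> B (T t x) (T t x)"
    by (intro bounded_bilinear.tendsto[OF B] bounded_linear.tendsto[OF C0_semigroupD(1)[OF T t]] X)
  moreover have "(\<lambda>n. B (X n) (X n)) \<longlonglongrightarrow> B x x"
    by (intro bounded_bilinear.tendsto[OF B] X)
  ultimately show ?thesis
    using orbit_form_antimono[OF T gen B sym diss X(1), of 0 t] t C0_semigroupD(2)[OF T]
    by (intro LIMSEQ_le) auto
qed

lemma orbit_linear_invariant:
  assumes T: "C0_semigroup T" and gen: "is_generator T D A"
    and l: "bounded_linear (l :: _ \<Rightarrow> real)" and l0: "\<And>x. x \<in> D \<Longrightarrow> l (A x) = 0"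
    and x: "x \<in> D" and t: "t \<ge> 0"
  shows "l (T t x) = l x"
proof -
  interpret bounded_linear l by (rule l)
  have d: "((\<lambda>s. l (T s x)) has_real_derivative 0) (at_right r)" if "r \<ge> 0" for r
    using has_vector_derivative[OF generator_orbit(3)[OF T gen x that]]
      l0[OF generator_orbit(1)[OF T gen x that]]
    by (simp add: has_real_derivative_iff_has_vector_derivative)
  have c: "continuous_on {0..t} (\<lambda>s. l (T s x))"
    by (intro continuous_on continuous_on_subset[OF C0_semigroup_continuous_orbit[OF T]]) auto
  have "l (T t x) \<le> l (T 0 x)"
    by (rule right_derivative_nonpos_imp_le[OF t c]) (use d in auto)
  moreover have "- l (T t x) \<le> - l (T 0 x)"
    by (rule right_derivative_nonpos_imp_le[OF t continuous_on_minus[OF c]])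
      (use DERIV_minus[OF d] in \<open>auto\<close>)
  ultimately show ?thesis using C0_semigroupD(2)[OF T] by simp
qed

lemma orbit_equilibrium:
  fixes e :: "'a::real_inner"
  assumes T: "C0_semigroup T" and gen: "is_generator T D A" and e: "e \<in> D" "A e = 0" and t: "t \<ge> 0"
  shows "T t e = e"
proof -
  have "norm (T t e - e) ^ 2 \<le> norm (T 0 e - e) ^ 2"
  proof (rule right_derivative_nonpos_imp_le[OF t])
    show "continuous_on {0..t} (\<lambda>s. norm (T s e - e) ^ 2)"
      by (intro continuous_intros continuous_on_subset[OF C0_semigroup_continuous_orbit[OF T]]) auto
    fix s :: real assume s: "0 \<le> s"
    have "A (T s e) = 0"
      using generator_orbit(2)[OF T gen e(1) s] e(2) linear_0[OF bounded_linear.linear[OF C0_semigroupD(1)[OF T s]]]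
      by simp
    then have "((\<lambda>r. T r e - e) has_vector_derivative 0) (at_right s)"
      using generator_orbit(3)[OF T gen e(1) s] by (auto intro!: derivative_eq_intros)
    from bounded_bilinear.has_vector_derivative[OF bounded_bilinear_inner this this]
    have "((\<lambda>r. norm (T r e - e) ^ 2) has_real_derivative 0) (at_right s)"
      by (simp add: has_real_derivative_iff_has_vector_derivative power2_norm_eq_inner)
    then show "\<exists>D\<le>0. ((\<lambda>r. norm (T r e - e) ^ 2) has_real_derivative D) (at_right s)" by auto
  qed
  then show ?thesis using C0_semigroupD(2)[OF T] by simp
qed

text \<open>
  The form \<open>S\<close> is the energy, \<open>b\<close> the part of the dissipation whose time derivative can be
  controlled too, \<open>d\<close> the rest of it, and \<open>l\<close> a conserved functional, with \<open>e\<close> a vector of the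
  domain along which \<open>l\<close> can be corrected. The hypothesis on \<open>S x x\<close> says that the dissipation,
  \<open>b (A x)\<close> and the derivative of the bounded quadratic form \<open>Q x x\<close> together see the whole energy.

  For \<open>x\<close> in the domain put \<open>y = (T h x - x) / h\<close>, which is in the domain again and tends to \<open>A x\<close>.
  The dissipation along the orbit of \<open>y\<close> dominates \<open>(b (A (T t x)))\<^sup>2\<close> up to an error that
  vanishes with \<open>h\<close>. Hence a combination of \<open>S\<close> and \<open>Q\<close> along the orbit of \<open>x\<close> and of \<open>S\<close> along
  that of \<open>y\<close> decreases at least at the rate \<open>S (T t x) (T t x)\<close>. As \<open>S\<close> itself decreases, this
  bounds \<open>s * S (T s x) (T s x)\<close> uniformly in \<open>s\<close>.
\<close>

theorem lyapunov_imp_strongly_stable: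
  fixes T :: "real \<Rightarrow> 'a::real_normed_vector \<Rightarrow> 'a" and S Q :: "'a \<Rightarrow> 'a \<Rightarrow> real" and b l :: "'a \<Rightarrow> real"
  assumes T: "C0_semigroup T" and gen: "is_generator T D A" and dense: "closure D = UNIV"
    and S: "bounded_bilinear S" and sym: "\<And>x y. S x y = S y x"
    and c: "c > 0" "\<And>x. c * (norm x)\<^sup>2 \<le> S x x"
    and Q: "bounded_bilinear Q" and b: "bounded_linear b" and l: "bounded_linear l"
    and d: "\<And>x. 0 \<le> d x" and k: "k > 0" and C: "C \<ge> 0"
    and diss: "\<And>x. x \<in> D \<Longrightarrow> S x (A x) \<le> - k * ((b x)\<^sup>2 + d x)"
    and obs: "\<And>x. x \<in> D \<Longrightarrow> l x = 0 \<Longrightarrow>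
      S x x \<le> C * ((b x)\<^sup>2 + d x + (b (A x))\<^sup>2) + Q x (A x) + Q (A x) x"
    and l0: "\<And>x. x \<in> D \<Longrightarrow> l (A x) = 0"
    and e: "e \<in> D" "l e = 1"
    and x: "l x = 0"
  shows "((\<lambda>t. S (T t x) (T t x)) \<longlongrightarrow> 0) at_top"
proof -
  interpret S: bounded_bilinear S by (rule S)
  interpret Q: bounded_bilinear Q by (rule Q)
  interpret b: bounded_linear b by (rule b)
  interpret l: bounded_linear l by (rule l)
  have S0: "0 \<le> S x x" for x using order_trans[OF _ c(2)[of x]] c(1) by simp
  have diss0: "S x (A x) \<le> 0" if "x \<in> D" for x
  proof -
    have "0 \<le> k * ((b x)\<^sup>2 + d x)" using k d by (intro mult_nonneg_nonneg add_nonneg_nonneg) auto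
    then show ?thesis using diss[OF that] by simp
  qed
  have contr: "S (T t x) (T t x) \<le> S x x" if "t \<ge> 0" for t x
    by (rule dissipative_imp_form_contraction[OF T gen dense S sym _ that]) (rule diss0)
  obtain Kb where Kb: "0 \<le> Kb" "\<And>x. \<bar>b x\<bar> \<le> norm x * Kb"
    using b.nonneg_bounded by auto
  have bS: "(b x)\<^sup>2 \<le> Kb\<^sup>2 / c * S x x" for x
  proof -
    have "(b x)\<^sup>2 \<le> (norm x * Kb)\<^sup>2"
      using Kb(2)[of x] by (metis abs_ge_zero power2_abs power_mono)
    also have "\<dots> = Kb\<^sup>2 / c * (c * (norm x)\<^sup>2)" using c(1) by (simp add: power_mult_distrib)
    also have "\<dots> \<le> Kb\<^sup>2 / c * S x x" using c by (intro mult_left_mono) auto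
    finally show ?thesis .
  qed
  obtain KQ where KQ: "0 \<le> KQ" "\<And>x y. \<bar>Q x y\<bar> \<le> norm x * norm y * KQ"
    using Q.nonneg_bounded by auto
  have QS: "\<bar>Q x x\<bar> \<le> KQ / c * S x x" for x
  proof -
    have "\<bar>Q x x\<bar> \<le> KQ / c * (c * (norm x)\<^sup>2)"
      using KQ(2)[of x x] c(1) by (simp add: power2_eq_square mult.commute)
    also have "\<dots> \<le> KQ / c * S x x" using c KQ by (intro mult_left_mono) auto
    finally show ?thesis .
  qed
  have decay: "\<exists>K0. \<forall>s>0. s * S (T s x) (T s x) \<le> K0" if xD: "x \<in> D" and x0: "l x = 0" for x
  proof -
    \<comment> \<open>\<open>N\<close> copies of the energy of the orbit of \<open>x\<close> absorb \<open>b x\<close> and \<open>d x\<close>; \<open>P\<close> copies of the energy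
      of the difference quotients absorb \<open>b (A x)\<close>, which costs a factor \<open>2\<close> in the square of a sum.\<close>
    define N where "N = C / (2 * k)"
    define P where "P = C / k"
    have NP: "N \<ge> 0" "P \<ge> 0" "2 * N * k = C" "P * k = C" using C k by (auto simp: N_def P_def)
    define K1 where "K1 = N * S x x - Q x x + KQ / c * S x x"
    have "s * S (T s x) (T s x) \<le> K1 + P * S (A x) (A x)" if s: "s > 0" for s
    proof -
      define y where "y h = (1 / h) *\<^sub>R (T h x - x)" for h
      define \<delta> where "\<delta> h = 2 * C * (Kb\<^sup>2 / c) * S (A x - y h) (A x - y h)" for h
      have bound: "s * S (T s x) (T s x) \<le> K1 + P * S (y h) (y h) + s * \<delta> h" if h: "h > 0" for h
      proof -
        have hD: "T h x \<in> D" by (rule generator_orbit(1)[OF T gen xD]) (use h in simp)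
        have yD: "y h \<in> D"
          unfolding y_def by (rule generator_domain_diff_scaleR(1)[OF gen T hD xD])
        define V where "V t = N * S (T t x) (T t x) - Q (T t x) (T t x) + P * S (T t (y h)) (T t (y h))" for t
        \<comment> \<open>On \<open>[0,s]\<close> the energy is at least its final value, so \<open>V\<close> falls at least at this constant rate.\<close>
        have "V s + s * (S (T s x) (T s x) - \<delta> h) \<le> V 0 + 0 * (S (T s x) (T s x) - \<delta> h)"
        proof (rule right_derivative_nonpos_imp_le[of 0 s "\<lambda>t. V t + t * (S (T s x) (T s x) - \<delta> h)"])
          show "0 \<le> s" using s by simp
          show "continuous_on {0..s} (\<lambda>t. V t + t * (S (T s x) (T s x) - \<delta> h))"
            unfolding V_def
            by (intro continuous_intros continuous_on_subset[OF continuous_on_orbit_form[OF T S]]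
                continuous_on_subset[OF continuous_on_orbit_form[OF T Q]]) auto
          fix t assume t: "0 \<le> t" "t < s"
          define X where "X = T t x"
          define Y where "Y = T t (y h)"
          have X: "X \<in> D" and AX: "A X = T t (A x)" and Y: "Y \<in> D"
            unfolding X_def Y_def using generator_orbit(1,2)[OF T gen xD t(1)] generator_orbit(1)[OF T gen yD t(1)]
            by auto
          have lX: "l X = 0" using orbit_linear_invariant[OF T gen l l0 xD t(1)] x0 by (simp add: X_def)
          define V' where "V' = N * (S X (A X) + S (A X) X) - (Q X (A X) + Q (A X) X) +
              P * (S Y (A Y) + S (A Y) Y) + (S (T s x) (T s x) - \<delta> h)"
          have "((\<lambda>t. V t + t * (S (T s x) (T s x) - \<delta> h)) has_real_derivative V') (at_right t)"
            unfolding V_def V'_def X_def Y_def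
            by (auto intro!: derivative_eq_intros orbit_form_derivative[OF T gen S xD t(1)]
                orbit_form_derivative[OF T gen Q xD t(1)] orbit_form_derivative[OF T gen S yD t(1)])
          moreover have "V' \<le> 0"
          proof -
            have "b (A X) = b Y + b (T t (A x - y h))"
              unfolding AX Y_def using b.diff bounded_linear.axioms(1)[OF C0_semigroupD(1)[OF T t(1)], THEN linear_diff]
              by simp
            then have "(b (A X))\<^sup>2 \<le> 2 * (b Y)\<^sup>2 + 2 * (b (T t (A x - y h)))\<^sup>2"
              using sum_squares_bound[of "b Y" "b (T t (A x - y h))"] by (simp add: power2_sum)
            also have "(b (T t (A x - y h)))\<^sup>2 \<le> Kb\<^sup>2 / c * S (T t (A x - y h)) (T t (A x - y h))"
              by (rule bS)
            also have "\<dots> \<le> Kb\<^sup>2 / c * S (A x - y h) (A x - y h)"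
              using contr[OF t(1), of "A x - y h"] c(1) by (intro mult_left_mono) auto
            finally have "C * (b (A X))\<^sup>2 \<le> C * (2 * (b Y)\<^sup>2 + 2 * (Kb\<^sup>2 / c * S (A x - y h) (A x - y h)))"
              using C by (intro mult_left_mono) auto
            then have 1: "C * (b (A X))\<^sup>2 \<le> 2 * (C * (b Y)\<^sup>2) + \<delta> h" by (simp add: \<delta>_def algebra_simps)
            have "N * (2 * S X (A X)) \<le> N * (2 * (- k * ((b X)\<^sup>2 + d X)))"
              using diss[OF X] NP by (intro mult_left_mono) auto
            also have "\<dots> = - (2 * N * k * ((b X)\<^sup>2 + d X))" by (simp add: algebra_simps)
            finally have 2: "N * (2 * S X (A X)) \<le> - (C * ((b X)\<^sup>2 + d X))" by (simp only: NP(3))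
            have "P * (2 * S Y (A Y)) \<le> P * (2 * (- k * ((b Y)\<^sup>2 + 0)))"
            proof (intro mult_left_mono)
              have "k * (b Y)\<^sup>2 \<le> k * ((b Y)\<^sup>2 + d Y)" using k d[of Y] by (intro mult_left_mono) auto
              then show "S Y (A Y) \<le> - k * ((b Y)\<^sup>2 + 0)" using diss[OF Y] by simp
            qed (use NP in auto)
            also have "\<dots> = - (2 * (P * k * (b Y)\<^sup>2))" by simp
            finally have 3: "P * (2 * S Y (A Y)) \<le> - (2 * (C * (b Y)\<^sup>2))" by (simp only: NP(4))
            have 4: "S (T s x) (T s x) \<le> S X X"
              unfolding X_def by (rule orbit_form_antimono[OF T gen S sym _ xD]) (use t diss0 in auto)
            show ?thesis
              using 1 2 3 4 obs[OF X lX]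
              unfolding V'_def sym[of "A X" X] sym[of "A Y" Y] distrib_left mult_2 by linarith
          qed
          ultimately show "\<exists>V'\<le>0. ((\<lambda>t. V t + t * (S (T s x) (T s x) - \<delta> h)) has_real_derivative V') (at_right t)"
            by blast
        qed
        moreover have "V 0 = N * S x x - Q x x + P * S (y h) (y h)"
          by (simp add: V_def C0_semigroupD(2)[OF T])
        moreover have "- (KQ / c * S x x) \<le> V s"
        proof -
          have "\<bar>Q (T s x) (T s x)\<bar> \<le> KQ / c * S (T s x) (T s x)" by (rule QS)
          also have "\<dots> \<le> KQ / c * S x x"
            using contr[of s x] s KQ c(1) by (intro mult_left_mono) auto
          finally show ?thesis
            using mult_nonneg_nonneg[OF NP(1) S0[of "T s x"]] mult_nonneg_nonneg[OF NP(2) S0[of "T s (y h)"]]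
            unfolding V_def by linarith
        qed
        ultimately show ?thesis by (simp add: K1_def algebra_simps)
      qed
      have yl: "(y \<longlongrightarrow> A x) (at_right 0)"
      proof -
        have "y = (\<lambda>h. (T h x - x) /\<^sub>R h)" by (auto simp: y_def inverse_eq_divide)
        then show ?thesis using gen xD by (simp add: is_generator_def)
      qed
      have "((\<lambda>h. K1 + P * S (y h) (y h) + s * \<delta> h) \<longlongrightarrow> K1 + P * S (A x) (A x) +
          s * (2 * C * (Kb\<^sup>2 / c) * S (A x - A x) (A x - A x))) (at_right 0)"
        unfolding \<delta>_def by (intro tendsto_intros S.tendsto yl)
      then show ?thesis
        using eventually_at_right_less[of "0::real"]
        by (intro tendsto_lowerbound[of _ "K1 + P * S (A x) (A x)" "at_right 0"])
          (auto elim!: eventually_mono intro: bound simp: S.zero_left)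
    qed
    then show ?thesis by blast
  qed
  have decay': "((\<lambda>t. S (T t x) (T t x)) \<longlongrightarrow> 0) at_top" if xl: "x \<in> D" "l x = 0" for x
  proof -
    obtain K0 where K0: "\<And>s. s > 0 \<Longrightarrow> s * S (T s x) (T s x) \<le> K0" using decay[OF xl] by blast
    show ?thesis
    proof (rule tendsto_sandwich)
      show "\<forall>\<^sub>F s in at_top. 0 \<le> S (T s x) (T s x)" using S0 by simp
      show "\<forall>\<^sub>F s in at_top. S (T s x) (T s x) \<le> K0 / s"
        using eventually_gt_at_top[of 0]
        by eventually_elim (use K0 in \<open>simp add: field_simps\<close>)
      show "((\<lambda>s. K0 / s) \<longlongrightarrow> 0) at_top"
        by (intro real_tendsto_divide_at_top[OF tendsto_const] filterlim_ident)
    qed simp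
  qed
  show ?thesis
  proof (rule tendstoI)
    fix \<epsilon> :: real assume \<epsilon>: "\<epsilon> > 0"
    obtain X where X: "\<And>n. X n \<in> D" "X \<longlonglongrightarrow> x"
      using dense closure_sequential[of x D] by auto
    \<comment> \<open>Approximants in the domain are moved back into the kernel of \<open>l\<close>.\<close>
    define Y where "Y n = X n - l (X n) *\<^sub>R e" for n
    have z: "0 \<in> D" using generator_domain_diff_scaleR(1)[OF gen T e(1) e(1), of 1] by simp
    have Y: "Y n \<in> D" "l (Y n) = 0" for n
    proof -
      have "l (X n) *\<^sub>R (e - 0) \<in> D" by (rule generator_domain_diff_scaleR(1)[OF gen T e(1) z])
      from generator_domain_diff_scaleR(1)[OF gen T X(1)[of n] this, of 1]
      show "Y n \<in> D" by (simp add: Y_def)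
      show "l (Y n) = 0" by (simp add: Y_def l.diff l.scale e(2))
    qed
    have "Y \<longlonglongrightarrow> x - l x *\<^sub>R e" unfolding Y_def by (intro tendsto_intros l.tendsto X)
    then have "(\<lambda>n. S (x - Y n) (x - Y n)) \<longlonglongrightarrow> S (x - x) (x - x)"
      using x by (intro S.tendsto tendsto_intros) auto
    then have "\<forall>\<^sub>F n in sequentially. S (x - Y n) (x - Y n) < \<epsilon> / 4"
      using \<epsilon> by (intro order_tendstoD(2)) (auto simp: S.zero_left)
    then obtain n where n: "S (x - Y n) (x - Y n) < \<epsilon> / 4" using eventually_happens sequentially_bot by blast
    have "\<forall>\<^sub>F t in at_top. S (T t (Y n)) (T t (Y n)) < \<epsilon> / 4"
      by (rule order_tendstoD(2)[OF decay'[OF Y]]) (use \<epsilon> in simp)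
    then show "\<forall>\<^sub>F t in at_top. dist (S (T t x) (T t x)) 0 < \<epsilon>"
      using eventually_ge_at_top[of 0]
    proof eventually_elim
      case (elim t)
      define u where "u = T t (Y n)"
      define v where "v = T t (x - Y n)"
      have "T t x = u + v"
        using linear_diff[OF bounded_linear.linear[OF C0_semigroupD(1)[OF T elim(2)]], of x "Y n"] by (simp add: u_def v_def)
      moreover have "S (u + v) (u + v) + S (u - v) (u - v) = 2 * S u u + 2 * S v v"
        by (simp add: S.add_left S.add_right S.diff_left S.diff_right)
      moreover have "S v v < \<epsilon> / 4" unfolding v_def using contr[OF elim(2), of "x - Y n"] n by simp
      ultimately have "S (T t x) (T t x) < \<epsilon>" using S0[of "u - v"] elim(1) by (simp add: u_def)
      then show ?case using S0[of "T t x"] by simp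
    qed
  qed
qed

section \<open>Functions with a square integrable derivative\<close>

lemma integrable_leb01_absolutely:
  assumes "integrable leb01 (f :: real \<Rightarrow> real)"
  shows "f absolutely_integrable_on {0..1}"
  using assms absolutely_integrable_on_open_interval[where f = f and a = 0 and b = "1::real"]
  by (simp add: set_integrable_def integrable_restrict_space box_real)

lemma lebesgue_integral_leb01:
  assumes "integrable leb01 (f :: real \<Rightarrow> real)"
  shows "(LINT x|leb01. f x) = integral {0..1} f"
  using lebesgue_integral_eq_integral[OF assms] integral_open_interval_real[of 0 1 f] by simp

lemma continuous_on_measurable_leb01:
  assumes "continuous_on {0..1} (g :: real \<Rightarrow> real)"
  shows "g \<in> borel_measurable leb01"
  by (rule continuous_imp_measurable_on_sets_lebesgue[OF continuous_on_subset[OF assms]]) auto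

lemma square_integrable_continuous_mult:
  assumes g: "continuous_on {0..1} g" and f: "square_integrable f"
  shows "square_integrable (\<lambda>x. g x * f x)"
proof -
  have "compact (g ` {0..1})" using g by (intro compact_continuous_image) auto
  then obtain B where "\<forall>y\<in>g ` {0..1}. norm y \<le> B" using compact_imp_bounded bounded_iff by metis
  then have B: "\<And>x. x \<in> {0..1} \<Longrightarrow> \<bar>g x\<bar> \<le> B" by simp
  have [measurable]: "g \<in> borel_measurable leb01" "f \<in> borel_measurable leb01"
    using continuous_on_measurable_leb01[OF g] f by (auto simp: square_integrable_def)
  have "integrable leb01 (\<lambda>x. (g x * f x)\<^sup>2)"
  proof (rule Bochner_Integration.integrable_bound)
    show "integrable leb01 (\<lambda>x. B\<^sup>2 * (f x)\<^sup>2)" using f by (auto simp: square_integrable_def)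
    show "AE x in leb01. norm ((g x * f x)\<^sup>2) \<le> norm (B\<^sup>2 * (f x)\<^sup>2)"
    proof (rule AE_I2)
      fix x assume "x \<in> space leb01"
      then have "\<bar>g x\<bar> \<le> B" using B[of x] by auto
      then have "(g x)\<^sup>2 \<le> B\<^sup>2" by (metis abs_ge_zero power2_abs power_mono)
      then show "norm ((g x * f x)\<^sup>2) \<le> norm (B\<^sup>2 * (f x)\<^sup>2)"
        by (simp add: power_mult_distrib mult_right_mono)
    qed
  qed measurable
  then show ?thesis by (auto simp: square_integrable_def)
qed

lemma square_integrable_continuous:
  "continuous_on {0..1} g \<Longrightarrow> square_integrable g"
  using square_integrable_continuous_mult[OF _ square_integrable_const[of 1]] by simp

lemma square_integrable_absolutely:
  "square_integrable f \<Longrightarrow> f absolutely_integrable_on {0..1}"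
  by (intro integrable_leb01_absolutely square_integrable_integrable)

lemma square_integrable_integrable_on:
  assumes "square_integrable f" "0 \<le> s" "t \<le> 1"
  shows "f integrable_on {s..t}" "f absolutely_integrable_on {s..t}" "(\<lambda>x. \<bar>f x\<bar>) integrable_on {s..t}"
proof -
  show *: "f absolutely_integrable_on {s..t}"
    by (rule absolutely_integrable_on_subinterval[OF square_integrable_absolutely[OF assms(1)]])
      (use assms in auto)
  show "f integrable_on {s..t}" "(\<lambda>x. \<bar>f x\<bar>) integrable_on {s..t}"
    using * by (auto simp: absolutely_integrable_on_def)
qed

text \<open>
  \<open>F\<close> is the continuous representative of an element of \<open>H\<^sup>1(0,1)\<close> and \<open>f\<close> represents its weak
  derivative. Working with genuine functions on \<open>[0,1]\<close> makes boundary values and products immediate.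
\<close>

definition has_L2_deriv :: "(real \<Rightarrow> real) \<Rightarrow> (real \<Rightarrow> real) \<Rightarrow> bool" where
  "has_L2_deriv F f \<longleftrightarrow> square_integrable f \<and> (\<forall>x\<in>{0..1}. F x = F 0 + integral {0..x} f)"

lemma has_L2_derivD:
  assumes "has_L2_deriv F f"
  shows "square_integrable f" "x \<in> {0..1} \<Longrightarrow> F x = F 0 + integral {0..x} f"
  using assms unfolding has_L2_deriv_def by blast+

lemma has_L2_deriv_continuous:
  assumes "has_L2_deriv F f"
  shows "continuous_on {0..1} F"
proof -
  have "continuous_on {0..1} (\<lambda>x. F 0 + integral {0..x} f)"
    by (intro continuous_intros indefinite_integral_continuous_1 square_integrable_integrable_on
        has_L2_derivD(1)[OF assms]) auto
  then show ?thesis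
    by (rule continuous_on_eq) (metis has_L2_derivD(2)[OF assms])
qed

lemma has_L2_deriv_diff_eq:
  assumes "has_L2_deriv F f" "0 \<le> s" "s \<le> t" "t \<le> 1"
  shows "F t - F s = integral {s..t} f"
proof -
  have "integral {0..s} f + integral {s..t} f = integral {0..t} f"
    using assms(2-) by (intro Henstock_Kurzweil_Integration.integral_combine square_integrable_integrable_on
      has_L2_derivD(1)[OF assms(1)]) auto
  moreover have "F t = F 0 + integral {0..t} f" "F s = F 0 + integral {0..s} f"
    using assms(2-) by (intro has_L2_derivD(2)[OF assms(1)]; simp)+
  ultimately show ?thesis by simp
qed

lemma has_L2_deriv_C1:
  assumes "\<And>x. x \<in> {0..1} \<Longrightarrow> (G has_real_derivative g x) (at x within {0..1})" "continuous_on {0..1} g"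
  shows "has_L2_deriv G g"
  unfolding has_L2_deriv_def
proof (intro conjI ballI square_integrable_continuous assms)
  fix x :: real assume x: "x \<in> {0..1}"
  have "(g has_integral G x - G 0) {0..x}"
    using x assms(1)
    by (intro fundamental_theorem_of_calculus)
      (auto simp: has_real_derivative_iff_has_vector_derivative[symmetric] intro!: DERIV_subset[OF assms(1)])
  then show "G x = G 0 + integral {0..x} g" by (simp add: integral_unique)
qed

lemma has_L2_deriv_const: "has_L2_deriv (\<lambda>x. c) (\<lambda>x. 0)"
  by (rule has_L2_deriv_C1) (auto intro: continuous_intros)

lemma has_L2_deriv_add:
  assumes "has_L2_deriv F f" "has_L2_deriv G g"
  shows "has_L2_deriv (\<lambda>x. F x + G x) (\<lambda>x. f x + g x)"
  unfolding has_L2_deriv_def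
proof (intro conjI ballI square_integrable_add)
  fix x :: real assume x: "x \<in> {0..1}"
  show "F x + G x = F 0 + G 0 + integral {0..x} (\<lambda>x. f x + g x)"
    unfolding has_L2_derivD(2)[OF assms(1) x] has_L2_derivD(2)[OF assms(2) x]
    using x square_integrable_integrable_on(1)[OF has_L2_derivD(1)[OF assms(1)], of 0 x]
      square_integrable_integrable_on(1)[OF has_L2_derivD(1)[OF assms(2)], of 0 x]
    by (simp add: Henstock_Kurzweil_Integration.integral_add)
qed (intro has_L2_derivD(1)[OF assms(1)] has_L2_derivD(1)[OF assms(2)])+

lemma has_L2_deriv_cmult:
  assumes "has_L2_deriv F f"
  shows "has_L2_deriv (\<lambda>x. c * F x) (\<lambda>x. c * f x)"
  unfolding has_L2_deriv_def
proof (intro conjI ballI square_integrable_cmult)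
  fix x :: real assume x: "x \<in> {0..1}"
  show "c * F x = c * F 0 + integral {0..x} (\<lambda>x. c * f x)"
    unfolding has_L2_derivD(2)[OF assms x] by (simp add: distrib_left)
qed (rule has_L2_derivD(1)[OF assms])

lemma has_L2_deriv_diff:
  assumes "has_L2_deriv F f" "has_L2_deriv G g"
  shows "has_L2_deriv (\<lambda>x. F x - G x) (\<lambda>x. f x - g x)"
  using has_L2_deriv_add[OF assms(1) has_L2_deriv_cmult[OF assms(2), of "-1"]] by simp

lemma has_L2_deriv_cong:
  assumes "has_L2_deriv F f" "\<And>x. x \<in> {0..1} \<Longrightarrow> G x = F x"
  shows "has_L2_deriv G f"
  unfolding has_L2_deriv_def
  using has_L2_derivD[OF assms(1)] assms(2)[of 0] assms(2) by (metis atLeastAtMost_iff order_refl zero_le_one)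

text \<open>
  On a short interval \<open>[s,t]\<close> the mean value theorem and the intermediate value theorem give
  \<open>\<phi> (F t) - \<phi> (F s) = \<phi>' (F r) * (F t - F s)\<close> with \<open>r\<close> in \<open>[s,t]\<close>. By uniform continuity of \<open>\<phi>' \<circ> F\<close>
  this differs from \<open>\<integral> \<phi>' (F x) f x dx\<close> over \<open>[s,t]\<close> by at most \<open>e \<integral> \<bar>f\<bar> dx\<close>. These errors add up over
  a partition to at most \<open>e \<integral> \<bar>f\<bar> dx\<close> over the whole interval.
\<close>

lemma has_L2_deriv_chain:
  assumes F: "has_L2_deriv F f"
    and \<phi>: "\<And>x. (\<phi> has_real_derivative \<phi>' x) (at x)" and \<phi>': "continuous_on UNIV \<phi>'"
  shows "has_L2_deriv (\<lambda>x. \<phi> (F x)) (\<lambda>x. \<phi>' (F x) * f x)"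
proof -
  have cF: "continuous_on {0..1} F" by (rule has_L2_deriv_continuous[OF F])
  have ch: "continuous_on {0..1} (\<lambda>x. \<phi>' (F x))"
    by (rule continuous_on_compose2[OF \<phi>' cF]) auto
  have sf: "square_integrable f" by (rule has_L2_derivD(1)[OF F])
  define g where "g x = \<phi>' (F x) * f x" for x
  have sg: "square_integrable g" unfolding g_def by (rule square_integrable_continuous_mult[OF ch sf])
  note int = square_integrable_integrable_on[OF sf] square_integrable_integrable_on[OF sg]
  have local: "\<bar>\<phi> (F t) - \<phi> (F s) - integral {s..t} g\<bar> \<le> e * integral {s..t} (\<lambda>x. \<bar>f x\<bar>)"
    if st: "0 \<le> s" "s \<le> t" "t \<le> 1"
      and osc: "\<And>p q. p \<in> {s..t} \<Longrightarrow> q \<in> {s..t} \<Longrightarrow> \<bar>\<phi>' (F p) - \<phi>' (F q)\<bar> \<le> e" for s t e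
  proof -
    have cst: "continuous_on {s..t} F" by (rule continuous_on_subset[OF cF]) (use st in auto)
    have "\<exists>r\<in>{s..t}. \<phi> (F t) - \<phi> (F s) = \<phi>' (F r) * (F t - F s)"
    proof (cases "F s = F t")
      case False
      define lo where "lo = min (F s) (F t)"
      define hi where "hi = max (F s) (F t)"
      have "lo < hi" using False by (auto simp: lo_def hi_def)
      then obtain z where z: "lo < z" "z < hi" "\<phi> hi - \<phi> lo = (hi - lo) * \<phi>' z"
        using MVT2[of lo hi \<phi> \<phi>'] \<phi> by blast
      have "\<exists>r. s \<le> r \<and> r \<le> t \<and> F r = z"
        using IVT'[OF _ _ st(2) cst, of z] IVT2'[OF _ _ st(2) cst, of z] z
        by (auto simp: lo_def hi_def min_def max_def split: if_splits)
      then obtain r where r: "r \<in> {s..t}" "F r = z" by auto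
      have "\<phi> (F t) - \<phi> (F s) = \<phi>' z * (F t - F s)"
        using z(3) by (cases "F s \<le> F t") (simp_all add: lo_def hi_def min_def max_def algebra_simps)
      then show ?thesis using r by auto
    qed (use st in auto)
    then obtain r where r: "r \<in> {s..t}" "\<phi> (F t) - \<phi> (F s) = \<phi>' (F r) * (F t - F s)" by blast
    have "\<phi> (F t) - \<phi> (F s) - integral {s..t} g = integral {s..t} (\<lambda>x. (\<phi>' (F r) - \<phi>' (F x)) * f x)"
    proof -
      have "integral {s..t} (\<lambda>x. \<phi>' (F r) * f x - g x) = \<phi>' (F r) * integral {s..t} f - integral {s..t} g"
        using st
        by (subst Henstock_Kurzweil_Integration.integral_diff[OF integrable_on_mult_right[OF int(1)] int(4)])
          auto
      then show ?thesis unfolding r(2) has_L2_deriv_diff_eq[OF F st]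
        by (simp add: g_def left_diff_distrib)
    qed
    also have "\<bar>\<dots>\<bar> \<le> integral {s..t} (\<lambda>x. e * \<bar>f x\<bar>)"
      unfolding real_norm_def[symmetric]
    proof (rule Henstock_Kurzweil_Integration.integral_norm_bound_integral)
      have "(\<lambda>x. \<phi>' (F r) * f x - g x) integrable_on {s..t}"
        using st by (intro integrable_diff integrable_on_mult_right int) auto
      then show "(\<lambda>x. (\<phi>' (F r) - \<phi>' (F x)) * f x) integrable_on {s..t}"
        by (simp add: g_def left_diff_distrib)
      show "(\<lambda>x. e * norm (f x)) integrable_on {s..t}"
        using int(3)[of s t] st integrable_on_mult_right by force
      show "norm ((\<phi>' (F r) - \<phi>' (F x)) * f x) \<le> e * norm (f x)" if "x \<in> {s..t}" for x
        using osc[OF r(1) that] by (simp add: abs_mult mult_right_mono)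
    qed
    finally show ?thesis by simp
  qed
  have "\<phi> (F x) = \<phi> (F 0) + integral {0..x} g" if x: "x \<in> {0..1}" for x
  proof -
    define I where "I = integral {0..x} (\<lambda>x. \<bar>f x\<bar>)"
    have I0: "0 \<le> I" unfolding I_def by (rule integral_nonneg) (use int x in auto)
    have small: "\<bar>\<phi> (F x) - \<phi> (F 0) - integral {0..x} g\<bar> \<le> e * I" if e: "e > 0" for e
    proof -
      have "uniformly_continuous_on {0..1} (\<lambda>x. \<phi>' (F x))"
        by (rule compact_uniformly_continuous[OF ch]) auto
      then obtain \<delta> where \<delta>: "\<delta> > 0" "\<And>p q. p \<in> {0..1} \<Longrightarrow> q \<in> {0..1} \<Longrightarrow> \<bar>p - q\<bar> < \<delta> \<Longrightarrow>
          \<bar>\<phi>' (F p) - \<phi>' (F q)\<bar> < e"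
        using e unfolding uniformly_continuous_on_def dist_real_def by metis
      obtain n where n: "1 / real (Suc n) < \<delta>" using nat_approx_posE[OF \<delta>(1)] .
      define t where "t k = x * real k / real (Suc n)" for k
      have t: "0 \<le> t k" "t k \<le> t (Suc k)" for k using x by (auto simp: t_def field_simps)
      have t1: "t k \<le> x" if "k \<le> Suc n" for k
      proof -
        have "x * real k \<le> x * real (Suc n)" using that x by (intro mult_left_mono) auto
        then show ?thesis by (simp add: t_def divide_simps)
      qed
      have step: "t (Suc k) - t k < \<delta>" for k
      proof -
        have "t (Suc k) - t k = x / real (Suc n)" by (simp add: t_def diff_divide_distrib[symmetric] right_diff_distrib[symmetric])
        also have "\<dots> \<le> 1 / real (Suc n)" using x by (intro divide_right_mono) auto
        finally show ?thesis using n by simp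
      qed
      have "\<bar>\<phi> (F (t k)) - \<phi> (F 0) - integral {0..t k} g\<bar> \<le> e * integral {0..t k} (\<lambda>x. \<bar>f x\<bar>)"
        if "k \<le> Suc n" for k
        using that
      proof (induction k)
        case 0
        then show ?case by (simp add: t_def)
      next
        case (Suc k)
        have le1: "t (Suc k) \<le> 1" using t1[OF Suc.prems] x by simp
        have "\<bar>\<phi> (F (t (Suc k))) - \<phi> (F (t k)) - integral {t k..t (Suc k)} g\<bar> \<le>
            e * integral {t k..t (Suc k)} (\<lambda>x. \<bar>f x\<bar>)"
        proof (rule local)
          fix p q assume pq: "p \<in> {t k..t (Suc k)}" "q \<in> {t k..t (Suc k)}"
          then have "p \<in> {0..1}" "q \<in> {0..1}" using t(1)[of k] le1 by auto
          moreover have "\<bar>p - q\<bar> < \<delta>" using pq step[of k] by auto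
          ultimately show "\<bar>\<phi>' (F p) - \<phi>' (F q)\<bar> \<le> e" using \<delta>(2) by (simp add: less_imp_le)
        qed (use t le1 in auto)
        moreover have add: "integral {0..t k} g + integral {t k..t (Suc k)} g = integral {0..t (Suc k)} g"
          "integral {0..t k} (\<lambda>x. \<bar>f x\<bar>) + integral {t k..t (Suc k)} (\<lambda>x. \<bar>f x\<bar>) =
            integral {0..t (Suc k)} (\<lambda>x. \<bar>f x\<bar>)"
          using t le1 by (intro Henstock_Kurzweil_Integration.integral_combine int; simp)+
        moreover have "\<bar>\<phi> (F (t k)) - \<phi> (F 0) - integral {0..t k} g\<bar> \<le> e * integral {0..t k} (\<lambda>x. \<bar>f x\<bar>)"
          using Suc by simp
        ultimately show ?case unfolding add(2)[symmetric] distrib_left by linarith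
      qed
      from this[of "Suc n"] show ?thesis by (simp add: t_def I_def)
    qed
    have "\<bar>\<phi> (F x) - \<phi> (F 0) - integral {0..x} g\<bar> \<le> 0"
    proof (rule field_le_epsilon)
      fix e :: real assume e: "e > 0"
      have "\<bar>\<phi> (F x) - \<phi> (F 0) - integral {0..x} g\<bar> \<le> e / (I + 1) * I"
        using small[of "e / (I + 1)"] e I0 by simp
      also have "\<dots> \<le> e" using e I0 by (simp add: field_simps)
      finally show "\<bar>\<phi> (F x) - \<phi> (F 0) - integral {0..x} g\<bar> \<le> 0 + e" by simp
    qed
    then show ?thesis by simp
  qed
  then show ?thesis using sg unfolding has_L2_deriv_def g_def by blast
qed

text \<open>
  By polarization the product rule follows from the chain rule for the square.
\<close>

lemma has_L2_deriv_mult: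
  assumes F: "has_L2_deriv F f" and G: "has_L2_deriv G g"
  shows "has_L2_deriv (\<lambda>x. F x * G x) (\<lambda>x. f x * G x + F x * g x)"
proof -
  have sq: "has_L2_deriv (\<lambda>x. (H x)\<^sup>2) (\<lambda>x. 2 * H x * h x)" if "has_L2_deriv H h" for H h
  proof (rule has_L2_deriv_chain[OF that, of "\<lambda>x. x\<^sup>2" "\<lambda>x. 2 * x"])
    show "((\<lambda>x::real. x\<^sup>2) has_real_derivative 2 * x) (at x)" for x
      by (auto intro!: derivative_eq_intros)
  qed (intro continuous_intros)
  have "has_L2_deriv (\<lambda>x. (1/4) * ((F x + G x)\<^sup>2 - (F x - G x)\<^sup>2))
      (\<lambda>x. (1/4) * (2 * (F x + G x) * (f x + g x) - 2 * (F x - G x) * (f x - g x)))"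
    by (intro has_L2_deriv_cmult has_L2_deriv_diff sq has_L2_deriv_add assms)
  moreover have "(1/4) * ((F x + G x)\<^sup>2 - (F x - G x)\<^sup>2) = F x * G x" for x
    by (simp add: power2_eq_square algebra_simps)
  moreover have "(1/4) * (2 * (F x + G x) * (f x + g x) - 2 * (F x - G x) * (f x - g x)) = f x * G x + F x * g x" for x
    by (simp add: algebra_simps)
  ultimately show ?thesis by (simp only:)
qed

lemma has_L2_deriv_integral:
  "has_L2_deriv F f \<Longrightarrow> integral {0..1} f = F 1 - F 0"
  using has_L2_derivD(2)[of F f 1] by simp

lemma has_L2_deriv_mult_integral:
  assumes "has_L2_deriv F f" "has_L2_deriv G g"
  shows "integral {0..1} (\<lambda>x. f x * G x + F x * g x) = F 1 * G 1 - F 0 * G 0"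
  by (rule has_L2_deriv_integral[OF has_L2_deriv_mult[OF assms]])

section \<open>Continuous representatives in $H^1(0,1)$\<close>

lemma LINT_rep_abs_L2_mult:
  assumes "square_integrable f" "square_integrable g"
  shows "(LINT x|leb01. rep_L2 (abs_L2 f) x * g x) = integral {0..1} (\<lambda>x. f x * g x)"
proof -
  have [measurable]: "f \<in> borel_measurable leb01" "g \<in> borel_measurable leb01"
    using assms by (auto simp: square_integrable_def)
  have "(LINT x|leb01. rep_L2 (abs_L2 f) x * g x) = (LINT x|leb01. f x * g x)"
    by (rule integral_cong_AE) (use rep_abs_L2[OF assms(1)] in auto)
  also have "\<dots> = integral {0..1} (\<lambda>x. f x * g x)"
    by (rule lebesgue_integral_leb01[OF square_integrable_mult[OF assms]])
  finally show ?thesis .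
qed

lemma test_function_support:
  assumes "test_function \<phi>"
  obtains c d where "0 < c" "c \<le> d" "d < 1" "\<And>x. x \<notin> {c..d} \<Longrightarrow> \<phi> x = 0"
proof -
  obtain C where C: "compact C" "C \<subseteq> {0<..<1}" "\<And>x. x \<notin> C \<Longrightarrow> \<phi> x = 0"
    using assms unfolding test_function_def by auto
  define C' where "C' = insert (1/2) C"
  have C': "compact C'" "C' \<noteq> {}" "C' \<subseteq> {0<..<1}" using C by (auto simp: C'_def)
  obtain c where c: "c \<in> C'" "\<And>x. x \<in> C' \<Longrightarrow> c \<le> x" using compact_attains_inf[OF C'(1,2)] by blast
  obtain d where d: "d \<in> C'" "\<And>x. x \<in> C' \<Longrightarrow> x \<le> d" using compact_attains_sup[OF C'(1,2)] by blast
  show thesis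
    by (rule that[of c d]) (use c d C' C(3) in \<open>auto simp: C'_def\<close>)
qed

lemma test_function_has_derivative:
  assumes "test_function \<phi>"
  shows "(\<phi> has_real_derivative deriv \<phi> x) (at x)"
proof -
  have "\<phi> differentiable (at x)"
    using assms by (auto simp: test_function_def C1_differentiable_on_eq)
  then show ?thesis using DERIV_deriv_iff_real_differentiable by blast
qed

lemma has_L2_deriv_test_function:
  assumes "test_function \<phi>"
  shows "has_L2_deriv \<phi> (deriv \<phi>)"
  using test_functionD[OF assms] test_function_has_derivative[OF assms]
  by (intro has_L2_deriv_C1) (auto intro: continuous_on_subset has_field_derivative_at_within)

lemma has_L2_deriv_imp_has_weak_deriv:
  assumes F: "has_L2_deriv F f"
  shows "has_weak_deriv (abs_L2 F) (abs_L2 f)"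
  unfolding has_weak_deriv_def
proof (intro allI impI)
  fix \<phi> assume t: "test_function \<phi>"
  obtain c d where cd: "0 < c" "c \<le> d" "d < 1" "\<And>x. x \<notin> {c..d} \<Longrightarrow> \<phi> x = 0"
    using test_function_support[OF t] by metis
  then have "\<phi> 0 = 0" "\<phi> 1 = 0" by auto
  moreover note sF = square_integrable_continuous[OF has_L2_deriv_continuous[OF F]]
    and sf = has_L2_derivD(1)[OF F]
    and s\<phi> = square_integrable_continuous[OF has_L2_deriv_continuous[OF has_L2_deriv_test_function[OF t]]]
    and sd = has_L2_derivD(1)[OF has_L2_deriv_test_function[OF t]]
  have "integral {0..1} (\<lambda>x. f x * \<phi> x + F x * deriv \<phi> x) =
      integral {0..1} (\<lambda>x. f x * \<phi> x) + integral {0..1} (\<lambda>x. F x * deriv \<phi> x)"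
    by (intro Henstock_Kurzweil_Integration.integral_add set_lebesgue_integral_eq_integral(1)
        integrable_leb01_absolutely square_integrable_mult sf s\<phi> sF sd)
  ultimately show "(LINT x|leb01. rep_L2 (abs_L2 F) x * deriv \<phi> x) = - (LINT x|leb01. rep_L2 (abs_L2 f) x * \<phi> x)"
    using has_L2_deriv_mult_integral[OF F has_L2_deriv_test_function[OF t]]
    by (simp add: LINT_rep_abs_L2_mult sF sf s\<phi> sd)
qed

text \<open>
  The mean value zero makes the primitive vanish to the right of the support.
\<close>

lemma test_function_antiderivative:
  assumes k: "continuous_on UNIV k" and cd: "0 < c" "c \<le> d" "d < 1" "\<And>x. x \<notin> {c..d} \<Longrightarrow> k x = 0"
    and k0: "integral {0..1} k = 0"
  shows "\<exists>\<phi>. test_function \<phi> \<and> deriv \<phi> = k"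
proof -
  define \<phi> where "\<phi> x = integral {0..x} k" for x
  have int: "k integrable_on {s..t}" for s t
    using k by (intro integrable_continuous_real) (auto intro: continuous_on_subset)
  have left: "\<phi> x = 0" if "x < c" for x
    unfolding \<phi>_def by (subst integral_cong[of "{0..x}" k "\<lambda>x. 0"]) (use cd(4) that in auto)
  have right: "\<phi> x = 0" if "d < x" for x
  proof (cases "x \<le> 1")
    case True
    have "integral {0..x} k + integral {x..1} k = integral {0..1} k"
      by (intro Henstock_Kurzweil_Integration.integral_combine int) (use that True cd in auto)
    moreover have "integral {x..1} k = 0"
      by (subst integral_cong[of "{x..1}" k "\<lambda>x. 0"]) (use cd(4) that in auto)
    ultimately show ?thesis by (simp add: \<phi>_def k0)
  next
    case False
    have "integral {0..1} k + integral {1..x} k = integral {0..x} k"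
      by (intro Henstock_Kurzweil_Integration.integral_combine int) (use that False cd in auto)
    moreover have "integral {1..x} k = 0"
      by (subst integral_cong[of "{1..x}" k "\<lambda>x. 0"]) (use cd that in auto)
    ultimately show ?thesis by (simp add: \<phi>_def k0)
  qed
  have der: "(\<phi> has_real_derivative k x) (at x)" for x
  proof (cases "x < c")
    case True
    have "((\<lambda>_. 0) has_real_derivative k x) (at x)" using cd(4)[of x] True by auto
    then show ?thesis
      by (rule has_field_derivative_transform_within_open[of _ _ _ "{..<c}"]) (use True left in auto)
  next
    case False
    have "((\<lambda>u. integral {0..u} k) has_real_derivative k x) (at x within {0..x + 1})"
      by (rule integral_has_real_derivative) (use k False cd in \<open>auto intro: continuous_on_subset\<close>)
    moreover have "at x within {0..x + 1} = at x"
      by (rule at_within_interior) (use False cd in \<open>auto simp: interior_atLeastAtMost_real\<close>)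
    ultimately show ?thesis by (simp add: \<phi>_def[abs_def])
  qed
  have "\<phi> C1_differentiable_on UNIV"
    unfolding C1_differentiable_on_def using der k
    by (intro exI[of _ k]) (auto simp: has_real_derivative_iff_has_vector_derivative)
  then have "test_function \<phi>"
    unfolding test_function_def using left right cd
    by (intro conjI exI[of _ "{c..d}"]) (auto simp: not_le)
  moreover have "deriv \<phi> = k" using der by (auto intro: DERIV_imp_deriv)
  ultimately show ?thesis by blast
qed

text \<open>
  The lemma of du Bois-Reymond. Subtracting from a test function \<open>\<psi>\<close> the multiple of a fixed test
  function \<open>\<theta>\<close> with the same integral leaves the derivative of a test function. So testing \<open>h\<close>
  with \<open>\<psi>\<close> gives the same as testing a constant that depends only on \<open>\<theta>\<close>.
\<close>

lemma weak_deriv_zero_imp_const: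
  assumes h: "has_weak_deriv h 0"
  shows "\<exists>c. h = abs_L2 (\<lambda>x. c)"
proof -
  define \<theta> where "\<theta> = bump (1/4) (3/4)"
  have t\<theta>: "test_function \<theta>" using test_function_bump[of "1/4" "3/4" 1] by (simp add: \<theta>_def)
  note c\<theta> = test_functionD(1)[OF t\<theta>]
  define I where "I = integral {0..1} \<theta>"
  have c01: "continuous_on {0..1} \<phi>" if "test_function \<phi>" for \<phi>
    using test_functionD(1)[OF that] by (rule continuous_on_subset) simp
  have "I \<noteq> 0"
  proof
    assume "I = 0"
    moreover have "\<theta> x \<ge> 0" for x by (simp add: \<theta>_def bump_def)
    ultimately have "\<forall>x\<in>{0..1}. \<theta> x = 0"
      unfolding I_def using integral_eq_0_iff[OF c01[OF t\<theta>]] by auto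
    from bspec[OF this, of "1/2"] show False by (simp add: \<theta>_def bump_def)
  qed
  define c where "c = (LINT x|leb01. rep_L2 h x * \<theta> x) / I"
  have "h - abs_L2 (\<lambda>x. c) = 0"
  proof (rule weak_zero_imp_zero)
    fix \<psi> assume t: "test_function \<psi>"
    note c\<psi> = test_functionD(1)[OF t]
    define J where "J = integral {0..1} \<psi>"
    define k where "k x = \<psi> x - J / I * \<theta> x" for x
    have ck: "continuous_on UNIV k" unfolding k_def by (intro continuous_intros c\<psi> c\<theta>)
    obtain c1 d1 where 1: "0 < c1" "c1 \<le> d1" "d1 < 1" "\<And>x. x \<notin> {c1..d1} \<Longrightarrow> \<psi> x = 0"
      using test_function_support[OF t] by metis
    obtain c2 d2 where 2: "0 < c2" "c2 \<le> d2" "d2 < 1" "\<And>x. x \<notin> {c2..d2} \<Longrightarrow> \<theta> x = 0"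
      using test_function_support[OF t\<theta>] by metis
    have int: "\<phi> integrable_on {0..1}" if "test_function \<phi>" for \<phi>
      by (intro integrable_continuous_real c01 that)
    have "integral {0..1} k = 0"
      unfolding k_def using int[OF t] int[OF t\<theta>] \<open>I \<noteq> 0\<close>
      by (subst Henstock_Kurzweil_Integration.integral_diff) (auto simp: I_def J_def intro: integrable_on_mult_right)
    moreover have "k x = 0" if "x \<notin> {min c1 c2..max d1 d2}" for x
    proof -
      have "x \<notin> {c1..d1}" "x \<notin> {c2..d2}" using that by auto
      then show ?thesis using 1(4) 2(4) by (simp add: k_def del: atLeastAtMost_iff)
    qed
    ultimately have "\<exists>\<phi>. test_function \<phi> \<and> deriv \<phi> = k"
      using 1 2 by (intro test_function_antiderivative[OF ck, of "min c1 c2" "max d1 d2"]) auto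
    then obtain \<phi> where "test_function \<phi>" "deriv \<phi> = k" by blast
    then have "(LINT x|leb01. rep_L2 h x * k x) = 0"
      using h unfolding has_weak_deriv_def
      using integral_rep_L2_lincomb[OF test_functionD(1,3)[OF \<open>test_function \<phi>\<close>], of 0 1 0] by auto
    moreover have "(LINT x|leb01. rep_L2 h x * k x) =
        (LINT x|leb01. rep_L2 h x * \<psi> x) - J / I * (LINT x|leb01. rep_L2 h x * \<theta> x)"
      using integrable_rep_L2_mult[OF test_functionD(1,3)[OF t], of h]
        integrable_rep_L2_mult[OF test_functionD(1,3)[OF t\<theta>], of h]
      unfolding k_def by (simp add: right_diff_distrib mult.left_commute)
    ultimately have "(LINT x|leb01. rep_L2 h x * \<psi> x) = c * J" by (simp add: c_def)
    moreover have "(LINT x|leb01. rep_L2 (abs_L2 (\<lambda>x. c)) x * \<psi> x) = c * J"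
      using LINT_rep_abs_L2_mult[OF square_integrable_const square_integrable_continuous[OF c01[OF t]], of c]
      by (simp add: J_def)
    ultimately show "(LINT x|leb01. rep_L2 (h - abs_L2 (\<lambda>x. c)) x * \<psi> x) = 0"
      using integral_rep_L2_lincomb[OF test_functionD(1,3)[OF t], of h "-1" "abs_L2 (\<lambda>x. c)"] by simp
  qed
  then show ?thesis by auto
qed

lemma abs_rep_L2: "abs_L2 (rep_L2 f) = f"
  by (rule Quotient_abs_rep[OF Quotient_L2])

lemma abs_L2_eq_iff:
  assumes "square_integrable f" "square_integrable g"
  shows "abs_L2 f = abs_L2 g \<longleftrightarrow> (AE x in leb01. f x = g x)"
  using Quotient_rel_abs[OF Quotient_L2, of f g] assms Quotient_rel[OF Quotient_L2, of f g] by blast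

lemma abs_L2_add:
  assumes "square_integrable f" "square_integrable g"
  shows "abs_L2 (\<lambda>x. f x + g x) = abs_L2 f + abs_L2 g"
  using assms by (simp add: plus_L2.abs_eq)

lemma continuous_AE_eq_imp_eq:
  assumes "continuous_on {0..1} v" "continuous_on {0..1} w" "AE x in leb01. v x = w x" "x \<in> {0..1}"
  shows "v x = (w x :: real)"
proof -
  have c: "continuous_on {0..1} (\<lambda>x. \<bar>v x - w x\<bar>)" by (intro continuous_intros assms)
  have "(LINT x|leb01. \<bar>v x - w x\<bar>) = 0"
    by (rule integral_eq_zero_AE) (use assms(3) in auto)
  then have "integral {0..1} (\<lambda>x. \<bar>v x - w x\<bar>) = 0"
    by (subst (asm) lebesgue_integral_leb01[OF square_integrable_integrable[OF square_integrable_continuous[OF c]]])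
  then have "\<forall>x\<in>{0..1}. \<bar>v x - w x\<bar> = 0" using integral_eq_0_iff[OF c] by simp
  then show ?thesis using assms(4) by fastforce
qed

text \<open>
  A primitive of the weak derivative differs from \<open>y\<close> by a constant. This links the classes
  of \<open>H\<^sup>1(0,1)\<close> to the calculus of \<open>has_L2_deriv\<close>.
\<close>

lemma in_H1_cont_rep:
  assumes "in_H1 y"
  shows "has_L2_deriv (cont_rep y) (rep_L2 (weak_deriv y))" "abs_L2 (cont_rep y) = y"
    "AE x in leb01. rep_L2 y x = cont_rep y x"
proof -
  define g where "g = rep_L2 (weak_deriv y)"
  have sg: "square_integrable g" by (simp add: g_def rep_L2_square_integrable)
  define F where "F x = integral {0..x} g" for x
  have F: "has_L2_deriv F g" unfolding has_L2_deriv_def F_def using sg by simp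
  have "has_weak_deriv (y + (- 1) *\<^sub>R abs_L2 F) (weak_deriv y + (- 1) *\<^sub>R abs_L2 g)"
    by (intro has_weak_deriv_lincomb has_weak_deriv_weak_deriv assms has_L2_deriv_imp_has_weak_deriv F)
  then obtain c where c: "y - abs_L2 F = abs_L2 (\<lambda>x. c)"
    using weak_deriv_zero_imp_const[of "y - abs_L2 F"] by (auto simp: g_def abs_rep_L2)
  have cF: "has_L2_deriv (\<lambda>x. c + F x) g" using has_L2_deriv_add[OF has_L2_deriv_const F] by simp
  note ccF = has_L2_deriv_continuous[OF cF] has_L2_deriv_continuous[OF F]
  have "y = abs_L2 (\<lambda>x. c + F x)"
    using c abs_L2_add[OF square_integrable_const square_integrable_continuous[OF ccF(2)], of c]
    by (simp add: algebra_simps)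
  then have ae: "AE x in leb01. rep_L2 y x = c + F x"
    using rep_abs_L2[OF square_integrable_continuous[OF ccF(1)]] by simp
  have v: "continuous_on {0..1} (cont_rep y) \<and> (AE x in leb01. rep_L2 y x = cont_rep y x)"
    unfolding cont_rep_def by (rule someI[of _ "\<lambda>x. c + F x"]) (use ae ccF in simp)
  then show "AE x in leb01. rep_L2 y x = cont_rep y x" by simp
  have "AE x in leb01. cont_rep y x = c + F x" using v ae by auto
  then have "cont_rep y x = c + F x" if "x \<in> {0..1}" for x
    using continuous_AE_eq_imp_eq[OF _ ccF(1) _ that] v by auto
  then show d: "has_L2_deriv (cont_rep y) (rep_L2 (weak_deriv y))"
    unfolding g_def[symmetric] by (rule has_L2_deriv_cong[OF cF])
  show "abs_L2 (cont_rep y) = y"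
    using v abs_L2_eq_iff[OF square_integrable_continuous rep_L2_square_integrable, of "cont_rep y" y]
    by (auto simp: abs_rep_L2)
qed

lemma has_L2_deriv_imp_in_H1:
  assumes F: "has_L2_deriv F f"
  shows "in_H1 (abs_L2 F)" "weak_deriv (abs_L2 F) = abs_L2 f" "x \<in> {0..1} \<Longrightarrow> cont_rep (abs_L2 F) x = F x"
proof -
  note w = has_L2_deriv_imp_has_weak_deriv[OF F]
  note cF = has_L2_deriv_continuous[OF F]
  show H: "in_H1 (abs_L2 F)" using w by (auto simp: in_H1_def)
  show "weak_deriv (abs_L2 F) = abs_L2 f" by (rule weak_deriv_eq[OF w])
  have "AE x in leb01. cont_rep (abs_L2 F) x = F x"
    using in_H1_cont_rep(3)[OF H] rep_abs_L2[OF square_integrable_continuous[OF cF]] by auto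
  then show "x \<in> {0..1} \<Longrightarrow> cont_rep (abs_L2 F) x = F x"
    using continuous_AE_eq_imp_eq[OF has_L2_deriv_continuous[OF in_H1_cont_rep(1)[OF H]] cF] by blast
qed

lemma inner_abs_L2:
  assumes "square_integrable f" "square_integrable g"
  shows "inner (abs_L2 f) (abs_L2 g) = integral {0..1} (\<lambda>x. f x * g x)"
  using assms lebesgue_integral_leb01[OF square_integrable_mult[OF assms]]
  by (simp add: inner_L2.abs_eq)

section \<open>Density of the domain of the generator\<close>

lemma norm_abs_L2_sq:
  assumes "square_integrable f"
  shows "(norm (abs_L2 f))\<^sup>2 = (LINT x|leb01. (f x)\<^sup>2)"
  unfolding power2_norm_eq_inner using assms by (simp add: inner_L2.abs_eq power2_eq_square)

lemma abs_L2_diff: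
  assumes "square_integrable f" "square_integrable g"
  shows "abs_L2 (\<lambda>x. f x - g x) = abs_L2 f - abs_L2 g"
  using assms by (simp add: minus_L2.abs_eq)

lemma abs_L2_cmult:
  assumes "square_integrable f"
  shows "abs_L2 (\<lambda>x. c * f x) = c *\<^sub>R abs_L2 f"
  using assms by (simp add: scaleR_L2.abs_eq)

lemma L2_dominated_convergence:
  assumes F: "\<And>n::nat. square_integrable (F n)" and G: "square_integrable G" and h: "square_integrable h"
    and lim: "AE x in leb01. (\<lambda>n. F n x) \<longlonglongrightarrow> G x"
    and bound: "\<And>n. AE x in leb01. \<bar>F n x\<bar> \<le> h x" "AE x in leb01. \<bar>G x\<bar> \<le> h x"
  shows "(\<lambda>n. abs_L2 (F n)) \<longlonglongrightarrow> abs_L2 G"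
proof -
  have [measurable]: "F n \<in> borel_measurable leb01" "G \<in> borel_measurable leb01" for n
    using F G by (auto simp: square_integrable_def)
  have "(\<lambda>n. LINT x|leb01. (F n x - G x)\<^sup>2) \<longlonglongrightarrow> (LINT x|leb01. 0)"
  proof (rule integral_dominated_convergence[where w = "\<lambda>x. 4 * (h x)\<^sup>2"])
    show "integrable leb01 (\<lambda>x. 4 * (h x)\<^sup>2)" using h by (auto simp: square_integrable_def)
    show "AE x in leb01. (\<lambda>n. (F n x - G x)\<^sup>2) \<longlonglongrightarrow> 0"
      using lim
    proof eventually_elim
      case (elim x)
      have "(\<lambda>n. (F n x - G x)\<^sup>2) \<longlonglongrightarrow> (G x - G x)\<^sup>2" by (intro tendsto_intros elim)
      then show ?case by simp
    qed
    fix n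
    show "AE x in leb01. norm ((F n x - G x)\<^sup>2) \<le> 4 * (h x)\<^sup>2"
      using bound(1)[of n] bound(2)
    proof eventually_elim
      case (elim x)
      then have "\<bar>F n x - G x\<bar> \<le> 2 * h x" by linarith
      then have "\<bar>F n x - G x\<bar>\<^sup>2 \<le> (2 * h x)\<^sup>2" by (intro power_mono) auto
      then show ?case by (simp add: power_mult_distrib)
    qed
  qed measurable
  then have "(\<lambda>n. (norm (abs_L2 (F n) - abs_L2 G))\<^sup>2) \<longlonglongrightarrow> 0"
    using norm_abs_L2_sq[OF square_integrable_diff[OF F G]] by (simp add: abs_L2_diff F G)
  then have "(\<lambda>n. sqrt ((norm (abs_L2 (F n) - abs_L2 G))\<^sup>2)) \<longlonglongrightarrow> sqrt 0"
    by (intro tendsto_real_sqrt)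
  then show ?thesis
    by (subst Lim_null, intro tendsto_norm_zero_cancel[of "\<lambda>n. abs_L2 (F n) - abs_L2 G"]) simp
qed

text \<open>
  A measurable function is almost everywhere the limit of continuous functions; cutting these off
  at the bound of \<open>f\<close> allows dominated convergence.
\<close>

lemma bounded_in_closure_continuous:
  assumes f: "square_integrable f" and B: "\<And>x. \<bar>f x\<bar> \<le> B"
  shows "abs_L2 f \<in> closure (abs_L2 ` {g. continuous_on {0..1} g})"
proof -
  have "f measurable_on {0<..<1}"
    using f by (subst measurable_on_iff_borel_measurable) (auto simp: square_integrable_def)
  then obtain N g where N: "negligible N" and g: "\<And>n. continuous_on UNIV (g n)"
    and lim: "\<And>x. x \<notin> N \<Longrightarrow> (\<lambda>n. g n x) \<longlonglongrightarrow> (if x \<in> {0<..<1} then f x else 0)"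
    unfolding measurable_on_def by blast
  define h where "h n x = max (- B) (min B (g n x))" for n x
  have B0: "0 \<le> B" using B[of 0] by simp
  have ch: "continuous_on {0..1} (h n)" for n
    unfolding h_def by (intro continuous_intros continuous_on_subset[OF g]) auto
  have "(\<lambda>n. abs_L2 (h n)) \<longlonglongrightarrow> abs_L2 f"
  proof (rule L2_dominated_convergence[where h = "\<lambda>x. B"])
    have "AE x in lebesgue. x \<notin> N" using N by (intro AE_not_in) (simp add: negligible_iff_null_sets)
    then have "AE x in leb01. x \<notin> N" by (subst AE_restrict_space_iff) auto
    then show "AE x in leb01. (\<lambda>n. h n x) \<longlonglongrightarrow> f x"
      using AE_space
    proof eventually_elim
      case (elim x)
      then have "(\<lambda>n. h n x) \<longlonglongrightarrow> max (- B) (min B (f x))"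
        unfolding h_def using lim[of x] by (intro tendsto_intros) (auto split: if_splits)
      moreover have "max (- B) (min B (f x)) = f x" using B[of x] by (auto simp: max_def min_def)
      ultimately show ?case by simp
    qed
    show "AE x in leb01. \<bar>h n x\<bar> \<le> B" for n
      using B0 by (intro AE_I2) (auto simp: h_def max_def min_def)
  qed (use B f in \<open>auto intro: square_integrable_continuous ch square_integrable_const\<close>)
  then show ?thesis
    unfolding closure_sequential using ch by (intro exI[of _ "\<lambda>n. abs_L2 (h n)"]) auto
qed

lemma continuous_dense_L2: "closure (abs_L2 ` {g. continuous_on {0..1} g}) = UNIV"
proof -
  have "abs_L2 f \<in> closure (abs_L2 ` {g. continuous_on {0..1} g})" if f: "square_integrable f" for f
  proof -
    define F where "F n x = max (- real n) (min (real n) (f x))" for n x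
    have [measurable]: "f \<in> borel_measurable leb01" using f by (auto simp: square_integrable_def)
    have le: "\<bar>F n x\<bar> \<le> \<bar>f x\<bar>" "\<bar>F n x\<bar> \<le> real n" for n x by (auto simp: F_def max_def min_def)
    have F: "square_integrable (F n)" for n
    proof -
      have [measurable]: "F n \<in> borel_measurable leb01" unfolding F_def by measurable
      have "integrable leb01 (\<lambda>x. (F n x)\<^sup>2)"
      proof (rule Bochner_Integration.integrable_bound)
        show "integrable leb01 (\<lambda>x. (f x)\<^sup>2)" using f by (auto simp: square_integrable_def)
        show "AE x in leb01. norm ((F n x)\<^sup>2) \<le> norm ((f x)\<^sup>2)"
          using le(1)[of n] by (intro AE_I2) (simp add: abs_le_square_iff)
      qed measurable
      then show ?thesis by (auto simp: square_integrable_def)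
    qed
    have abs: "square_integrable (\<lambda>x. \<bar>f x\<bar>)" using f by (auto simp: square_integrable_def)
    have "(\<lambda>n. abs_L2 (F n)) \<longlonglongrightarrow> abs_L2 f"
    proof (rule L2_dominated_convergence[where h = "\<lambda>x. \<bar>f x\<bar>"])
      show "AE x in leb01. (\<lambda>n. F n x) \<longlonglongrightarrow> f x"
      proof (rule AE_I2)
        fix x
        obtain N where N: "\<bar>f x\<bar> \<le> real N" using real_arch_simple by blast
        have "\<forall>\<^sub>F n in sequentially. F n x = f x"
          using eventually_ge_at_top[of N]
          by eventually_elim (use N in \<open>auto simp: F_def max_def min_def\<close>)
        then show "(\<lambda>n. F n x) \<longlonglongrightarrow> f x" by (rule tendsto_eventually)
      qed
    qed (use le F f abs in auto)
    moreover have "abs_L2 (F n) \<in> closure (abs_L2 ` {g. continuous_on {0..1} g})" for n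
      by (rule bounded_in_closure_continuous[OF F le(2)])
    ultimately have "abs_L2 f \<in> closure (closure (abs_L2 ` {g. continuous_on {0..1} g}))"
      unfolding closure_sequential[of _ "closure _"] by (intro exI[of _ "\<lambda>n. abs_L2 (F n)"]) auto
    then show ?thesis by simp
  qed
  then have "y \<in> closure (abs_L2 ` {g. continuous_on {0..1} g})" for y
    using rep_L2_square_integrable[of y] abs_rep_L2[of y] by metis
  then show ?thesis by blast
qed

lemma norm_abs_L2_le:
  assumes g: "continuous_on {0..1} g" and B: "\<And>x. x \<in> {0..1} \<Longrightarrow> \<bar>g x\<bar> \<le> B"
  shows "norm (abs_L2 g) \<le> B"
proof (rule power2_le_imp_le)
  show "0 \<le> B" using B[of 0] by auto
  have "(norm (abs_L2 g))\<^sup>2 = integral {0..1} (\<lambda>x. g x * g x)"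
    by (simp add: power2_norm_eq_inner inner_abs_L2 square_integrable_continuous g)
  also have "\<dots> \<le> integral {0..1} (\<lambda>x::real. B\<^sup>2)"
  proof (rule integral_le)
    show "(\<lambda>x. g x * g x) integrable_on {0..1}"
      by (intro integrable_continuous_real continuous_intros g)
    fix x :: real assume "x \<in> {0..1}"
    then have "(g x)\<^sup>2 \<le> B\<^sup>2" using B[of x] by (metis abs_ge_zero power2_abs power_mono)
    then show "g x * g x \<le> B\<^sup>2" by (simp add: power2_eq_square)
  qed auto
  finally show "(norm (abs_L2 g))\<^sup>2 \<le> B\<^sup>2" by simp
qed

lemma powers_tendsto_zero_L2:
  assumes p: "continuous_on {0..1} p" "\<And>x. 0 < x \<Longrightarrow> x < 1 \<Longrightarrow> \<bar>p x\<bar> < 1"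
  shows "(\<lambda>n. abs_L2 (\<lambda>x. p x ^ Suc n)) \<longlonglongrightarrow> 0"
proof -
  have "(\<lambda>n. abs_L2 (\<lambda>x. p x ^ Suc n)) \<longlonglongrightarrow> abs_L2 (\<lambda>x. 0)"
  proof (rule L2_dominated_convergence[where h = "\<lambda>x. 1"])
    show "square_integrable (\<lambda>x. p x ^ Suc n)" for n
      by (intro square_integrable_continuous continuous_intros p)
    show "AE x in leb01. (\<lambda>n. p x ^ Suc n) \<longlonglongrightarrow> 0"
      using p(2) by (intro AE_I2 LIMSEQ_Suc LIMSEQ_power_zero) auto
    show "AE x in leb01. \<bar>p x ^ Suc n\<bar> \<le> 1" for n
      using p(2) by (intro AE_I2) (simp add: power_abs power_le_one less_imp_le del: power_Suc)
  qed (auto intro: square_integrable_const)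
  then show ?thesis by (simp add: zero_L2_def)
qed

text \<open>
  Boundary values are free in \<open>L\<^sup>2\<close>: the terms \<open>(1 - x) ^ n\<close> and \<open>x ^ n\<close> change them at \<open>0\<close> and
  \<open>1\<close> by prescribed amounts while their norms vanish as \<open>n\<close> grows.
\<close>

lemma H1_dense_with_boundary_values:
  assumes "0 < e"
  shows "\<exists>G g. has_L2_deriv G g \<and> G 0 = c \<and> G 1 = d \<and> norm (y - abs_L2 G) < e"
proof -
  have "y \<in> closure (abs_L2 ` {g. continuous_on {0..1} g})" using continuous_dense_L2 by blast
  then obtain g where g: "continuous_on {0..1} g" "dist (abs_L2 g) y < e / 4"
    unfolding closure_approachable using assms by (auto dest!: spec[of _ "e / 4"])
  obtain q where q: "real_polynomial_function q" "\<And>x. x \<in> {0..1} \<Longrightarrow> \<bar>g x - q x\<bar> < e / 4"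
    using Stone_Weierstrass_real_polynomial_function[of "{0..1}" g "e / 4"] g assms by auto
  obtain q' where q': "real_polynomial_function q'" "\<And>x. (q has_real_derivative q' x) (at x)"
    using has_real_derivative_polynomial_function[OF q(1)] by metis
  have cq: "continuous_on S q" "continuous_on S q'" for S
    using q(1) q'(1) by (auto intro: continuous_on_polymonial_function simp: real_polynomial_function_eq)
  define G where "G n x = q x + ((c - q 0) * (1 - x) ^ Suc n + (d - q 1) * x ^ Suc n)" for n x
  define G' where "G' n x = q' x + ((c - q 0) * (- (real (Suc n) * (1 - x) ^ n)) + (d - q 1) * (real (Suc n) * x ^ n))" for n x
  have G: "has_L2_deriv (G n) (G' n)" for n
  proof (rule has_L2_deriv_C1)
    fix x
    have "((\<lambda>x. (1 - x) ^ Suc n) has_real_derivative - (real (Suc n) * (1 - x) ^ n)) (at x)"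
      "((\<lambda>x. x ^ Suc n) has_real_derivative real (Suc n) * x ^ n) (at x)"
      by (auto intro!: derivative_eq_intros simp del: power_Suc)
    then have "(G n has_real_derivative G' n x) (at x)"
      unfolding G_def G'_def by (intro DERIV_add DERIV_cmult q')
    then show "(G n has_real_derivative G' n x) (at x within {0..1})" by (rule has_field_derivative_at_within)
  qed (unfold G'_def, intro continuous_intros cq)
  have s1: "square_integrable (\<lambda>x. (1 - x) ^ Suc n)" "square_integrable (\<lambda>x::real. x ^ Suc n)" for n
    by (intro square_integrable_continuous continuous_intros)+
  have eq: "abs_L2 (G n) = abs_L2 q + ((c - q 0) *\<^sub>R abs_L2 (\<lambda>x. (1 - x) ^ Suc n) + (d - q 1) *\<^sub>R abs_L2 (\<lambda>x. x ^ Suc n))" for n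
    unfolding G_def abs_L2_add[OF square_integrable_continuous[OF cq(1)]
        square_integrable_add[OF square_integrable_cmult[OF s1(1)] square_integrable_cmult[OF s1(2)]]]
      abs_L2_add[OF square_integrable_cmult[OF s1(1)] square_integrable_cmult[OF s1(2)]]
      abs_L2_cmult[OF s1(1)] abs_L2_cmult[OF s1(2)] ..
  have "(\<lambda>n. norm (y - abs_L2 (G n))) \<longlonglongrightarrow> norm (y - (abs_L2 q + ((c - q 0) *\<^sub>R 0 + (d - q 1) *\<^sub>R 0)))"
    unfolding eq by (intro tendsto_intros powers_tendsto_zero_L2 continuous_intros) auto
  moreover have "norm (y - abs_L2 q) < e"
  proof -
    have "norm (abs_L2 g - abs_L2 q) \<le> e / 4"
      using norm_abs_L2_le[of "\<lambda>x. g x - q x" "e / 4"] q(2) g(1) cq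
      by (simp add: abs_L2_diff square_integrable_continuous continuous_on_diff less_imp_le)
    moreover have "norm (y - abs_L2 g) < e / 4" using g(2) by (simp add: dist_norm norm_minus_commute)
    ultimately show ?thesis
      using norm_triangle_ineq[of "y - abs_L2 g" "abs_L2 g - abs_L2 q"] assms by simp
  qed
  ultimately have "\<forall>\<^sub>F n in sequentially. norm (y - abs_L2 (G n)) < e"
    by (intro order_tendstoD(2)) auto
  then obtain n where "norm (y - abs_L2 (G n)) < e" using eventually_happens sequentially_bot by blast
  moreover have "G n 0 = c" "G n 1 = d" by (auto simp: G_def)
  ultimately show ?thesis using G by blast
qed

lemma abs_integral_le_norm_L2:
  assumes f: "square_integrable f" and x: "x \<in> {0..1}"
  shows "\<bar>integral {0..x} f\<bar> \<le> norm (abs_L2 f)"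
proof -
  have abs: "square_integrable (\<lambda>x. \<bar>f x\<bar>)" using f by (auto simp: square_integrable_def)
  have "\<bar>integral {0..x} f\<bar> \<le> integral {0..x} (\<lambda>x. \<bar>f x\<bar>)"
    using square_integrable_integrable_on[OF f, of 0 x] x
      Henstock_Kurzweil_Integration.integral_norm_bound_integral[of f "{0..x}" "\<lambda>x. \<bar>f x\<bar>"] by simp
  also have "\<dots> \<le> integral {0..1} (\<lambda>x. \<bar>f x\<bar>)"
    using square_integrable_integrable_on[OF f] x by (intro integral_subset_le) auto
  also have "\<dots> = inner (abs_L2 (\<lambda>x. \<bar>f x\<bar>)) (abs_L2 (\<lambda>x. 1))"
    by (simp add: inner_abs_L2 abs square_integrable_const)
  also have "\<dots> \<le> norm (abs_L2 (\<lambda>x. \<bar>f x\<bar>)) * norm (abs_L2 (\<lambda>x. 1))" by (rule norm_cauchy_schwarz)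
  also have "\<dots> \<le> norm (abs_L2 (\<lambda>x. \<bar>f x\<bar>)) * 1"
    by (intro mult_left_mono norm_abs_L2_le) auto
  also have "\<dots> = norm (abs_L2 f)"
    using norm_abs_L2_sq[OF abs] norm_abs_L2_sq[OF f]
      power2_eq_imp_eq[of "norm (abs_L2 (\<lambda>x. \<bar>f x\<bar>))" "norm (abs_L2 f)"] by simp
  finally show ?thesis .
qed

lemma has_L2_deriv_norm_le:
  assumes F: "has_L2_deriv F f" and "F 0 = 0"
  shows "norm (abs_L2 F) \<le> norm (abs_L2 f)"
  by (rule norm_abs_L2_le[OF has_L2_deriv_continuous[OF F]])
    (use abs_integral_le_norm_L2[OF has_L2_derivD(1)[OF F]] has_L2_derivD(2)[OF F] assms(2) in simp)

lemma norm_H1_sq: "(norm y)\<^sup>2 = (norm (L2_of_H1 y))\<^sup>2 + (norm (weak_deriv (L2_of_H1 y)))\<^sup>2"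
  by (simp add: power2_norm_eq_inner inner_H1.rep_eq)

lemma in_H1_L2_of_H1: "in_H1 (L2_of_H1 y)"
  using L2_of_H1[of y] by simp

text \<open>
  The velocities and the delay line are approximated with the boundary values that
  the domain prescribes. For the displacement it is the derivative that is approximated, and the
  value at \<open>0\<close> is kept; the error of the displacement is then bounded by that of its derivative.
\<close>

lemma crane_dom_dense: "closure crane_dom = UNIV"
proof -
  have "\<Phi> \<in> closure crane_dom" for \<Phi> :: state
    unfolding closure_approachable
  proof (intro allI impI)
    fix e :: real assume e: "0 < e"
    obtain y z u \<xi> \<eta> where \<Phi>: "\<Phi> = (y, z, u, \<xi>, \<eta>)" by (cases \<Phi>)
    obtain G g where G: "has_L2_deriv G g" "norm (weak_deriv (L2_of_H1 y) - abs_L2 G) < e / 8"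
      using H1_dense_with_boundary_values[of "e / 8"] e by (metis divide_pos_pos zero_less_numeral)
    obtain Z z' where Z: "has_L2_deriv Z z'" "Z 0 = \<xi>" "Z 1 = \<eta>" "norm (z - abs_L2 Z) < e / 4"
      using H1_dense_with_boundary_values[of "e / 4"] e by (metis divide_pos_pos zero_less_numeral)
    obtain U u' where U: "has_L2_deriv U u'" "U 0 = \<xi>" "norm (u - abs_L2 U) < e / 4"
      using H1_dense_with_boundary_values[of "e / 4"] e by (metis divide_pos_pos zero_less_numeral)
    have sG: "square_integrable G" by (rule square_integrable_continuous[OF has_L2_deriv_continuous[OF G(1)]])
    define Y where "Y x = cont_rep (L2_of_H1 y) 0 + integral {0..x} G" for x
    have Y: "has_L2_deriv Y G" using sG by (simp add: has_L2_deriv_def Y_def)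
    define Y' where "Y' = Abs_H1 (abs_L2 Y)"
    have LY': "L2_of_H1 Y' = abs_L2 Y"
      unfolding Y'_def by (rule Abs_H1_inverse) (simp add: has_L2_deriv_imp_in_H1[OF Y])
    note Hy = in_H1_cont_rep[OF in_H1_L2_of_H1[of y]]
    have d: "has_L2_deriv (\<lambda>x. cont_rep (L2_of_H1 y) x - Y x) (\<lambda>x. rep_L2 (weak_deriv (L2_of_H1 y)) x - G x)"
      by (intro has_L2_deriv_diff Hy(1) Y)
    have "norm (abs_L2 (\<lambda>x. cont_rep (L2_of_H1 y) x - Y x)) \<le> norm (abs_L2 (\<lambda>x. rep_L2 (weak_deriv (L2_of_H1 y)) x - G x))"
      by (rule has_L2_deriv_norm_le[OF d]) (simp add: Y_def)
    then have 1: "norm (L2_of_H1 y - abs_L2 Y) \<le> norm (weak_deriv (L2_of_H1 y) - abs_L2 G)"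
      unfolding abs_L2_diff[OF square_integrable_continuous[OF has_L2_deriv_continuous[OF Hy(1)]]
          square_integrable_continuous[OF has_L2_deriv_continuous[OF Y]]]
        abs_L2_diff[OF rep_L2_square_integrable sG] abs_rep_L2 Hy(2) .
    have wd: "weak_deriv (L2_of_H1 (y - Y')) = weak_deriv (L2_of_H1 y) - abs_L2 G"
      using weak_deriv_lincomb[OF in_H1_L2_of_H1[of y] in_H1_L2_of_H1[of Y'], of "-1"] has_L2_deriv_imp_in_H1(2)[OF Y]
      by (simp add: minus_H1.rep_eq LY')
    have "(norm (y - Y'))\<^sup>2 \<le> (2 * norm (weak_deriv (L2_of_H1 y) - abs_L2 G))\<^sup>2"
    proof -
      have "(norm (L2_of_H1 (y - Y')))\<^sup>2 \<le> (norm (weak_deriv (L2_of_H1 y) - abs_L2 G))\<^sup>2"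
        using 1 by (intro power_mono) (simp_all add: minus_H1.rep_eq LY')
      then show ?thesis
        unfolding norm_H1_sq wd power_mult_distrib
        using zero_le_power2[of "norm (weak_deriv (L2_of_H1 y) - abs_L2 G)"]
        unfolding four_x_squared[symmetric] power2_eq_square by linarith
    qed
    then have "norm (y - Y') \<le> 2 * norm (weak_deriv (L2_of_H1 y) - abs_L2 G)" by (rule power2_le_imp_le) simp
    then have y: "norm (y - Y') < e / 4" using G(2) by simp
    note HZ = has_L2_deriv_imp_in_H1[OF Z(1)] and HU = has_L2_deriv_imp_in_H1[OF U(1)]
    let ?\<Psi> = "(Y', abs_L2 Z, abs_L2 U, \<xi>, \<eta>)"
    have "?\<Psi> \<in> crane_dom"
      unfolding crane_dom_def
      using HZ HU Z U has_L2_deriv_imp_in_H1(1)[OF G(1)] has_L2_deriv_imp_in_H1(2)[OF Y] by (simp add: LY')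
    moreover have "dist ?\<Psi> \<Phi> < e"
    proof -
      have "dist ?\<Psi> \<Phi> = norm (y - Y', z - abs_L2 Z, u - abs_L2 U, 0::real, 0::real)"
        by (simp add: \<Phi> dist_norm norm_minus_commute[of _ \<Phi>] norm_Pair norm_minus_commute)
      also have "\<dots> \<le> norm (y - Y') + (norm (z - abs_L2 Z) + (norm (u - abs_L2 U) + norm (0::real, 0::real)))"
        by (intro order_trans[OF norm_Pair_le] add_left_mono order_refl)
      finally show ?thesis using y Z(4) U(3) e by (simp add: norm_Pair)
    qed
    ultimately show "\<exists>\<Psi>\<in>crane_dom. dist \<Psi> \<Phi> < e" by blast
  qed
  then show ?thesis by blast
qed

section \<open>Bounded forms on the state space\<close>

definition mulL2 :: "(real \<Rightarrow> real) \<Rightarrow> L2 \<Rightarrow> L2" where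
  "mulL2 w f = abs_L2 (\<lambda>x. w x * rep_L2 f x)"

lemma mulL2_abs:
  assumes w: "continuous_on {0..1} w" and f: "square_integrable f"
  shows "mulL2 w (abs_L2 f) = abs_L2 (\<lambda>x. w x * f x)"
  unfolding mulL2_def
  using rep_abs_L2[OF f] f w
  by (subst abs_L2_eq_iff) (auto intro: square_integrable_continuous_mult rep_L2_square_integrable)

lemma bounded_linear_mulL2:
  assumes w: "continuous_on {0..1} w"
  shows "bounded_linear (mulL2 w)"
proof -
  have "compact (w ` {0..1})" using w by (intro compact_continuous_image) auto
  then obtain B where "\<forall>y\<in>w ` {0..1}. norm y \<le> B" using compact_imp_bounded bounded_iff by metis
  then have B: "\<And>x. x \<in> {0..1} \<Longrightarrow> \<bar>w x\<bar> \<le> B" by simp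
  have B0: "0 \<le> B" using B[of 0] by auto
  have sq: "square_integrable (\<lambda>x. w x * f x)" if "square_integrable f" for f
    by (rule square_integrable_continuous_mult[OF w that])
  have "mulL2 w (abs_L2 f + abs_L2 g) = mulL2 w (abs_L2 f) + mulL2 w (abs_L2 g)"
    if "square_integrable f" "square_integrable g" for f g
    using that by (simp add: mulL2_abs w abs_L2_add[symmetric] square_integrable_add sq distrib_left)
  then have add: "mulL2 w (f + g) = mulL2 w f + mulL2 w g" for f g
    using rep_L2_square_integrable abs_rep_L2 by metis
  have "mulL2 w (c *\<^sub>R abs_L2 f) = c *\<^sub>R mulL2 w (abs_L2 f)" if "square_integrable f" for f c
    using that by (simp add: mulL2_abs w abs_L2_cmult[symmetric] square_integrable_cmult sq mult.left_commute)
  then have scale: "mulL2 w (c *\<^sub>R f) = c *\<^sub>R mulL2 w f" for f c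
    using rep_L2_square_integrable abs_rep_L2 by metis
  have norm: "norm (mulL2 w f) \<le> norm f * B" for f
  proof (rule power2_le_imp_le)
    have "(norm (mulL2 w f))\<^sup>2 = (LINT x|leb01. (w x * rep_L2 f x)\<^sup>2)"
      unfolding mulL2_def by (rule norm_abs_L2_sq[OF sq[OF rep_L2_square_integrable]])
    also have "\<dots> \<le> (LINT x|leb01. B\<^sup>2 * (rep_L2 f x)\<^sup>2)"
    proof (rule integral_mono)
      show "integrable leb01 (\<lambda>x. (w x * rep_L2 f x)\<^sup>2)"
        using sq[OF rep_L2_square_integrable] by (simp add: square_integrable_def)
      show "integrable leb01 (\<lambda>x. B\<^sup>2 * (rep_L2 f x)\<^sup>2)"
        using rep_L2_square_integrable[of f] by (simp add: square_integrable_def)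
      fix x assume "x \<in> space leb01"
      then have "\<bar>w x\<bar> \<le> B" using B[of x] by auto
      then have "(w x)\<^sup>2 \<le> B\<^sup>2" by (metis abs_ge_zero power2_abs power_mono)
      then show "(w x * rep_L2 f x)\<^sup>2 \<le> B\<^sup>2 * (rep_L2 f x)\<^sup>2"
        by (simp add: power_mult_distrib mult_right_mono)
    qed
    also have "\<dots> = B\<^sup>2 * (norm f)\<^sup>2"
      using norm_abs_L2_sq[OF rep_L2_square_integrable[of f]] by (simp add: abs_rep_L2)
    finally show "(norm (mulL2 w f))\<^sup>2 \<le> (norm f * B)\<^sup>2" by (simp add: power_mult_distrib mult.commute)
    show "0 \<le> norm f * B" using B0 by simp
  qed
  show ?thesis by (rule bounded_linear_intro[OF add scale norm])
qed

lemma inner_mulL2: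
  assumes w: "continuous_on {0..1} w"
  shows "inner (mulL2 w f) g = (LINT x|leb01. w x * rep_L2 f x * rep_L2 g x)"
  unfolding mulL2_def
  using inner_L2.abs_eq[of "\<lambda>x. w x * rep_L2 f x" "rep_L2 g"]
    square_integrable_continuous_mult[OF w rep_L2_square_integrable[of f]] rep_L2_square_integrable[of g]
  by (simp add: abs_rep_L2)

lemma LINT_rep_L2: "(LINT x|leb01. rep_L2 z x) = inner (abs_L2 (\<lambda>x. 1)) z"
  using inner_L2.abs_eq[of "\<lambda>x. 1" "rep_L2 z"] square_integrable_const[of 1] rep_L2_square_integrable[of z]
  by (simp add: abs_rep_L2)

lemma inner_abs_L2_mono:
  assumes "square_integrable f1" "square_integrable g1" "square_integrable f2" "square_integrable g2"
    and "\<And>x. x \<in> {0..1} \<Longrightarrow> f1 x * g1 x \<le> f2 x * g2 x"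
  shows "inner (abs_L2 f1) (abs_L2 g1) \<le> inner (abs_L2 f2) (abs_L2 g2)"
  unfolding inner_abs_L2[OF assms(1,2)] inner_abs_L2[OF assms(3,4)]
  using assms
  by (intro integral_le set_lebesgue_integral_eq_integral(1) integrable_leb01_absolutely square_integrable_mult)

lemma inner_integration_by_parts:
  assumes F: "has_L2_deriv F f" and G: "has_L2_deriv G g"
  shows "inner (abs_L2 f) (abs_L2 G) + inner (abs_L2 F) (abs_L2 g) = F 1 * G 1 - F 0 * G 0"
proof -
  note s = square_integrable_continuous[OF has_L2_deriv_continuous[OF F]] has_L2_derivD(1)[OF F]
    square_integrable_continuous[OF has_L2_deriv_continuous[OF G]] has_L2_derivD(1)[OF G]
  have "integral {0..1} (\<lambda>x. f x * G x + F x * g x) =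
      integral {0..1} (\<lambda>x. f x * G x) + integral {0..1} (\<lambda>x. F x * g x)"
    by (intro Henstock_Kurzweil_Integration.integral_add set_lebesgue_integral_eq_integral(1)
        integrable_leb01_absolutely square_integrable_mult s)
  then show ?thesis
    using has_L2_deriv_mult_integral[OF F G] by (simp only: inner_abs_L2[OF s(2,3)] inner_abs_L2[OF s(1,4)])
qed

lemma inner_one_deriv:
  assumes F: "has_L2_deriv F f"
  shows "inner (abs_L2 (\<lambda>x. 1)) (abs_L2 f) = F 1 - F 0"
  using inner_integration_by_parts[OF has_L2_deriv_const[of 1] F] unfolding zero_L2_def[symmetric]
  by simp

lemma bounded_linear_L2_of_H1: "bounded_linear L2_of_H1"
proof (rule bounded_linear_intro[where K = 1])
  show "norm (L2_of_H1 y) \<le> norm y * 1" for y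
    by (rule power2_le_imp_le) (simp_all add: norm_H1_sq[of y])
qed (simp_all add: plus_H1.rep_eq scaleR_H1.rep_eq)

lemma bounded_linear_weak_deriv_H1: "bounded_linear (\<lambda>y. weak_deriv (L2_of_H1 y))"
proof (rule bounded_linear_intro[where K = 1])
  show "norm (weak_deriv (L2_of_H1 y)) \<le> norm y * 1" for y
    by (rule power2_le_imp_le) (simp_all add: norm_H1_sq[of y])
  show "weak_deriv (L2_of_H1 (y + z)) = weak_deriv (L2_of_H1 y) + weak_deriv (L2_of_H1 z)" for y z
    using weak_deriv_lincomb[OF in_H1_L2_of_H1[of y] in_H1_L2_of_H1[of z], of 1] by (simp add: plus_H1.rep_eq)
  show "weak_deriv (L2_of_H1 (r *\<^sub>R y)) = r *\<^sub>R weak_deriv (L2_of_H1 y)" for r y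
    using weak_deriv_lincomb[OF in_H1_0 in_H1_L2_of_H1[of y], of r] weak_deriv_eq[OF has_weak_deriv_0]
    by (simp add: scaleR_H1.rep_eq)
qed

text \<open>
  Integrating the derivative of \<open>(1 - x) y(x)\<close> writes the point value as a bounded functional.
\<close>

lemma trace_zero_eq:
  "cont_rep (L2_of_H1 y) 0 = inner (abs_L2 (\<lambda>x. 1)) (L2_of_H1 y)
    - inner (abs_L2 (\<lambda>x. 1 - x)) (weak_deriv (L2_of_H1 y))"
proof -
  note H = in_H1_cont_rep[OF in_H1_L2_of_H1[of y]]
  have c: "has_L2_deriv (\<lambda>x. 1 - x) (\<lambda>x. - 1)"
    by (rule has_L2_deriv_C1) (auto intro!: derivative_eq_intros)
  have "abs_L2 (\<lambda>x. - 1) = - abs_L2 (\<lambda>x. 1)"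
    using abs_L2_cmult[OF square_integrable_const, of "-1" 1] by simp
  then show ?thesis
    using inner_integration_by_parts[OF c H(1)] by (simp add: H(2) abs_rep_L2)
qed

lemma ell_bounded_linear: "bounded_linear (ell m M \<tau> \<alpha> \<beta>)"
proof -
  have eq: "ell m M \<tau> \<alpha> \<beta> = (\<lambda>\<Phi>. inner (abs_L2 (\<lambda>x. 1)) (fst (snd \<Phi>)) + m * fst (snd (snd (snd \<Phi>)))
      + M * snd (snd (snd (snd \<Phi>)))
      + (\<beta> - \<alpha>) * (inner (abs_L2 (\<lambda>x. 1)) (L2_of_H1 (fst \<Phi>))
          - inner (abs_L2 (\<lambda>x. 1 - x)) (weak_deriv (L2_of_H1 (fst \<Phi>))))
      + \<tau> * \<alpha> * inner (abs_L2 (\<lambda>x. 1)) (fst (snd (snd \<Phi>))))"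
    by (rule ext) (auto simp: LINT_rep_L2 trace_zero_eq split: prod.splits)
  show ?thesis
    unfolding eq
    by (intro bounded_linear_add bounded_linear_sub bounded_linear_const_mult
        bounded_linear_compose[OF bounded_linear_inner_right]
        bounded_linear_compose[OF bounded_linear_L2_of_H1]
        bounded_linear_compose[OF bounded_linear_weak_deriv_H1]
        bounded_linear_fst_comp bounded_linear_snd_comp bounded_linear_ident)
qed

lemma inner_X_eq:
  "inner_X a m M \<tau> \<alpha> \<beta> K \<omega> (y, z, u, \<xi>, \<eta>) (y', z', u', \<xi>', \<eta>') =
    inner (mulL2 (cont_rep (L2_of_H1 a)) (weak_deriv (L2_of_H1 y))) (weak_deriv (L2_of_H1 y')) + inner z z'
    + K * \<tau> * inner u u' + m * \<xi> * \<xi>' + M * \<eta> * \<eta>'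
    + \<omega> * ell m M \<tau> \<alpha> \<beta> (y, z, u, \<xi>, \<eta>) * ell m M \<tau> \<alpha> \<beta> (y', z', u', \<xi>', \<eta>')"
proof -
  let ?a = "cont_rep (L2_of_H1 a)"
  let ?g = "rep_L2 (weak_deriv (L2_of_H1 y))" and ?g' = "rep_L2 (weak_deriv (L2_of_H1 y'))"
  have ca: "continuous_on {0..1} ?a"
    by (rule has_L2_deriv_continuous[OF in_H1_cont_rep(1)[OF in_H1_L2_of_H1]])
  have "integrable leb01 (\<lambda>x. ?a x * ?g x * ?g' x)" "integrable leb01 (\<lambda>x. rep_L2 z x * rep_L2 z' x)"
    by (intro square_integrable_mult square_integrable_continuous_mult ca rep_L2_square_integrable)+
  then have "(LINT x|leb01. ?a x * ?g x * ?g' x + rep_L2 z x * rep_L2 z' x) =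
      inner (mulL2 ?a (weak_deriv (L2_of_H1 y))) (weak_deriv (L2_of_H1 y')) + (LINT x|leb01. rep_L2 z x * rep_L2 z' x)"
    by (simp add: inner_mulL2[OF ca])
  moreover have "(LINT x|leb01. rep_L2 p x * rep_L2 q x) = inner p q" for p q
    using inner_mulL2[of "\<lambda>x. 1" p q] by (simp add: mulL2_def abs_rep_L2)
  ultimately show ?thesis by simp
qed

text \<open>
  Both arguments enter through bounded linear maps into a product of Hilbert spaces.
\<close>

lemma inner_X_bounded_bilinear: "bounded_bilinear (inner_X a m M \<tau> \<alpha> \<beta> K \<omega>)"
proof -
  let ?W = "\<lambda>\<Phi>::state. (mulL2 (cont_rep (L2_of_H1 a)) (weak_deriv (L2_of_H1 (fst \<Phi>))), fst (snd \<Phi>),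
      (K * \<tau>) *\<^sub>R fst (snd (snd \<Phi>)), m * fst (snd (snd (snd \<Phi>))), M * snd (snd (snd (snd \<Phi>))),
      \<omega> * ell m M \<tau> \<alpha> \<beta> \<Phi>)"
  let ?J = "\<lambda>\<Phi>::state. (weak_deriv (L2_of_H1 (fst \<Phi>)), fst (snd \<Phi>),
      fst (snd (snd \<Phi>)), fst (snd (snd (snd \<Phi>))), snd (snd (snd (snd \<Phi>))), ell m M \<tau> \<alpha> \<beta> \<Phi>)"
  have ca: "continuous_on {0..1} (cont_rep (L2_of_H1 a))"
    by (rule has_L2_deriv_continuous[OF in_H1_cont_rep(1)[OF in_H1_L2_of_H1]])
  have "inner_X a m M \<tau> \<alpha> \<beta> K \<omega> \<Phi> \<Psi> = inner (?W \<Phi>) (?J \<Psi>)" for \<Phi> \<Psi>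
    by (cases \<Phi>; cases \<Psi>) (simp add: inner_X_eq inner_prod_def del: inner_X.simps ell.simps)
  then have eq: "inner_X a m M \<tau> \<alpha> \<beta> K \<omega> = (\<lambda>\<Phi> \<Psi>. inner (?W \<Phi>) (?J \<Psi>))" by blast
  show ?thesis
    unfolding eq
    by (intro bounded_bilinear.comp[OF bounded_bilinear_inner] bounded_linear_Pair
        bounded_linear_compose[OF bounded_linear_mulL2[OF ca]]
        bounded_linear_compose[OF bounded_linear_weak_deriv_H1] bounded_linear_const_mult
        bounded_linear_compose[OF bounded_linear_scaleR_right] ell_bounded_linear
        bounded_linear_fst_comp bounded_linear_snd_comp bounded_linear_ident)
qed

lemma inner_X_commute: "inner_X a m M \<tau> \<alpha> \<beta> K \<omega> \<Phi> \<Psi> = inner_X a m M \<tau> \<alpha> \<beta> K \<omega> \<Psi> \<Phi>"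
  by (cases \<Phi>; cases \<Psi>) (simp add: mult_ac del: ell.simps)

lemma inner_mulL2_commute:
  assumes w: "continuous_on {0..1} w"
  shows "inner (mulL2 w f) g = inner (mulL2 w g) f"
  unfolding inner_mulL2[OF w] by (simp add: mult_ac)

text \<open>
  Integrate the derivative of \<open>(2 - x) u(x)\<^sup>2\<close>. As \<open>u\<^sub>x = - \<tau> u\<^sub>t\<close>, the last term is a time derivative.
\<close>

lemma delay_energy_identity:
  assumes u: "has_L2_deriv u u'"
  shows "inner (abs_L2 u) (abs_L2 u) =
    2 * (u 0)\<^sup>2 - (u 1)\<^sup>2 + 2 * inner (mulL2 (\<lambda>x. 2 - x) (abs_L2 u)) (abs_L2 u')"
proof -
  have q: "has_L2_deriv (\<lambda>x. 2 - x) (\<lambda>x. - 1)"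
    by (rule has_L2_deriv_C1) (auto intro!: derivative_eq_intros)
  note cq = has_L2_deriv_continuous[OF q]
  note su = square_integrable_continuous[OF has_L2_deriv_continuous[OF u]] has_L2_derivD(1)[OF u]
  have "abs_L2 (\<lambda>x. - 1 * u x + (2 - x) * u' x) = (- 1) *\<^sub>R abs_L2 u + mulL2 (\<lambda>x. 2 - x) (abs_L2 u')"
    unfolding abs_L2_add[OF square_integrable_cmult[OF su(1)] square_integrable_continuous_mult[OF cq su(2)]]
      abs_L2_cmult[OF su(1)] mulL2_abs[OF cq su(2)] ..
  then show ?thesis
    using inner_integration_by_parts[OF has_L2_deriv_mult[OF q u] u]
      inner_mulL2_commute[OF cq, of "abs_L2 u'" "abs_L2 u"]
    unfolding mulL2_abs[OF cq su(1)]
    by (simp add: inner_diff_left inner_add_left power2_eq_square)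
qed

section \<open>Energy dissipation and observability of the crane\<close>

locale crane =
  fixes a :: H1 and a\<^sub>0 m M \<tau> \<alpha> \<beta> K \<omega> :: real
  assumes pos: "m > 0" "M > 0" "\<tau> > 0" "K > 0"
    and a0: "a\<^sub>0 > 0" "\<And>x. x \<in> {0..1} \<Longrightarrow> cont_rep (L2_of_H1 a) x \<ge> a\<^sub>0"
begin

abbreviation c where "c \<equiv> cont_rep (L2_of_H1 a)"
abbreviation c' where "c' \<equiv> rep_L2 (weak_deriv (L2_of_H1 a))"
abbreviation S where "S \<equiv> inner_X a m M \<tau> \<alpha> \<beta> K \<omega>"
abbreviation L where "L \<equiv> ell m M \<tau> \<alpha> \<beta>"
abbreviation A where "A \<equiv> crane_op a m M \<tau> \<alpha> \<beta>"

lemma c_deriv: "has_L2_deriv c c'"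
  by (rule in_H1_cont_rep(1)[OF in_H1_L2_of_H1])

lemmas c_cont = has_L2_deriv_continuous[OF c_deriv]

text \<open>
  In the domain every component is represented by an explicit function, and so is its image under
  the generator; the estimates below are integrations by parts between these functions.
\<close>

lemma crane_domE:
  assumes "\<Phi> \<in> crane_dom"
  obtains y g g' z z' u u' where
    "has_L2_deriv g g'" "has_L2_deriv z z'" "has_L2_deriv u u'" "u 0 = z 0"
    "weak_deriv (L2_of_H1 y) = abs_L2 g"
    "\<Phi> = (y, abs_L2 z, abs_L2 u, z 0, z 1)"
    "A \<Phi> = (Abs_H1 (abs_L2 z), abs_L2 (\<lambda>x. c' x * g x + c x * g' x), (- 1 / \<tau>) *\<^sub>R abs_L2 u',
      (c 0 * g 0 - \<beta> * z 0 + \<alpha> * u 1) / m, - (c 1 * g 1 / M))"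
    "L2_of_H1 (Abs_H1 (abs_L2 z)) = abs_L2 z"
    "weak_deriv (abs_L2 z) = abs_L2 z'" "cont_rep (abs_L2 z) 0 = z 0" "cont_rep (abs_L2 u) 1 = u 1"
proof -
  obtain y zz uu \<xi> \<eta> where \<Phi>: "\<Phi> = (y, zz, uu, \<xi>, \<eta>)" by (cases \<Phi>)
  have H: "in_H1 (weak_deriv (L2_of_H1 y))" "in_H1 zz" "in_H1 uu"
    and b: "\<xi> = cont_rep uu 0" "cont_rep uu 0 = cont_rep zz 0" "\<eta> = cont_rep zz 1"
    using assms by (auto simp: \<Phi> crane_dom_def)
  define g where "g = cont_rep (weak_deriv (L2_of_H1 y))"
  define g' where "g' = rep_L2 (weak_deriv (weak_deriv (L2_of_H1 y)))"
  define z where "z = cont_rep zz"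
  define z' where "z' = rep_L2 (weak_deriv zz)"
  define u where "u = cont_rep uu"
  define u' where "u' = rep_L2 (weak_deriv uu)"
  have d: "has_L2_deriv g g'" "has_L2_deriv z z'" "has_L2_deriv u u'"
    using H in_H1_cont_rep(1) by (simp_all add: g_def g'_def z_def z'_def u_def u'_def)
  have e: "weak_deriv (L2_of_H1 y) = abs_L2 g" "zz = abs_L2 z" "uu = abs_L2 u"
    using H in_H1_cont_rep(2) by (simp_all add: g_def z_def u_def)
  have w: "weak_deriv zz = abs_L2 z'" "weak_deriv uu = abs_L2 u'" by (simp_all add: z'_def u'_def abs_rep_L2)
  have p: "has_L2_deriv (\<lambda>x. c x * g x) (\<lambda>x. c' x * g x + c x * g' x)"
    by (rule has_L2_deriv_mult[OF c_deriv d(1)])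
  have flux: "flux a y = abs_L2 (\<lambda>x. c x * g x)"
    using mulL2_abs[OF c_cont square_integrable_continuous[OF has_L2_deriv_continuous[OF d(1)]]] e(1)
    by (simp add: flux_def mulL2_def)
  note Hp = has_L2_deriv_imp_in_H1[OF p]
  have Hz: "in_H1 (abs_L2 z)" using H(2) e(2) by simp
  have A: "A \<Phi> = (Abs_H1 (abs_L2 z), abs_L2 (\<lambda>x. c' x * g x + c x * g' x), (- 1 / \<tau>) *\<^sub>R abs_L2 u',
      (c 0 * g 0 - \<beta> * z 0 + \<alpha> * u 1) / m, - (c 1 * g 1 / M))"
  proof -
    have "cont_rep (abs_L2 (\<lambda>x. c x * g x)) 0 = c 0 * g 0" "cont_rep (abs_L2 (\<lambda>x. c x * g x)) 1 = c 1 * g 1"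
      by (intro Hp(3); simp)+
    moreover have "\<xi> = z 0" using b by (simp add: z_def)
    moreover have "- (abs_L2 u' /\<^sub>R \<tau>) = (- 1 / \<tau>) *\<^sub>R abs_L2 u'" by (simp add: inverse_eq_divide)
    ultimately show ?thesis
      unfolding \<Phi> crane_op.simps flux Hp(2) w(2) e(2) by (simp only: u_def[symmetric])
  qed
  show thesis
  proof (rule that[OF d _ e(1) _ A])
    show "u 0 = z 0" using b(2) by (simp add: u_def z_def)
    show "\<Phi> = (y, abs_L2 z, abs_L2 u, z 0, z 1)"
      unfolding \<Phi> e(2,3)[symmetric] using b by (simp add: z_def)
    show "L2_of_H1 (Abs_H1 (abs_L2 z)) = abs_L2 z" using Hz by (simp add: Abs_H1_inverse)
    show "weak_deriv (abs_L2 z) = abs_L2 z'" unfolding e(2)[symmetric] by (rule w(1))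
    show "cont_rep (abs_L2 z) 0 = z 0" "cont_rep (abs_L2 u) 1 = u 1"
      unfolding e(2,3)[symmetric] by (simp_all add: z_def u_def)
  qed
qed

lemma ell_crane_op:
  assumes "\<Phi> \<in> crane_dom"
  shows "L (A \<Phi>) = 0"
  using assms
proof (cases rule: crane_domE)
  case (1 y g g' z z' u u')
  have "L (A \<Phi>) = (c 1 * g 1 - c 0 * g 0) + m * ((c 0 * g 0 - \<beta> * z 0 + \<alpha> * u 1) / m) + M * (- (c 1 * g 1 / M))
      + (\<beta> - \<alpha>) * z 0 + \<tau> * \<alpha> * (- 1 / \<tau> * (u 1 - u 0))"
    unfolding 1(7) ell.simps LINT_rep_L2 1(8) 1(10) inner_scaleR_right
      inner_one_deriv[OF has_L2_deriv_mult[OF c_deriv 1(1)]] inner_one_deriv[OF 1(3)] ..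
  also have "\<dots> = (c 1 * g 1 - c 0 * g 0) + (c 0 * g 0 - \<beta> * z 0 + \<alpha> * u 1) - c 1 * g 1
      + (\<beta> - \<alpha>) * z 0 - \<alpha> * (u 1 - z 0)"
    using pos by (simp add: 1(4))
  also have "\<dots> = 0" by (simp add: algebra_simps)
  finally show ?thesis .
qed

text \<open>
  The boundary terms of the string cancel against the equations of motion of the two masses, up to the
  control force. The transport equation contributes \<open>K / 2 * (\<xi>\<^sup>2 - u(1)\<^sup>2)\<close>.
\<close>

lemma crane_energy_rate:
  assumes "\<Phi> \<in> crane_dom"
  shows "S \<Phi> (A \<Phi>) = - ((\<beta> - K / 2) * (fst (snd (snd (snd \<Phi>))))\<^sup>2
    - \<alpha> * fst (snd (snd (snd \<Phi>))) * cont_rep (fst (snd (snd \<Phi>))) 1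
    + K / 2 * (cont_rep (fst (snd (snd \<Phi>))) 1)\<^sup>2)"
  using assms
proof (cases rule: crane_domE)
  case (1 y g g' z z' u u')
  note g = square_integrable_continuous[OF has_L2_deriv_continuous[OF 1(1)]]
  have L0: "L (A \<Phi>) = 0" by (rule ell_crane_op[OF assms])
  have p: "inner (abs_L2 (\<lambda>x. c x * g x)) (abs_L2 z') + inner (abs_L2 z) (abs_L2 (\<lambda>x. c' x * g x + c x * g' x))
      = c 1 * g 1 * z 1 - c 0 * g 0 * z 0"
    using inner_integration_by_parts[OF has_L2_deriv_mult[OF c_deriv 1(1)] 1(2)]
    by (simp add: inner_commute add.commute)
  have u: "2 * inner (abs_L2 u) (abs_L2 u') = (u 1)\<^sup>2 - (z 0)\<^sup>2"
    using inner_integration_by_parts[OF 1(3) 1(3)] 1(4)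
    by (simp add: inner_commute[of "abs_L2 u'"] power2_eq_square)
  have "S \<Phi> (A \<Phi>) = inner (abs_L2 (\<lambda>x. c x * g x)) (abs_L2 z')
      + inner (abs_L2 z) (abs_L2 (\<lambda>x. c' x * g x + c x * g' x))
      + K * \<tau> * (- 1 / \<tau> * inner (abs_L2 u) (abs_L2 u'))
      + m * z 0 * ((c 0 * g 0 - \<beta> * z 0 + \<alpha> * u 1) / m) + M * z 1 * (- (c 1 * g 1 / M))
      + \<omega> * L \<Phi> * L (A \<Phi>)"
    unfolding 1(6) 1(7)[unfolded 1(6)] inner_X_eq 1(5) 1(8) 1(9) mulL2_abs[OF c_cont g] inner_scaleR_right ..
  also have "\<dots> = (c 1 * g 1 * z 1 - c 0 * g 0 * z 0) - K / 2 * ((u 1)\<^sup>2 - (z 0)\<^sup>2)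
      + z 0 * (c 0 * g 0 - \<beta> * z 0 + \<alpha> * u 1) - z 1 * (c 1 * g 1)"
    unfolding p L0 u[symmetric] using pos by simp
  finally show ?thesis
    unfolding 1(6) by (simp add: 1(11) power2_eq_square algebra_simps)
qed

lemma crane_dissipative:
  assumes "\<Phi> \<in> crane_dom"
  shows "S \<Phi> (A \<Phi>) \<le> - min (\<beta> - K / 2 - \<bar>\<alpha>\<bar> / 2) (K / 2 - \<bar>\<alpha>\<bar> / 2)
    * ((fst (snd (snd (snd \<Phi>))))\<^sup>2 + (cont_rep (fst (snd (snd \<Phi>))) 1)\<^sup>2)"
proof -
  define \<xi> where "\<xi> = fst (snd (snd (snd \<Phi>)))"
  define r where "r = cont_rep (fst (snd (snd \<Phi>))) 1"
  let ?k = "min (\<beta> - K / 2 - \<bar>\<alpha>\<bar> / 2) (K / 2 - \<bar>\<alpha>\<bar> / 2)"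
  have "\<alpha> * \<xi> * r \<le> \<bar>\<alpha>\<bar> * (\<bar>\<xi>\<bar> * \<bar>r\<bar>)"
    by (metis abs_ge_self abs_mult mult.assoc)
  also have "\<dots> \<le> \<bar>\<alpha>\<bar> * ((\<xi>\<^sup>2 + r\<^sup>2) / 2)"
    using sum_squares_bound[of "\<bar>\<xi>\<bar>" "\<bar>r\<bar>"] by (intro mult_left_mono) auto
  finally have 1: "\<alpha> * \<xi> * r \<le> \<bar>\<alpha>\<bar> / 2 * \<xi>\<^sup>2 + \<bar>\<alpha>\<bar> / 2 * r\<^sup>2" by (simp add: algebra_simps)
  have "?k * \<xi>\<^sup>2 \<le> (\<beta> - K / 2 - \<bar>\<alpha>\<bar> / 2) * \<xi>\<^sup>2" "?k * r\<^sup>2 \<le> (K / 2 - \<bar>\<alpha>\<bar> / 2) * r\<^sup>2"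
    by (intro mult_right_mono; simp)+
  then show ?thesis
    using 1 unfolding crane_energy_rate[OF assms] \<xi>_def[symmetric] r_def[symmetric]
    by (simp only: left_diff_distrib distrib_left minus_mult_left[symmetric])
qed

text \<open>
  The exponent has derivative \<open>1 + \<bar>a'\<bar> / a\<^sub>0\<close> so that \<open>(a v)' = (a' - a - a \<bar>a'\<bar> / a\<^sub>0) v \<le> - a\<^sub>0 v\<close>:
  the unbounded function \<open>a'\<close> is absorbed.
\<close>

definition v where "v x = exp (- integral {0..x} (\<lambda>s. 1 + \<bar>c' s\<bar> / a\<^sub>0))"

definition v' where "v' x = - ((1 + \<bar>c' x\<bar> / a\<^sub>0) * v x)"

lemma weight_deriv: "has_L2_deriv v v'"
proof -
  have "square_integrable (\<lambda>s. \<bar>c' s\<bar>)" using rep_L2_square_integrable by (auto simp: square_integrable_def)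
  then have sq: "square_integrable (\<lambda>s. 1 + \<bar>c' s\<bar> / a\<^sub>0)"
    using square_integrable_add[OF square_integrable_const[of 1] square_integrable_cmult[of _ "1 / a\<^sub>0"]] by simp
  have "has_L2_deriv (\<lambda>x. integral {0..x} (\<lambda>s. 1 + \<bar>c' s\<bar> / a\<^sub>0)) (\<lambda>s. 1 + \<bar>c' s\<bar> / a\<^sub>0)"
    using sq by (simp add: has_L2_deriv_def)
  then have "has_L2_deriv (\<lambda>x. exp (- integral {0..x} (\<lambda>s. 1 + \<bar>c' s\<bar> / a\<^sub>0)))
      (\<lambda>x. - exp (- integral {0..x} (\<lambda>s. 1 + \<bar>c' s\<bar> / a\<^sub>0)) * (1 + \<bar>c' x\<bar> / a\<^sub>0))"
    by (rule has_L2_deriv_chain[of _ _ "\<lambda>x. exp (- x)" "\<lambda>x. - exp (- x)"])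
      (auto intro!: derivative_eq_intros continuous_intros)
  then show ?thesis by (simp add: v_def[abs_def] v'_def[abs_def] mult.commute)
qed

lemma weight_0: "v 0 = 1"
  by (simp add: v_def)

lemma weight_pos: "v x > 0"
  by (simp add: v_def)

lemma weight_ge: "x \<in> {0..1} \<Longrightarrow> v 1 \<le> v x"
proof -
  assume x: "x \<in> {0..1}"
  have "v 1 - v x = integral {x..1} v'"
    by (rule has_L2_deriv_diff_eq[OF weight_deriv]) (use x in auto)
  also have "\<dots> \<le> integral {x..1} (\<lambda>x. 0)"
  proof (rule integral_le)
    show "v' integrable_on {x..1}"
      by (rule square_integrable_integrable_on(1)[OF has_L2_derivD(1)[OF weight_deriv]]) (use x in auto)
    show "v' s \<le> 0" for s
      using weight_pos[of s] a0(1) by (simp add: v'_def add_nonneg_nonneg)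
  qed auto
  finally show ?thesis by simp
qed

text \<open>
  Here \<open>p = a y\<^sub>x\<close> is the tension and \<open>w = a v\<close>. The right hand side contains the time derivative
  \<open>\<integral> w (z z\<^sub>x + p\<^sub>x y\<^sub>x) dx\<close> of the weighted momentum \<open>\<integral> w z y\<^sub>x dx\<close>. As \<open>w y\<^sub>x = v p\<close>, its integrand is half of
  \<open>w (z\<^sup>2)\<^sub>x + v (p\<^sup>2)\<^sub>x\<close>, and integrating by parts puts the derivative on the weights \<open>v\<close> and \<open>w\<close>, where
  it has a sign. The Cauchy data at \<open>0\<close> remain as the only unfavourable terms.
\<close>

lemma momentum_estimate:
  assumes g: "has_L2_deriv g g'" and z: "has_L2_deriv z z'"
  shows "v 1 * a\<^sub>0 * (inner (mulL2 c (abs_L2 g)) (abs_L2 g) + inner (abs_L2 z) (abs_L2 z) + (z 1)\<^sup>2)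
    \<le> 2 * (inner (mulL2 (\<lambda>x. c x * v x) (abs_L2 z)) (abs_L2 z')
        + inner (mulL2 (\<lambda>x. c x * v x) (abs_L2 (\<lambda>x. c' x * g x + c x * g' x))) (abs_L2 g))
      + (c 0 * g 0)\<^sup>2 + c 0 * (z 0)\<^sup>2"
proof -
  note v = weight_deriv
  note p = has_L2_deriv_mult[OF c_deriv g]
  note w = has_L2_deriv_mult[OF c_deriv v]
  note vp = has_L2_deriv_mult[OF v p] and wz = has_L2_deriv_mult[OF w z]
  let ?p = "\<lambda>x. c x * g x" and ?p' = "\<lambda>x. c' x * g x + c x * g' x"
  let ?w = "\<lambda>x. c x * v x" and ?w' = "\<lambda>x. c' x * v x + c x * v' x"
  note cont = has_L2_deriv_continuous
  note sq = square_integrable_continuous[OF cont] has_L2_derivD(1) square_integrable_continuous_mult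
  have 1: "2 * inner (abs_L2 (\<lambda>x. v x * ?p x)) (abs_L2 ?p') + inner (abs_L2 (\<lambda>x. v' x * ?p x)) (abs_L2 ?p)
      = v 1 * (c 1 * g 1)\<^sup>2 - (c 0 * g 0)\<^sup>2"
  proof -
    have "abs_L2 (\<lambda>x. v' x * ?p x + v x * ?p' x) = abs_L2 (\<lambda>x. v' x * ?p x) + abs_L2 (\<lambda>x. v x * ?p' x)"
      using sq(3)[OF cont[OF p] sq(2)[OF v]] by (intro abs_L2_add sq(3)[OF cont[OF v] sq(2)[OF p]]) (simp add: mult.commute)
    moreover have "inner (abs_L2 (\<lambda>x. v x * ?p' x)) (abs_L2 ?p) = inner (abs_L2 (\<lambda>x. v x * ?p x)) (abs_L2 ?p')"
      unfolding inner_abs_L2[OF sq(3)[OF cont[OF v] sq(2)[OF p]] sq(1)[OF p]]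
        inner_abs_L2[OF sq(3)[OF cont[OF v] sq(1)[OF p]] sq(2)[OF p]] by (simp only: ac_simps)
    ultimately show ?thesis
      using inner_integration_by_parts[OF vp p] by (simp add: inner_add_left weight_0 power2_eq_square)
  qed
  have 2: "2 * inner (abs_L2 (\<lambda>x. ?w x * z x)) (abs_L2 z') + inner (abs_L2 (\<lambda>x. ?w' x * z x)) (abs_L2 z)
      = c 1 * v 1 * (z 1)\<^sup>2 - c 0 * (z 0)\<^sup>2"
  proof -
    have "abs_L2 (\<lambda>x. ?w' x * z x + ?w x * z' x) = abs_L2 (\<lambda>x. ?w' x * z x) + abs_L2 (\<lambda>x. ?w x * z' x)"
      using sq(3)[OF cont[OF z] sq(2)[OF w]] by (intro abs_L2_add sq(3)[OF cont[OF w] sq(2)[OF z]]) (simp add: mult.commute)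
    moreover have "inner (abs_L2 (\<lambda>x. ?w x * z' x)) (abs_L2 z) = inner (abs_L2 (\<lambda>x. ?w x * z x)) (abs_L2 z')"
      unfolding inner_abs_L2[OF sq(3)[OF cont[OF w] sq(2)[OF z]] sq(1)[OF z]]
        inner_abs_L2[OF sq(3)[OF cont[OF w] sq(1)[OF z]] sq(2)[OF z]] by (simp only: ac_simps)
    ultimately show ?thesis
      using inner_integration_by_parts[OF wz z] by (simp add: inner_add_left weight_0 power2_eq_square)
  qed
  have c0: "0 < c x" "a\<^sub>0 \<le> c x" if "x \<in> {0..1}" for x using a0 that by (auto intro: less_le_trans)
  have 3: "inner (abs_L2 (\<lambda>x. v' x * ?p x)) (abs_L2 ?p) \<le> inner (abs_L2 (\<lambda>x. (- (v 1 * a\<^sub>0)) * (c x * g x))) (abs_L2 g)"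
  proof (rule inner_abs_L2_mono)
    show "square_integrable (\<lambda>x. v' x * ?p x)"
      using sq(3)[OF cont[OF p] sq(2)[OF v]] by (simp add: mult.commute)
    fix x :: real assume x: "x \<in> {0..1}"
    have "v 1 \<le> - v' x"
    proof -
      have "v x * 1 \<le> v x * (1 + \<bar>c' x\<bar> / a\<^sub>0)" using weight_pos[of x] a0(1) by (intro mult_left_mono) auto
      also have "\<dots> = - v' x" by (simp add: v'_def)
      finally show ?thesis using weight_ge[OF x] by simp
    qed
    then have "v 1 * a\<^sub>0 * (c x * (g x)\<^sup>2) \<le> - v' x * c x * (c x * (g x)\<^sup>2)"
      using c0[OF x] a0(1) weight_pos[of 1] by (intro mult_right_mono mult_mono) auto
    then show "v' x * (c x * g x) * (c x * g x) \<le> - (v 1 * a\<^sub>0) * (c x * g x) * g x"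
      by (simp add: power2_eq_square algebra_simps)
  qed (intro sq(1)[OF p] sq(1)[OF g] square_integrable_cmult)+
  have 4: "inner (abs_L2 (\<lambda>x. ?w' x * z x)) (abs_L2 z) \<le> inner (abs_L2 (\<lambda>x. (- (v 1 * a\<^sub>0)) * z x)) (abs_L2 z)"
  proof (rule inner_abs_L2_mono)
    show "square_integrable (\<lambda>x. ?w' x * z x)"
      using sq(3)[OF cont[OF z] sq(2)[OF w]] by (simp add: mult.commute)
    fix x :: real assume x: "x \<in> {0..1}"
    have "a\<^sub>0 * (1 + \<bar>c' x\<bar> / a\<^sub>0) \<le> c x * (1 + \<bar>c' x\<bar> / a\<^sub>0)"
      using c0(2)[OF x] a0(1) by (intro mult_right_mono) auto
    then have "a\<^sub>0 \<le> c x * (1 + \<bar>c' x\<bar> / a\<^sub>0) - c' x"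
      using a0(1) abs_ge_self[of "c' x"] by (simp add: distrib_left)
    then have "v 1 * a\<^sub>0 \<le> v x * (c x * (1 + \<bar>c' x\<bar> / a\<^sub>0) - c' x)"
      using weight_ge[OF x] weight_pos[of x] a0(1) by (intro mult_mono) auto
    also have "\<dots> = - ?w' x" by (simp add: v'_def algebra_simps)
    finally have "v 1 * a\<^sub>0 * (z x)\<^sup>2 \<le> - ?w' x * (z x)\<^sup>2" by (intro mult_right_mono) auto
    then show "?w' x * z x * z x \<le> - (v 1 * a\<^sub>0) * z x * z x"
      by (simp add: power2_eq_square algebra_simps)
  qed (intro sq(1)[OF z] square_integrable_cmult)+
  have 5: "v 1 * a\<^sub>0 * (z 1)\<^sup>2 \<le> c 1 * v 1 * (z 1)\<^sup>2"
    using c0(2)[of 1] weight_pos[of 1] by (intro mult_right_mono) (auto simp: mult.commute)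
  have 6: "0 \<le> v 1 * (c 1 * g 1)\<^sup>2" using weight_pos[of 1] by simp
  have "inner (mulL2 ?w (abs_L2 ?p')) (abs_L2 g) = inner (abs_L2 (\<lambda>x. v x * ?p x)) (abs_L2 ?p')"
    unfolding mulL2_abs[OF cont[OF w] sq(2)[OF p]] inner_abs_L2[OF sq(3)[OF cont[OF w] sq(2)[OF p]] sq(1)[OF g]]
      inner_abs_L2[OF sq(3)[OF cont[OF v] sq(1)[OF p]] sq(2)[OF p]] by (simp only: ac_simps)
  moreover have "inner (abs_L2 (\<lambda>x. (- (v 1 * a\<^sub>0)) * (c x * g x))) (abs_L2 g) =
      - (v 1 * a\<^sub>0) * inner (abs_L2 ?p) (abs_L2 g)"
    "inner (abs_L2 (\<lambda>x. (- (v 1 * a\<^sub>0)) * z x)) (abs_L2 z) = - (v 1 * a\<^sub>0) * inner (abs_L2 z) (abs_L2 z)"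
    using abs_L2_cmult[OF sq(1)[OF p], of "- (v 1 * a\<^sub>0)"] abs_L2_cmult[OF sq(1)[OF z], of "- (v 1 * a\<^sub>0)"]
    by simp_all
  ultimately show ?thesis
    using 1 2 3 4 5 6 unfolding mulL2_abs[OF cont[OF w] sq(1)[OF z]] mulL2_abs[OF c_cont sq(1)[OF g]]
      distrib_left minus_mult_left[symmetric]
    by linarith
qed

text \<open>
  The time derivative of \<open>Q \<Phi> \<Phi>\<close> is the part of the energy estimate that is not
  controlled by dissipation: the weighted momentum of the string and the weighted energy of the delay
  line, scaled so that they cover the corresponding parts of the inner product.
\<close>

definition Q :: "state \<Rightarrow> state \<Rightarrow> real" where
  "Q \<Phi> \<Psi> = 2 * (1 + M) / (v 1 * a\<^sub>0) *
      inner (mulL2 (\<lambda>x. c x * v x) (fst (snd \<Phi>))) (weak_deriv (L2_of_H1 (fst \<Psi>)))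
    - K * \<tau>\<^sup>2 * inner (mulL2 (\<lambda>x. 2 - x) (fst (snd (snd \<Phi>)))) (fst (snd (snd \<Psi>)))"

lemma cv_cont: "continuous_on {0..1} (\<lambda>x. c x * v x)"
  by (intro continuous_on_mult c_cont has_L2_deriv_continuous[OF weight_deriv])

lemma bounded_bilinear_Q: "bounded_bilinear Q"
proof -
  let ?W = "\<lambda>\<Phi>::state. ((2 * (1 + M) / (v 1 * a\<^sub>0)) *\<^sub>R mulL2 (\<lambda>x. c x * v x) (fst (snd \<Phi>)),
      (- (K * \<tau>\<^sup>2)) *\<^sub>R mulL2 (\<lambda>x. 2 - x) (fst (snd (snd \<Phi>))))"
  let ?J = "\<lambda>\<Phi>::state. (weak_deriv (L2_of_H1 (fst \<Phi>)), fst (snd (snd \<Phi>)))"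
  have eq: "Q = (\<lambda>\<Phi> \<Psi>. inner (?W \<Phi>) (?J \<Psi>))"
    by (intro ext) (simp add: Q_def inner_prod_def)
  have c2: "continuous_on {0..1} (\<lambda>x::real. 2 - x)" by (intro continuous_intros)
  show ?thesis
    unfolding eq
    by (intro bounded_bilinear.comp[OF bounded_bilinear_inner] bounded_linear_Pair
        bounded_linear_compose[OF bounded_linear_scaleR_right]
        bounded_linear_compose[OF bounded_linear_mulL2[OF cv_cont]]
        bounded_linear_compose[OF bounded_linear_mulL2[OF c2]]
        bounded_linear_compose[OF bounded_linear_weak_deriv_H1]
        bounded_linear_fst_comp bounded_linear_snd_comp bounded_linear_ident)
qed

text \<open>
  The contributions come from the tension and the velocity at \<open>x = 0\<close>, the delay line, and the mass
  \<open>m\<close>, in this order.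
\<close>

definition obs_const :: real where
  "obs_const = (1 + M) / (v 1 * a\<^sub>0) * (3 * (m\<^sup>2 + \<beta>\<^sup>2 + \<alpha>\<^sup>2) + c 0) + 2 * K * \<tau> + m"

lemma obs_const_nonneg: "0 \<le> obs_const"
  unfolding obs_const_def using pos a0(1) a0(2)[of 0] weight_pos[of 1]
  by (intro add_nonneg_nonneg mult_nonneg_nonneg divide_nonneg_nonneg) auto

text \<open>
  The momentum estimate needs the tension at \<open>0\<close>, which the boundary condition expresses through
  \<open>\<xi>\<close>, \<open>u(1)\<close> and the acceleration, that is, through the component of \<open>A \<Phi>\<close> that belongs to \<open>\<xi>\<close>.
\<close>

lemma crane_observability:
  assumes dom: "\<Phi> \<in> crane_dom" and L0: "L \<Phi> = 0"
  shows "S \<Phi> \<Phi> \<le> obs_const * ((fst (snd (snd (snd \<Phi>))))\<^sup>2 + (cont_rep (fst (snd (snd \<Phi>))) 1)\<^sup>2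
      + (fst (snd (snd (snd (A \<Phi>)))))\<^sup>2) + Q \<Phi> (A \<Phi>) + Q (A \<Phi>) \<Phi>"
  using dom
proof (cases rule: crane_domE)
  case (1 y g g' z z' u u')
  define \<kappa> where "\<kappa> = (1 + M) / (v 1 * a\<^sub>0)"
  have \<kappa>: "0 < \<kappa>" using pos a0(1) weight_pos[of 1] by (simp add: \<kappa>_def)
  define \<xi>' where "\<xi>' = (c 0 * g 0 - \<beta> * z 0 + \<alpha> * u 1) / m"
  define X where "X = (z 0)\<^sup>2 + (u 1)\<^sup>2 + \<xi>'\<^sup>2"
  have X: "(z 0)\<^sup>2 \<le> X" "(u 1)\<^sup>2 \<le> X" "\<xi>'\<^sup>2 \<le> X" "0 \<le> X" by (auto simp: X_def)
  define E where "E = inner (mulL2 c (abs_L2 g)) (abs_L2 g) + inner (abs_L2 z) (abs_L2 z)"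
  define R where "R = inner (mulL2 (\<lambda>x. c x * v x) (abs_L2 z)) (abs_L2 z')
        + inner (mulL2 (\<lambda>x. c x * v x) (abs_L2 (\<lambda>x. c' x * g x + c x * g' x))) (abs_L2 g)"
  define D where "D = inner (mulL2 (\<lambda>x. 2 - x) (abs_L2 u)) (abs_L2 u')"
  note sg = square_integrable_continuous[OF has_L2_deriv_continuous[OF 1(1)]]
  have c2: "continuous_on {0..1} (\<lambda>x::real. 2 - x)" by (intro continuous_intros)
  have cpos: "0 < c x" if "x \<in> {0..1}" for x using a0 that by (auto intro: less_le_trans)
  have "0 \<le> inner (mulL2 c (abs_L2 g)) (abs_L2 g)"
    unfolding mulL2_abs[OF c_cont sg] inner_abs_L2[OF square_integrable_continuous_mult[OF c_cont sg] sg]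
    by (intro integral_nonneg set_lebesgue_integral_eq_integral(1) integrable_leb01_absolutely
        square_integrable_mult square_integrable_continuous_mult[OF c_cont sg] sg)
      (metis cpos less_imp_le mult.assoc mult_nonneg_nonneg zero_le_square)
  then have E0: "0 \<le> E" by (simp add: E_def)
  have p0: "(c 0 * g 0)\<^sup>2 \<le> 3 * (m\<^sup>2 + \<beta>\<^sup>2 + \<alpha>\<^sup>2) * X"
  proof -
    have sq3: "(p + q - r)\<^sup>2 \<le> 3 * (p\<^sup>2 + q\<^sup>2 + r\<^sup>2)" for p q r :: real
      using zero_le_power2[of "p - q"] zero_le_power2[of "p + r"] zero_le_power2[of "q + r"]
      by (simp add: power2_eq_square algebra_simps)
    have "c 0 * g 0 = m * \<xi>' + \<beta> * z 0 - \<alpha> * u 1" using pos by (simp add: \<xi>'_def)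
    then have "(c 0 * g 0)\<^sup>2 \<le> 3 * (m\<^sup>2 * \<xi>'\<^sup>2 + \<beta>\<^sup>2 * (z 0)\<^sup>2 + \<alpha>\<^sup>2 * (u 1)\<^sup>2)"
      using sq3[of "m * \<xi>'" "\<beta> * z 0" "\<alpha> * u 1"] by (simp add: power_mult_distrib)
    also have "\<dots> \<le> 3 * (m\<^sup>2 * X + \<beta>\<^sup>2 * X + \<alpha>\<^sup>2 * X)"
      using X by (intro mult_left_mono add_mono) auto
    finally show ?thesis by (simp add: algebra_simps)
  qed
  have "v 1 * a\<^sub>0 * (E + (z 1)\<^sup>2) \<le> 2 * R + (c 0 * g 0)\<^sup>2 + c 0 * (z 0)\<^sup>2"
    using momentum_estimate[OF 1(1,2)] by (simp add: E_def R_def)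
  then have "\<kappa> * (v 1 * a\<^sub>0 * (E + (z 1)\<^sup>2)) \<le> \<kappa> * (2 * R + (c 0 * g 0)\<^sup>2 + c 0 * (z 0)\<^sup>2)"
    using \<kappa> by (intro mult_left_mono) auto
  moreover have "\<kappa> * (v 1 * a\<^sub>0 * (E + (z 1)\<^sup>2)) = (1 + M) * (E + (z 1)\<^sup>2)"
    using a0(1) weight_pos[of 1] by (simp add: \<kappa>_def)
  moreover have "E + M * (z 1)\<^sup>2 \<le> (1 + M) * (E + (z 1)\<^sup>2)"
    using mult_nonneg_nonneg[OF less_imp_le[OF pos(2)] E0] by (simp add: algebra_simps)
  moreover have "\<kappa> * (2 * R + (c 0 * g 0)\<^sup>2 + c 0 * (z 0)\<^sup>2) \<le>
      \<kappa> * (2 * R + 3 * (m\<^sup>2 + \<beta>\<^sup>2 + \<alpha>\<^sup>2) * X + c 0 * X)"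
    using \<kappa> p0 X(1) cpos[of 0] by (intro mult_left_mono add_mono order_refl) auto
  ultimately have wave: "E + M * (z 1)\<^sup>2 \<le> 2 * \<kappa> * R + \<kappa> * (3 * (m\<^sup>2 + \<beta>\<^sup>2 + \<alpha>\<^sup>2) + c 0) * X"
    by (simp add: algebra_simps)
  have "K * \<tau> * inner (abs_L2 u) (abs_L2 u) = K * \<tau> * (2 * (z 0)\<^sup>2 - (u 1)\<^sup>2) + 2 * K * \<tau> * D"
    unfolding delay_energy_identity[OF 1(3)] D_def 1(4) by (simp add: algebra_simps)
  also have "K * \<tau> * (2 * (z 0)\<^sup>2 - (u 1)\<^sup>2) \<le> K * \<tau> * (2 * X)"
  proof (intro mult_left_mono)
    show "2 * (z 0)\<^sup>2 - (u 1)\<^sup>2 \<le> 2 * X" using X(1) zero_le_power2[of "u 1"] by linarith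
  qed (use pos in simp)
  finally have delay: "K * \<tau> * inner (abs_L2 u) (abs_L2 u) \<le> 2 * K * \<tau> * X + 2 * K * \<tau> * D" by simp
  have S: "S \<Phi> \<Phi> = E + K * \<tau> * inner (abs_L2 u) (abs_L2 u) + m * (z 0)\<^sup>2 + M * (z 1)\<^sup>2"
    using L0 unfolding 1(6) inner_X_eq 1(5) E_def by (simp add: power2_eq_square del: ell.simps)
  have scale: "mulL2 (\<lambda>x. 2 - x) ((- 1 / \<tau>) *\<^sub>R abs_L2 u') = (- 1 / \<tau>) *\<^sub>R mulL2 (\<lambda>x. 2 - x) (abs_L2 u')"
    by (rule linear_scale[OF bounded_linear.linear[OF bounded_linear_mulL2[OF c2]]])
  have Q: "Q \<Phi> (A \<Phi>) + Q (A \<Phi>) \<Phi> = 2 * \<kappa> * R + 2 * K * \<tau> * D"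
  proof -
    have "Q \<Phi> (A \<Phi>) + Q (A \<Phi>) \<Phi> = 2 * \<kappa> * R - K * \<tau>\<^sup>2 * ((- 1 / \<tau>) * D + (- 1 / \<tau>) * D)"
      unfolding Q_def 1(7) unfolding 1(6) fst_conv snd_conv 1(5) 1(8) 1(9) scale inner_scaleR_left inner_scaleR_right
        inner_mulL2_commute[OF c2, of "abs_L2 u'"] R_def D_def \<kappa>_def
      by (simp only: distrib_left times_divide_eq_right)
    also have "K * \<tau>\<^sup>2 * ((- 1 / \<tau>) * D + (- 1 / \<tau>) * D) = - (2 * K * \<tau> * D)"
      using pos by (simp add: power2_eq_square)
    finally show ?thesis by simp
  qed
  have "obs_const * X = \<kappa> * (3 * (m\<^sup>2 + \<beta>\<^sup>2 + \<alpha>\<^sup>2) + c 0) * X + 2 * K * \<tau> * X + m * X"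
    by (simp add: obs_const_def \<kappa>_def distrib_right)
  moreover have "m * (z 0)\<^sup>2 \<le> m * X" using pos X(1) by (intro mult_left_mono) auto
  ultimately have "S \<Phi> \<Phi> \<le> obs_const * X + (Q \<Phi> (A \<Phi>) + Q (A \<Phi>) \<Phi>)"
    using wave delay unfolding S Q by linarith
  moreover have "fst (snd (snd (snd \<Phi>))) = z 0" "cont_rep (fst (snd (snd \<Phi>))) 1 = u 1"
    unfolding 1(6) by (simp_all add: 1(11))
  moreover have "fst (snd (snd (snd (A \<Phi>)))) = \<xi>'" unfolding 1(7) by (simp add: \<xi>'_def)
  ultimately show ?thesis by (simp add: X_def)
qed

end

section \<open>Convergence to the equilibrium\<close>

lemma cont_rep_const: "x \<in> {0..1} \<Longrightarrow> cont_rep (abs_L2 (\<lambda>x. r)) x = r"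
  by (rule has_L2_deriv_imp_in_H1(3)[OF has_L2_deriv_const])

lemma equilibrium_in_crane_dom: "(const_H1 r, 0, 0, 0, 0) \<in> crane_dom"
  and equilibrium_crane_op: "crane_op a m M \<tau> \<alpha> \<beta> (const_H1 r, 0, 0, 0, 0) = 0"
  and equilibrium_ell: "ell m M \<tau> \<alpha> \<beta> (const_H1 r, 0, 0, 0, 0) = (\<beta> - \<alpha>) * r"
proof -
  have w: "weak_deriv (L2_of_H1 (const_H1 r)) = 0"
    unfolding const_H1.rep_eq by (rule weak_deriv_eq[OF has_weak_deriv_const])
  have w0: "weak_deriv 0 = 0" by (rule weak_deriv_eq[OF has_weak_deriv_0])
  have t0: "cont_rep 0 x = 0" if "x \<in> {0..1}" for x
    using cont_rep_const[OF that, of 0] by (simp add: zero_L2_def)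
  have ca: "continuous_on {0..1} (cont_rep (L2_of_H1 a))"
    by (rule has_L2_deriv_continuous[OF in_H1_cont_rep(1)[OF in_H1_L2_of_H1]])
  have flux: "flux a (const_H1 r) = 0"
    using linear_0[OF bounded_linear.linear[OF bounded_linear_mulL2[OF ca]]]
    by (simp add: flux_def mulL2_def w)
  show "(const_H1 r, 0, 0, 0, 0) \<in> crane_dom"
    using t0[of 0] t0[of 1] by (simp add: crane_dom_def w in_H1_0)
  show "crane_op a m M \<tau> \<alpha> \<beta> (const_H1 r, 0, 0, 0, 0) = 0"
    using t0[of 0] t0[of 1] by (simp add: flux w0 zero_prod_def zero_H1_def)
  show "ell m M \<tau> \<alpha> \<beta> (const_H1 r, 0, 0, 0, 0) = (\<beta> - \<alpha>) * r"
    by (simp add: LINT_rep_L2 const_H1.rep_eq cont_rep_const)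
qed

lemma equivalent_norm_X_imp_coercive:
  assumes "equivalent_norms (norm_X a m M \<tau> \<alpha> \<beta> K \<omega>) norm"
  shows "\<exists>k>0. \<forall>\<Phi>. k * (norm \<Phi>)\<^sup>2 \<le> inner_X a m M \<tau> \<alpha> \<beta> K \<omega> \<Phi> \<Phi>"
proof -
  obtain k where k: "k > 0" "\<And>\<Phi>. k * norm \<Phi> \<le> norm_X a m M \<tau> \<alpha> \<beta> K \<omega> \<Phi>"
    using assms by (auto simp: equivalent_norms_def)
  have "k\<^sup>2 * (norm \<Phi>)\<^sup>2 \<le> inner_X a m M \<tau> \<alpha> \<beta> K \<omega> \<Phi> \<Phi>" for \<Phi>
  proof -
    have le: "0 \<le> k * norm \<Phi>" "k * norm \<Phi> \<le> sqrt (inner_X a m M \<tau> \<alpha> \<beta> K \<omega> \<Phi> \<Phi>)"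
      using k by (auto simp: norm_X_def)
    then have "0 \<le> sqrt (inner_X a m M \<tau> \<alpha> \<beta> K \<omega> \<Phi> \<Phi>)" by (rule order_trans)
    then have "(sqrt (inner_X a m M \<tau> \<alpha> \<beta> K \<omega> \<Phi> \<Phi>))\<^sup>2 = inner_X a m M \<tau> \<alpha> \<beta> K \<omega> \<Phi> \<Phi>" by simp
    then show ?thesis using power_mono[OF le(2,1), of 2] by (simp add: power_mult_distrib)
  qed
  then show ?thesis using k(1) by (intro exI[of _ "k\<^sup>2"]) auto
qed

theorem theorem3:
  fixes a y\<^sub>0 :: H1 and y\<^sub>1 :: L2 and f :: "real \<Rightarrow> real"
    and a\<^sub>0 m M \<tau> \<alpha> \<beta> K \<omega> \<xi>\<^sub>0 \<eta>\<^sub>0 :: real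
    and T :: "real \<Rightarrow> state \<Rightarrow> state"
  assumes "m > 0" "M > 0" "\<tau> > 0" "\<beta> > 0" "K > 0"
    and "a\<^sub>0 > 0" "\<forall>x\<in>{0..1}. cont_rep (L2_of_H1 a) x \<ge> a\<^sub>0"
    and "\<bar>\<alpha>\<bar> < \<beta>" "\<bar>\<alpha>\<bar> < K" "K < 2 * \<beta> - \<bar>\<alpha>\<bar>"
    and "\<omega> > 0" "equivalent_norms (norm_X a m M \<tau> \<alpha> \<beta> K \<omega>) norm"
    and "C0_semigroup T" "is_generator T crane_dom (crane_op a m M \<tau> \<alpha> \<beta>)"
    and "square_integrable (\<lambda>x. f (- \<tau> * x))"
  shows "let \<Omega> = 1 / (\<beta> - \<alpha>) * ((LINT x|leb01. rep_L2 y\<^sub>1 x)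
              + \<alpha> * \<tau> * (LINT x|leb01. f (- \<tau> * x))
              + (\<beta> - \<alpha>) * cont_rep (L2_of_H1 y\<^sub>0) 0 + m * \<xi>\<^sub>0 + M * \<eta>\<^sub>0)
    in ((\<lambda>t. norm_X a m M \<tau> \<alpha> \<beta> K \<omega>
          (T t (y\<^sub>0, y\<^sub>1, abs_L2 (\<lambda>x. f (- \<tau> * x)), \<xi>\<^sub>0, \<eta>\<^sub>0)
            - (const_H1 \<Omega>, 0, 0, 0, 0))) \<longlongrightarrow> 0) at_top"
proof -
  interpret crane a a\<^sub>0 m M \<tau> \<alpha> \<beta> K \<omega>
    by unfold_locales (use assms in auto)
  note T = assms(13) and gen = assms(14)
  have \<mu>: "\<beta> - \<alpha> \<noteq> 0" using assms(8) by auto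
  obtain k where k: "k > 0" "\<And>\<Phi>. k * (norm \<Phi>)\<^sup>2 \<le> S \<Phi> \<Phi>"
    using equivalent_norm_X_imp_coercive[OF assms(12)] by blast
  define \<Omega> where "\<Omega> = 1 / (\<beta> - \<alpha>) * ((LINT x|leb01. rep_L2 y\<^sub>1 x)
              + \<alpha> * \<tau> * (LINT x|leb01. f (- \<tau> * x))
              + (\<beta> - \<alpha>) * cont_rep (L2_of_H1 y\<^sub>0) 0 + m * \<xi>\<^sub>0 + M * \<eta>\<^sub>0)"
  define \<Phi>\<^sub>0 where "\<Phi>\<^sub>0 = (y\<^sub>0, y\<^sub>1, abs_L2 (\<lambda>x. f (- \<tau> * x)), \<xi>\<^sub>0, \<eta>\<^sub>0)"
  define E where "E r = (const_H1 r, 0 :: L2, 0 :: L2, 0 :: real, 0 :: real)" for r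
  have ED: "E r \<in> crane_dom" "A (E r) = 0" "L (E r) = (\<beta> - \<alpha>) * r" for r
    unfolding E_def by (rule equilibrium_in_crane_dom equilibrium_crane_op equilibrium_ell)+
  interpret L: bounded_linear L by (rule ell_bounded_linear)
  have f1: "(LINT x|leb01. rep_L2 (abs_L2 (\<lambda>x. f (- \<tau> * x))) x) = (LINT x|leb01. f (- \<tau> * x))"
    by (rule integral_cong_AE) (use rep_abs_L2[OF assms(15)] assms(15) in \<open>auto simp: square_integrable_def\<close>)
  have "L \<Phi>\<^sub>0 = (\<beta> - \<alpha>) * \<Omega>"
  proof -
    have "(\<beta> - \<alpha>) * \<Omega> = (LINT x|leb01. rep_L2 y\<^sub>1 x) + \<alpha> * \<tau> * (LINT x|leb01. f (- \<tau> * x))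
        + (\<beta> - \<alpha>) * cont_rep (L2_of_H1 y\<^sub>0) 0 + m * \<xi>\<^sub>0 + M * \<eta>\<^sub>0"
      using \<mu> by (simp add: \<Omega>_def)
    then show ?thesis unfolding \<Phi>\<^sub>0_def ell.simps f1 by (simp add: mult.commute)
  qed
  then have L0: "L (\<Phi>\<^sub>0 - E \<Omega>) = 0" by (simp add: L.diff ED(3))
  have b: "bounded_linear (\<lambda>\<Phi>::state. fst (snd (snd (snd \<Phi>))))"
    by (intro bounded_linear_fst_comp bounded_linear_snd_comp bounded_linear_ident)
  have kd: "min (\<beta> - K / 2 - \<bar>\<alpha>\<bar> / 2) (K / 2 - \<bar>\<alpha>\<bar> / 2) > 0" using assms(9,10) by auto
  have LE: "L (E (1 / (\<beta> - \<alpha>))) = 1" using \<mu> by (simp add: ED(3))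
  have "((\<lambda>t. S (T t (\<Phi>\<^sub>0 - E \<Omega>)) (T t (\<Phi>\<^sub>0 - E \<Omega>))) \<longlongrightarrow> 0) at_top"
    by (rule lyapunov_imp_strongly_stable[OF T gen crane_dom_dense inner_X_bounded_bilinear
          inner_X_commute k bounded_bilinear_Q b ell_bounded_linear zero_le_power2 kd obs_const_nonneg
          crane_dissipative crane_observability ell_crane_op ED(1) LE L0])
  then have "((\<lambda>t. norm_X a m M \<tau> \<alpha> \<beta> K \<omega> (T t (\<Phi>\<^sub>0 - E \<Omega>))) \<longlongrightarrow> 0) at_top"
    unfolding norm_X_def using tendsto_real_sqrt by fastforce
  moreover have "\<forall>\<^sub>F t in at_top. norm_X a m M \<tau> \<alpha> \<beta> K \<omega> (T t (\<Phi>\<^sub>0 - E \<Omega>)) =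
      norm_X a m M \<tau> \<alpha> \<beta> K \<omega> (T t \<Phi>\<^sub>0 - E \<Omega>)"
    using eventually_ge_at_top[of 0]
  proof eventually_elim
    case (elim t)
    then show ?case
      using linear_diff[OF bounded_linear.linear[OF C0_semigroupD(1)[OF T elim]], of \<Phi>\<^sub>0 "E \<Omega>"]
        orbit_equilibrium[OF T gen ED(1,2) elim] by simp
  qed
  ultimately have "((\<lambda>t. norm_X a m M \<tau> \<alpha> \<beta> K \<omega> (T t \<Phi>\<^sub>0 - E \<Omega>)) \<longlongrightarrow> 0) at_top"
    by (rule Lim_transform_eventually)
  then show ?thesis unfolding Let_def \<Omega>_def[symmetric] \<Phi>\<^sub>0_def E_def .
qed

end
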